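(* Suppose that for the family $f_c(z)=z^2+c$ all non-constant polynomials $\Delta_{n,m}\in\mathbb{Z}[c]$ (positive integers $m\mid n$) are irreducible over $\mathbb{Q}$. Then each parabolic parameter for $f_c(z)=z^2+c$ of degree $3$ over $\mathbb{Q}$ is a root of one of the following polynomials: $$64c^3+128c^2+72c+81,\qquad 64c^3+144c^2+108c+135.$$
   Context: $\gamma\in\mathbb{C}$ is a parabolic parameter if $f_\gamma(z)=z^2+\gamma$ has a parabolic periodic point in $\mathbb{C}$, i.e. a point $\alpha$ of some period $m$ whose multiplier $(f_\gamma^{\circ m})'(\alpha)$ is a root of unity. Definition of $\Delta_{n,m}$: with $c$ an indeterminate and $f(z)=z^2+c$, let $\Phi_n^*(z)=\prod_{k\mid n}(f^{\circ k}(z)-z)^{\mu(n/k)}$ ($\mu$ the Möbius function), and let $\delta_n(x)\in\mathbb{Z}[c][x]$ be the monic polynomial in $x$ with $\delta_n(x)^n=\prod_{\Phi_n^*(\alpha)=0}(x-(f^{\circ n})'(\alpha))$ (roots in $\overline{\mathbb{Q}(c)}$ with multiplicity). For $m\mid n$, $m<n$, put $\Delta_{n,m}=\mathrm{Res}_x(\Phi^{\mathrm{cyc}}_{n/m}(x),\delta_m(x))$, where $\Phi^{\mathrm{cyc}}_i$ is the $i$-th cyclotomic polynomial, and define $\Delta_{n,n}$ by $\delta_n(1)=\Delta_{n,n}\prod_{m\mid n,\,m\ne n}\Delta_{n,m}$. All $\Delta_{n,m}$ are polynomials in $\mathbb{Z}[c]$. *)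

theory Defs
  imports
    "HOL-Analysis.Analysis"
    "HOL-Algebra.Algebraic_Closure_Type"
    "HOL-Number_Theory.Totient"
    "Subresultants.Resultant_Prelim"
begin

hide_const (open)
  Polynomials.lead_coeff Polynomials.degree
  Divisibility.irreducible

definition moebius_mu :: "nat \<Rightarrow> int" where
  "moebius_mu n = (if squarefree n then (-1) ^ card (prime_factors n) else 0)"

text \<open>
  Throughout, \<open>int poly\<close> plays the role of \<open>\<int>[c]\<close>, with \<open>[:0, 1:]\<close> as the indeterminate \<open>c\<close>, and
  \<open>int poly poly\<close> that of \<open>\<int>[c][z]\<close> or \<open>\<int>[c][x]\<close>.
\<close>

definition quad_iter :: "nat \<Rightarrow> int poly poly" where
  "quad_iter k = (pcompose [:[:0, 1:], 0, 1:] ^^ k) [:0, 1:]"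

text \<open>
  The exponents below may be \<open>-1\<close>, so the product is formed in the fraction field of \<open>\<int>[c][z]\<close>;
  its value is (the image of) a polynomial.
\<close>

definition dynatomic :: "nat \<Rightarrow> int poly poly" where
  "dynatomic n = (THE p. to_fract p =
     (\<Prod>k | k dvd n. to_fract (quad_iter k - [:0, 1:]) powi moebius_mu (n div k)))"

text \<open>The fraction field of \<open>\<int>[c]\<close> is \<open>\<rat>(c)\<close>.\<close>

type_synonym Qc_closure = "int poly fract alg_closure"

definition embed_Qc :: "int poly \<Rightarrow> Qc_closure" where
  "embed_Qc a = to_ac (to_fract a)"

definition delta :: "nat \<Rightarrow> int poly poly" where
  "delta n = (THE d. lead_coeff d = 1 \<and>
     map_poly embed_Qc d ^ n =
       (\<Prod>\<alpha>\<in>#proots (map_poly embed_Qc (dynatomic n)).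
          [:- poly (pderiv (map_poly embed_Qc (quad_iter n))) \<alpha>, 1:]))"

definition cyclotomic :: "nat \<Rightarrow> int poly" where
  "cyclotomic i = (THE p. map_poly complex_of_int p =
     (\<Prod>k\<in>totatives i. [:- cis (2 * pi * real k / real i), 1:]))"

text \<open>
  The inner \<open>map_poly\<close> regards the cyclotomic polynomial as an element of \<open>\<int>[c][x]\<close> by turning its
  integer coefficients into constants of \<open>\<int>[c]\<close>.
\<close>

definition Delta_res :: "nat \<Rightarrow> nat \<Rightarrow> int poly" where
  "Delta_res n m = resultant (map_poly (\<lambda>a. [:a:]) (cyclotomic (n div m))) (delta m)"

definition Delta :: "nat \<Rightarrow> nat \<Rightarrow> int poly" where
  "Delta n m =
     (if m = n
      then THE d. poly (delta n) 1 = d * (\<Prod>k | k dvd n \<and> k \<noteq> n. Delta_res n k)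
      else Delta_res n m)"

definition has_exact_period :: "('a \<Rightarrow> 'a) \<Rightarrow> nat \<Rightarrow> 'a \<Rightarrow> bool" where
  "has_exact_period f m z \<longleftrightarrow> m > 0 \<and> (f ^^ m) z = z \<and> (\<forall>k. 0 < k \<and> k < m \<longrightarrow> (f ^^ k) z \<noteq> z)"

definition root_of_unity :: "complex \<Rightarrow> bool" where
  "root_of_unity w \<longleftrightarrow> (\<exists>k>0. w ^ k = 1)"

definition parabolic_parameter :: "complex \<Rightarrow> bool" where
  "parabolic_parameter \<gamma> \<longleftrightarrow>
     (\<exists>\<alpha> m. has_exact_period (\<lambda>z. z ^ 2 + \<gamma>) m \<alpha> \<and>
            root_of_unity (deriv ((\<lambda>z. z ^ 2 + \<gamma>) ^^ m) \<alpha>))"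

text \<open>The polynomial \<open>p\<close> is necessarily the minimal polynomial of \<open>z\<close> over \<open>\<rat>\<close>.\<close>

definition has_degree_over_rat :: "complex \<Rightarrow> nat \<Rightarrow> bool" where
  "has_degree_over_rat z d \<longleftrightarrow>
     (\<exists>p :: rat poly. lead_coeff p = 1 \<and> irreducible p \<and> degree p = d \<and> poly (map_poly of_rat p) z = 0)"

end

theory Submission
  imports Defs "Subresultants.Subresultant"
begin

hide_const (open)
  up_ring.coeff up_ring.monom module.smult Coset.order Divisibility.prime

text \<open>
  Irreducibility turns the statement into a computation of degrees. If \<open>\<gamma>\<close> is parabolic, it is a
  root of some \<open>\<Delta>\<^sub>n\<^sub>,\<^sub>k\<close>; if \<open>\<gamma>\<close> is moreover cubic and this polynomial is irreducible, the polynomial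
  has degree \<open>3\<close>. The degree of \<open>\<Delta>\<^sub>n\<^sub>,\<^sub>k\<close> is known for all \<open>n\<close> and \<open>k\<close>, and it equals \<open>3\<close> only for
  \<open>(n, k) = (6, 3)\<close> and \<open>(n, k) = (4, 4)\<close>. In the first case \<open>\<gamma>\<close> has a \<open>3\<close>-cycle of multiplier \<open>-1\<close>,
  in the second one a \<open>4\<close>-cycle of multiplier \<open>1\<close>, and eliminating the cycle gives the two cubics
  (\<open>three_cycle_algebra\<close>, \<open>four_cycle_algebra\<close>).

  Most of the work lies in showing that the polynomials \<open>\<Phi>\<^sub>n\<^sup>*\<close>, \<open>\<delta>\<^sub>n\<close> and \<open>\<Delta>\<^sub>n\<^sub>,\<^sub>n\<close>, which are given by
  descriptions, exist. Let \<open>K\<close> be the algebraic closure of \<open>\<rat>(c)\<close> and \<open>P\<^sub>n = f\<^sup>n(z) - z\<close>.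

  \<^item> Over \<open>K\<close> no multiplier is a root of unity (\<open>generic_multiplier_neq_1\<close>, by specialising to
    \<open>c = 0\<close>), so \<open>P\<^sub>n\<close> is squarefree and factors according to exact periods. Division by monic
    polynomials descends the factors to \<open>\<int>[c]\<close>, and Moebius inversion identifies them with the
    \<open>\<Phi>\<^sub>n\<^sup>*\<close> (\<open>map_dynatomic\<close>).

  \<^item> The product \<open>\<Prod>(x - (f\<^sup>n)'(\<alpha>))\<close> over the roots of \<open>\<Phi>\<^sub>n\<^sup>*\<close> is a resultant, hence lies in \<open>\<int>[c][x]\<close>,
    and over \<open>K\<close> it is an \<open>n\<close>-th power since the multiplier is constant on cycles. Its monic \<open>n\<close>-th
    root descends to \<open>\<int>[c]\<close> because \<open>\<int>[c]\<close> is factorial of characteristic \<open>0\<close> (\<open>delta_facts\<close>).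

  \<^item> That \<open>\<Delta>\<^sub>n\<^sub>,\<^sub>n\<close> is a polynomial means that \<open>\<Prod>\<^sub>k \<Delta>\<^sub>n\<^sub>,\<^sub>k\<close>, over the proper divisors \<open>k\<close> of \<open>n\<close>, divides
    \<open>\<delta>\<^sub>n(1)\<close>. At a root \<open>\<alpha>\<close> of \<open>\<Phi>\<^sub>n\<^sup>*\<close> the number \<open>(f\<^sup>n)'(\<alpha>) - 1 = P\<^sub>n'(\<alpha>)\<close> is the product of
    \<open>(\<Phi>\<^sub>n\<^sup>*)'(\<alpha>)\<close> and of the \<open>\<Phi>\<^sub>k\<^sup>*(\<alpha>)\<close> for these \<open>k\<close>. The first factor is a multiple of
    \<open>\<Prod>\<^sub>0\<^sub><\<^sub>j\<^sub><\<^sub>n (\<alpha> - f\<^sup>j(\<alpha>))\<close>, as the orbit of \<open>\<alpha>\<close> consists of roots of \<open>\<Phi>\<^sub>n\<^sup>*\<close>, and there \<open>\<Phi>\<^sub>k\<^sup>*(\<alpha>)\<close> occurs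
    \<open>n/k - 1\<close> times. So \<open>P\<^sub>n'(\<alpha>)\<close> is divisible by \<open>\<Prod>\<^sub>k \<Phi>\<^sub>k\<^sup>*(\<alpha>)\<^sup>n\<^sup>/\<^sup>k\<close>. Taking norms, \<open>\<Phi>\<^sub>k\<^sup>*(\<alpha>)\<close>
    contributes \<open>Res(\<Phi>\<^sub>n\<^sup>*, \<Phi>\<^sub>k\<^sup>*)\<close>, which is a multiple of \<open>\<Delta>\<^sub>n\<^sub>,\<^sub>k\<^sup>k\<close> (\<open>Delta_res_power_dvd\<close>), and
    therefore \<open>(\<Prod>\<^sub>k \<Delta>\<^sub>n\<^sub>,\<^sub>k)\<^sup>n\<close> divides \<open>\<delta>\<^sub>n(1)\<^sup>n\<close> (\<open>Delta_res_prod_dvd\<close>).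

  Degrees are read off from the growth as \<open>c \<rightarrow> \<infinity>\<close>: then all periodic points have absolute value of
  the order of \<open>\<bar>c\<bar>\<^sup>1\<^sup>/\<^sup>2\<close>, so \<open>\<delta>\<^sub>n(\<zeta>)\<close> has degree \<open>\<nu>(n)/2\<close> in \<open>c\<close> for every \<open>\<zeta>\<close> of absolute value \<open>1\<close>,
  where \<open>\<nu>(n) = deg \<Phi>\<^sub>n\<^sup>*\<close> (\<open>degree_delta_values\<close>).
\<close>

section \<open>Resultants as products over roots\<close>

text \<open>
  One step of the Euclidean algorithm; a reading of the Brown-Traub lemma for the subresultant of
  index \<open>0\<close>, where the case of a constant remainder needs a different part of that lemma.
\<close>

lemma resultant_euclid_step:
  fixes F B G H :: "'a :: idom poly"
  assumes "F + B * G = H" "degree F \<ge> degree G" "degree H < degree G"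
  shows "resultant F G =
    (-1) ^ (degree F * degree G) * lead_coeff G ^ (degree F - degree H) * resultant G H"
proof (cases "degree H = 0")
  case True
  then obtain c where c: "H = [:c:]" by (metis degree_eq_zeroE)
  have "coeff (subresultant 0 F G) 0 = coeff (smult (
    (-1)^((degree F - degree H) * (degree G - degree H)) * lead_coeff G ^ (degree F - degree H)
      * lead_coeff H ^ (degree G - degree H - 1)) H) 0"
    using BT_lemma_1_13'[OF assms(1,2), of 0] assms(3) True by simp
  moreover have "c ^ (degree G - 1) * c = c ^ degree G"
    using assms(3) by (metis power_minus_mult not_less_zero neq0_conv)
  ultimately show ?thesis using True c
    by (simp add: coeff_subresultant_0_0_resultant mult.assoc)
next
  case False
  then have "coeff (subresultant 0 F G) 0 = coeff (smult (
    (-1)^((degree F - 0) * (degree G - 0)) * lead_coeff G ^ (degree F - degree H)) (subresultant 0 G H)) 0"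
    using BT_lemma_1_12[OF assms(1,2), of 0] assms(3) by simp
  then show ?thesis by (simp add: coeff_subresultant_0_0_resultant)
qed

definition lin_prod :: "'a :: comm_ring_1 multiset \<Rightarrow> 'a poly" where
  "lin_prod A = (\<Prod>a\<in>#A. [:- a, 1:])"

lemma lin_prod_empty [simp]: "lin_prod {#} = 1"
  and lin_prod_add [simp]: "lin_prod (add_mset a A) = [:- a, 1:] * lin_prod A"
  by (simp_all add: lin_prod_def)

lemma degree_lin_prod [simp]: "degree (lin_prod (A :: 'a :: idom multiset)) = size A"
  and lead_coeff_lin_prod [simp]: "lead_coeff (lin_prod A) = 1"
proof -
  have "degree (lin_prod A) = size A \<and> lead_coeff (lin_prod A) = 1"
  proof (induction A)
    case (add a A)
    then have "lin_prod A \<noteq> 0" by auto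
    then have "degree (lin_prod (add_mset a A)) = Suc (size A)"
      unfolding lin_prod_add using add by (subst degree_mult_eq) auto
    moreover have "lead_coeff (lin_prod (add_mset a A)) = 1"
      unfolding lin_prod_add lead_coeff_mult by (subst conjunct2[OF add]) simp
    ultimately show ?case by simp
  qed auto
  then show "degree (lin_prod A) = size A" "lead_coeff (lin_prod A) = 1" by auto
qed

lemma lin_prod_nonzero [simp]: "lin_prod (A :: 'a :: idom multiset) \<noteq> 0"
  by (metis lead_coeff_lin_prod leading_coeff_0_iff zero_neq_one)

lemma proots_lin_prod [simp]: "proots (lin_prod (A :: 'a :: idom multiset)) = A"
proof (induction A)
  case (add x B)
  have "proots ([:-x,1:] * lin_prod B) = proots [:-x,1:] + proots (lin_prod B)"
    by (rule proots_mult) auto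
  then show ?case unfolding lin_prod_add proots_linear_factor add by simp
qed simp

lemma poly_lin_prod: "poly (lin_prod A) x = (\<Prod>a\<in>#A. x - a)"
  by (induction A) (simp_all add: algebra_simps)

lemma prod_poly_lin_prod_swap:
  "(\<Prod>a\<in>#A. poly (lin_prod B) a) = (-1) ^ (size A * size B) * (\<Prod>b\<in>#B. poly (lin_prod A) (b :: 'a :: idom))"
proof (induction A)
  case (add a A)
  have "(\<Prod>b\<in>#B. poly (lin_prod (add_mset a A)) b) =
      (\<Prod>b\<in>#B. (b - a)) * (\<Prod>b\<in>#B. poly (lin_prod A) b)"
    unfolding lin_prod_add poly_mult prod_mset.distrib by simp
  moreover have "(\<Prod>b\<in>#B. (a - b)) = (-1) ^ size B * (\<Prod>b\<in>#B. (b - a))"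
    by (induction B) (simp_all add: algebra_simps)
  ultimately show ?case using add by (simp add: poly_lin_prod[of B] power_add algebra_simps)
qed (simp add: prod_mset.neutral)

text \<open>
  Over an algebraically closed field the product over the roots satisfies the recursion of the
  Euclidean algorithm just as the resultant does: it is symmetric up to sign, and in the second
  argument only the values at the roots of the first one matter.
\<close>

lemma resultant_lin_prod_alg_closed:
  fixes g :: "'a :: alg_closed_field poly"
  shows "resultant (lin_prod A) g = (\<Prod>a\<in>#A. poly g a)"
proof -
  let ?R = "\<lambda>(f::'a poly) (g::'a poly). lead_coeff f ^ degree g * (\<Prod>a\<in>#proots f. poly g a)"
  have split: "f = smult (lead_coeff f) (lin_prod (proots f))" "size (proots f) = degree f"
    if f0: "f \<noteq> 0" for f :: "'a poly"
  proof -
    obtain B where B: "size B = degree f" "f = smult (lead_coeff f) (\<Prod>x\<in>#B. [:-x, 1:])"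
      using alg_closed_imp_factorization[of f] f0 by blast
    have "proots (smult (lead_coeff f) (lin_prod B)) = B" using f0 by simp
    then have "proots f = B" using B(2) unfolding lin_prod_def by metis
    with B show "f = smult (lead_coeff f) (lin_prod (proots f))" "size (proots f) = degree f"
      by (simp_all add: lin_prod_def)
  qed
  have val: "poly f x = lead_coeff f * poly (lin_prod (proots f)) x" if "f \<noteq> 0" for f :: "'a poly" and x
    by (subst split(1)[OF that]) (simp only: poly_smult)
  \<comment> \<open>Both products are the double product of all differences of roots.\<close>
  have swap: "?R f g = (-1) ^ (degree f * degree g) * ?R g f" if "f \<noteq> 0" "g \<noteq> 0" for f g
  proof -
    have "?R f g = lead_coeff f ^ degree g * (\<Prod>a\<in>#proots f. lead_coeff g * poly (lin_prod (proots g)) a)"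
      by (simp only: val[OF that(2)])
    also have "\<dots> = lead_coeff f ^ degree g * lead_coeff g ^ degree f * (\<Prod>a\<in>#proots f. poly (lin_prod (proots g)) a)"
      by (simp add: prod_mset.distrib split(2)[OF that(1)])
    finally have 1: "?R f g = lead_coeff f ^ degree g * lead_coeff g ^ degree f * (\<Prod>a\<in>#proots f. poly (lin_prod (proots g)) a)" .
    have "?R g f = lead_coeff g ^ degree f * (\<Prod>a\<in>#proots g. lead_coeff f * poly (lin_prod (proots f)) a)"
      by (simp only: val[OF that(1)])
    also have "\<dots> = lead_coeff g ^ degree f * lead_coeff f ^ degree g * (\<Prod>a\<in>#proots g. poly (lin_prod (proots f)) a)"
      by (simp add: prod_mset.distrib split(2)[OF that(2)])
    finally show ?thesis unfolding 1 using prod_poly_lin_prod_swap[of "proots g" "proots f"]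
      by (simp add: split(2) that algebra_simps)
  qed
  have main: "resultant f g = ?R f g" if "f \<noteq> 0" "g \<noteq> 0" "degree g \<le> degree f" for f g
    using that
  proof (induction "degree g" arbitrary: f g rule: less_induct)
    case less
    show ?case
    proof (cases "degree g = 0")
      case True
      then obtain c where "g = [:c:]" by (metis degree_eq_zeroE)
      moreover from this have "poly g = (\<lambda>_. c)" by auto
      ultimately show ?thesis using split(2)[OF less.prems(1)] by simp
    next
      case False
      define H where "H = f mod g"
      have H: "f + (- (f div g)) * g = H" by (simp add: H_def minus_div_mult_eq_mod)
      have dH: "degree H < degree g" using False unfolding H_def
        by (metis degree_0 degree_mod_less gr0I)
      have "(\<Prod>a\<in>#proots g. poly f a) = (\<Prod>a\<in>#proots g. poly H a)"
        by (rule arg_cong[of _ _ prod_mset], rule image_mset_cong)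
          (use less.prems in \<open>auto simp flip: H\<close>)
      then have R: "?R g f = lead_coeff g ^ degree f * (\<Prod>a\<in>#proots g. poly H a)" by simp
      show ?thesis
      proof (cases "H = 0")
        case True
        have "proots g \<noteq> {#}" using split(2)[OF less.prems(2)] False by auto
        then obtain b where b: "b \<in># proots g" by blast
        have "(\<Prod>a\<in>#proots g. poly H a) = 0" using True b
          by (auto simp: nonempty_has_size[symmetric])
        then have "?R g f = 0" unfolding R by simp
        moreover have "resultant f g = 0"
          using resultant_euclid_step[OF H less.prems(3) dH] True False by simp
        ultimately show ?thesis using swap[OF less.prems(1,2)] by simp
      next
        case HN: False
        have "resultant f g = (-1) ^ (degree f * degree g) * lead_coeff g ^ (degree f - degree H) * ?R g H"
          using resultant_euclid_step[OF H less.prems(3) dH] less.hyps[OF dH less.prems(2) HN] dH by simp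
        moreover have "lead_coeff g ^ (degree f - degree H) * ?R g H = ?R g f"
          unfolding R using dH less.prems(3)
          by (simp flip: power_add mult.assoc)
        ultimately show ?thesis using swap[OF less.prems(1,2)] by (simp only: mult.assoc)
      qed
    qed
  qed
  show ?thesis
  proof (cases "g = 0")
    case True
    show ?thesis
    proof (cases "A = {#}")
      case False
      then have "degree (lin_prod A) > 0" by (simp add: nonempty_has_size)
      then show ?thesis using True False by auto
    qed simp
  next
    case False
    let ?f = "lin_prod A"
    have "resultant ?f g = ?R ?f g"
    proof (cases "degree g \<le> degree ?f")
      case True then show ?thesis using main False by simp
    next
      case nle: False
      then have "resultant g ?f = ?R g ?f" using main[of g ?f] False by simp
      then show ?thesis
        using swap[of ?f g] resultant_swap[of ?f g] False by simp
    qed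
    then show ?thesis unfolding lead_coeff_lin_prod proots_lin_prod by simp
  qed
qed

lemma map_poly_lin_prod:
  assumes "comm_ring_hom h"
  shows "map_poly h (lin_prod A) = lin_prod (image_mset h A)"
proof -
  interpret comm_ring_hom h by fact
  interpret p: map_poly_comm_ring_hom h ..
  show ?thesis by (induction A) (simp_all add: hom_distribs)
qed

text \<open>
  Every integral domain embeds into an algebraically closed field, which transfers the product
  formula to integral domains. Polynomial rings are needed as coefficients below.
\<close>

lemma inj_comm_ring_hom_to_ac_to_fract:
  "inj_comm_ring_hom (\<lambda>x :: 'a :: idom. to_ac (to_fract x))"
  by unfold_locales auto

lemma comm_ring_hom_prod_mset:
  assumes "comm_ring_hom h"
  shows "h (\<Prod>a\<in>#A. f a) = (\<Prod>a\<in>#A. h (f a))"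
proof -
  interpret comm_ring_hom h by fact
  show ?thesis by (induction A) (simp_all add: hom_distribs)
qed

lemma resultant_lin_prod:
  fixes g :: "'a :: idom poly"
  shows "resultant (lin_prod A) g = (\<Prod>a\<in>#A. poly g a)"
proof -
  let ?h = "\<lambda>x :: 'a. to_ac (to_fract x)"
  interpret inj_comm_ring_hom ?h by (rule inj_comm_ring_hom_to_ac_to_fract)
  have "?h (resultant (lin_prod A) g) = resultant (lin_prod (image_mset ?h A)) (map_poly ?h g)"
    by (simp add: resultant_hom[symmetric] map_poly_lin_prod comm_ring_hom_axioms)
  also have "\<dots> = ?h (\<Prod>a\<in>#A. poly g a)"
    unfolding resultant_lin_prod_alg_closed
    by (simp add: comm_ring_hom_prod_mset[OF comm_ring_hom_axioms] poly_map_poly image_mset.compositionality o_def)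
  finally show ?thesis by simp
qed

text \<open>
  The product of the values of \<open>q\<close> at the roots of a monic \<open>p\<close>. Adding a multiple of \<open>p\<close> leaves these
  values unchanged and makes the second argument monic; so its degree cannot drop under a ring
  homomorphism, and the norm commutes with all of them.
\<close>

definition root_norm :: "'a :: comm_ring_1 poly \<Rightarrow> 'a poly \<Rightarrow> 'a" where
  "root_norm p q = resultant p (q + monom 1 (Suc (degree q)) * p)"

lemma degree_map_poly_monic:
  assumes "comm_ring_hom (h :: 'a :: comm_ring_1 \<Rightarrow> 'b :: comm_ring_1)" "lead_coeff p = 1"
  shows "degree (map_poly h p) = degree p"
proof -
  interpret comm_ring_hom h by fact
  show ?thesis by (rule degree_map_poly) (use assms in auto)
qed

lemma lead_coeff_map_poly_monic:
  assumes "comm_ring_hom (h :: 'a :: comm_ring_1 \<Rightarrow> 'b :: comm_ring_1)" "lead_coeff p = 1"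
  shows "lead_coeff (map_poly h p) = 1"
proof -
  interpret comm_ring_hom h by fact
  show ?thesis by (simp only: degree_map_poly_monic[OF assms]) (use assms in \<open>simp add: coeff_map_poly\<close>)
qed

lemma hom_resultant_monic:
  assumes "comm_ring_hom (h :: 'a :: idom \<Rightarrow> 'b :: idom)" "lead_coeff p = 1" "lead_coeff q = 1"
    "map_poly h p = lin_prod A"
  shows "h (resultant p q) = (\<Prod>a\<in>#A. poly (map_poly h q) a)"
proof -
  interpret comm_ring_hom h by fact
  have "h (resultant p q) = resultant (map_poly h p) (map_poly h q)"
    by (rule resultant_map_poly[symmetric]; rule degree_map_poly_monic[OF assms(1)]; fact)
  then show ?thesis by (simp add: assms resultant_lin_prod)
qed

text \<open>
  The form in which resultants are used: a product over the roots of \<open>p\<close> in any extension or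
  specialisation \<open>h\<close> is the image of one element of the ground ring.
\<close>

lemma hom_root_norm:
  assumes "comm_ring_hom (h :: 'a :: idom \<Rightarrow> 'b :: idom)" "lead_coeff p = 1" "map_poly h p = lin_prod A"
  shows "h (root_norm p q) = (\<Prod>a\<in>#A. poly (map_poly h q) a)"
proof -
  interpret comm_ring_hom h by fact
  interpret p: map_poly_comm_ring_hom h ..
  let ?M = "monom 1 (Suc (degree q)) * p" let ?q = "q + ?M"
  have p0: "p \<noteq> 0" using assms(2) by auto
  have dM: "degree ?M = Suc (degree q) + degree p" using p0
    by (subst degree_mult_eq) (auto simp: degree_monom_eq)
  then have dq: "degree ?q = degree ?M"
    by (intro degree_add_eq_right) simp
  have "lead_coeff ?M = 1" using assms(2) by (simp only: lead_coeff_mult lead_coeff_monom) simp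
  moreover have "coeff q (degree ?M) = 0" using dM by (intro coeff_eq_0) simp
  ultimately have lq: "lead_coeff ?q = 1" unfolding dq by simp
  have "h (root_norm p q) = (\<Prod>a\<in>#A. poly (map_poly h ?q) a)"
    unfolding root_norm_def using hom_resultant_monic[OF assms(1,2) lq assms(3)] .
  also have "\<dots> = (\<Prod>a\<in>#A. poly (map_poly h q) a)"
    by (rule arg_cong[of _ _ prod_mset], rule image_mset_cong)
      (auto simp: hom_distribs assms(3) poly_lin_prod prod_mset_zero_iff)
  finally show ?thesis .
qed

section \<open>Descent of factors and of roots of monic polynomials\<close>

text \<open>
  Division with remainder by a monic polynomial commutes with ring extensions, so a remainder that
  vanishes in the extension vanishes already below.
\<close>

lemma monic_dvd_descent:
  fixes p q :: "'a :: idom poly" and h :: "'a \<Rightarrow> 'b :: idom"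
  assumes "inj_comm_ring_hom h" "lead_coeff p = 1" "map_poly h p dvd map_poly h q"
  shows "p dvd q"
proof -
  interpret inj_comm_ring_hom h by fact
  interpret p: map_poly_inj_comm_ring_hom h ..
  have p0: "p \<noteq> 0" using assms(2) by auto
  obtain s r where sr: "pseudo_divmod q p = (s, r)" by fastforce
  from pseudo_divmod[OF p0 sr] have q: "q = p * s + r" and r: "r = 0 \<or> degree r < degree p"
    by (simp_all add: assms(2))
  from assms(3) have "map_poly h p dvd map_poly h r"
    by (simp add: q hom_distribs dvd_add_right_iff)
  then have "r = 0" using r by (auto dest: dvd_imp_degree_le)
  then show ?thesis using q by simp
qed

lemma coeff_mult_degree_le:
  fixes p q :: "'a :: comm_semiring_0 poly"
  assumes "degree p \<le> m" "degree q \<le> k"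
  shows "coeff (p * q) (m + k) = coeff p m * coeff q k"
proof -
  have "coeff (p * q) (m + k) = (\<Sum>i\<le>m + k. coeff p i * coeff q (m + k - i))"
    by (simp add: coeff_mult)
  also have "\<dots> = (\<Sum>i\<in>{m}. coeff p i * coeff q (m + k - i))"
  proof (rule sum.mono_neutral_right)
    show "\<forall>i\<in>{..m + k} - {m}. coeff p i * coeff q (m + k - i) = 0"
    proof
      fix i assume "i \<in> {..m + k} - {m}"
      then have "i > m \<or> m + k - i > k" by auto
      then show "coeff p i * coeff q (m + k - i) = 0"
        using assms by (auto simp: coeff_eq_0)
    qed
  qed auto
  finally show ?thesis by simp
qed

lemma degree_lead_coeff_power_monic:
  fixes p :: "'a :: idom poly"
  assumes "lead_coeff p = 1"
  shows "degree (p ^ n) = n * degree p" "lead_coeff (p ^ n) = 1"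
proof -
  have "p \<noteq> 0" using assms by auto
  then show "degree (p ^ n) = n * degree p" by (simp add: degree_power_eq)
  show "lead_coeff (p ^ n) = 1" unfolding lead_coeff_power assms by simp
qed

text \<open>
  If \<open>D\<close> and \<open>E\<close> agree above index \<open>k\<close>, then so do their powers above a corresponding index, where
  they differ by \<open>n\<close> times the next difference. This recovers the coefficients of \<open>D\<close> from those of
  \<open>D ^ n\<close>, from the top downwards, in characteristic zero.
\<close>

lemma coeff_power_diff:
  fixes D E :: "'a :: idom poly"
  assumes "lead_coeff D = 1" "lead_coeff E = 1" "degree E = degree D"
    and "degree (D - E) \<le> k" "n > 0"
  shows "coeff (D ^ n - E ^ n) (k + (n - 1) * degree D) = of_nat n * coeff (D - E) k"
proof -
  let ?S = "\<Sum>i<n. E ^ (n - Suc i) * D ^ i"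
  let ?m = "(n - 1) * degree D"
  have 1: "degree (E ^ (n - Suc i) * D ^ i) = ?m \<and> lead_coeff (E ^ (n - Suc i) * D ^ i) = 1" if "i < n" for i
  proof -
    have "E ^ (n - Suc i) \<noteq> 0" "D ^ i \<noteq> 0" using assms by auto
    then have "degree (E ^ (n - Suc i) * D ^ i) = (n - Suc i) * degree D + i * degree D"
      using assms by (simp add: degree_mult_eq degree_lead_coeff_power_monic)
    also have "\<dots> = ?m" using that by (simp flip: add_mult_distrib)
    finally show ?thesis
      using assms(1,2) by (metis degree_lead_coeff_power_monic(2) lead_coeff_mult mult_1)
  qed
  have c: "coeff ?S ?m = of_nat n"
  proof -
    have "coeff ?S ?m = (\<Sum>i<n. coeff (E ^ (n - Suc i) * D ^ i) ?m)" by (rule coeff_sum)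
    also have "\<dots> = (\<Sum>i<n. 1)" by (rule sum.cong[OF refl]) (use 1 in force)
    finally show ?thesis by simp
  qed
  have d: "degree ?S \<le> ?m" by (rule degree_sum_le) (use 1 in auto)
  have "D ^ n - E ^ n = (D - E) * ?S" by (rule power_diff_sumr2)
  then show ?thesis using coeff_mult_degree_le[OF assms(4) d] c by (simp add: mult.commute)
qed

lemma monic_power_eq_imp_eq:
  fixes D E :: "'a :: idom poly"
  assumes "lead_coeff D = 1" "lead_coeff E = 1" "D ^ n = E ^ n" "(of_nat n :: 'a) \<noteq> 0"
  shows "D = E"
proof -
  have n: "n > 0" using assms(4) by (cases n) auto
  have "degree E = degree D"
    using assms(3) n degree_lead_coeff_power_monic(1)[OF assms(1), of n] degree_lead_coeff_power_monic(1)[OF assms(2), of n]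
    by simp
  from coeff_power_diff[OF assms(1,2) this le_refl n] assms(3,4) have "lead_coeff (D - E) = 0"
    by (metis coeff_0 diff_self mult_eq_0_iff)
  then show ?thesis by (metis leading_coeff_0_iff right_minus_eq)
qed

text \<open>
  The recursion for the coefficients of a monic \<open>n\<close>-th root takes place in the smaller field.
\<close>

lemma monic_root_descent_field:
  fixes j :: "'a :: field \<Rightarrow> 'b :: field"
  assumes "field_hom j" "lead_coeff D = 1" "D ^ n = map_poly j G" "(of_nat n :: 'b) \<noteq> 0"
  shows "\<exists>D0. D = map_poly j D0"
proof -
  interpret field_hom j by fact
  interpret p: map_poly_inj_comm_ring_hom j ..
  have n: "n > 0" using assms(4) by (cases n) auto
  let ?d = "degree D"
  have "coeff D k \<in> range j" for k
  proof (induction "?d - k" arbitrary: k rule: less_induct)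
    case less
    show ?case
    proof (cases "k < ?d")
      case False
      then show ?thesis using assms(2)
        by (metis coeff_eq_0 hom_one hom_zero linorder_neqE_nat rangeI)
    next
      case True
      have IH: "coeff D l \<in> range j" if "l > k" for l
        using that less[of l] True by (cases "l \<le> ?d") (auto simp: coeff_eq_0 intro!: image_eqI[of _ _ 0])
      define a where "a l = (if l > k then inv_into UNIV j (coeff D l) else 0)" for l
      have a: "j (a l) = (if l > k then coeff D l else 0)" for l
        using f_inv_into_f[OF IH[of l]] by (auto simp: a_def)
      \<comment> \<open>The part of \<open>D\<close> above index \<open>k\<close>, whose coefficients are already known to descend.\<close>
      define M where "M = (\<Sum>l\<le>?d. monom (a l) l)"
      have cM: "coeff M l = (if l \<le> ?d then a l else 0)" for l
        unfolding M_def coeff_sum by (auto simp: sum.If_cases if_distrib cong: if_cong)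
      define E where "E = map_poly j M"
      have cE: "coeff E l = (if l > k then coeff D l else 0)" for l
        using a[of l] by (cases "l > k") (auto simp: E_def coeff_map_poly cM coeff_eq_0 a_def)
      have "degree E \<le> ?d" by (rule degree_le) (auto simp: cE coeff_eq_0)
      moreover have "degree E \<ge> ?d" by (rule le_degree) (use True assms(2) in \<open>auto simp: cE\<close>)
      ultimately have dE: "degree E = ?d" by simp
      have lE: "lead_coeff E = 1" unfolding dE cE using True assms(2) by simp
      have "degree (D - E) \<le> k" by (rule degree_le) (auto simp: cE)
      from coeff_power_diff[OF assms(2) lE dE this n] have
        "coeff (D ^ n - E ^ n) (k + (n - 1) * ?d) = of_nat n * coeff D k" by (simp add: cE)
      moreover have "D ^ n - E ^ n = map_poly j (G - M ^ n)"
        by (simp add: assms(3) E_def hom_distribs)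
      ultimately have "of_nat n * coeff D k = j (coeff (G - M ^ n) (k + (n - 1) * ?d))"
        by (metis coeff_map_poly hom_zero)
      then have "coeff D k = j (coeff (G - M ^ n) (k + (n - 1) * ?d) / of_nat n)"
        using assms(4) unfolding hom_div hom_of_nat by (metis nonzero_mult_div_cancel_left)
      then show ?thesis by blast
    qed
  qed
  then have c: "j (inv_into UNIV j (coeff D k)) = coeff D k" for k by (rule f_inv_into_f)
  define D0 where "D0 = (\<Sum>l\<le>?d. monom (inv_into UNIV j (coeff D l)) l)"
  have "coeff D0 l = (if l \<le> ?d then inv_into UNIV j (coeff D l) else 0)" for l
    unfolding D0_def coeff_sum by (auto simp: sum.If_cases if_distrib cong: if_cong)
  then have "D = map_poly j D0" by (intro poly_eqI) (auto simp: coeff_map_poly c coeff_eq_0)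
  then show ?thesis by blast
qed

text \<open>
  Gauss's lemma: write \<open>D\<close> as a multiple of a primitive polynomial with leading coefficient \<open>l\<close>; then
  \<open>l ^ n\<close> divides the content of a power of this polynomial and is a unit.
\<close>

lemma monic_root_descent_fract:
  fixes D :: "'a :: {factorial_semiring,semiring_Gcd,ring_gcd,idom_divide,
                     semiring_gcd_mult_normalize} fract poly"
  assumes "lead_coeff D = 1" "D ^ n = map_poly to_fract G" "n > 0"
  shows "\<exists>D0. lead_coeff D0 = 1 \<and> D = map_poly to_fract D0"
proof -
  obtain c p where p: "D = smult c (map_poly to_fract p)" "content p = 1"
    by (rule content_decompose_fract)
  define l where "l = lead_coeff p"
  have cl: "c * to_fract l = 1"
  proof -
    have "degree (map_poly to_fract p) = degree p" by (rule degree_map_poly) auto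
    then have "lead_coeff (map_poly to_fract p) = to_fract l" by (simp add: l_def coeff_map_poly)
    then show ?thesis using assms(1) unfolding p(1) lead_coeff_smult by simp
  qed
  then have l0: "to_fract l \<noteq> 0" by auto
  have "map_poly to_fract p = smult (to_fract l) D"
    using cl by (simp add: p(1) mult.commute)
  moreover have pw: "map_poly to_fract (p ^ n) = (map_poly to_fract p) ^ n" for n
    by (induction n) auto
  moreover have tp: "to_fract (l ^ n) = to_fract l ^ n" for n by (induction n) auto
  ultimately have "map_poly to_fract (p ^ n) = map_poly to_fract (smult (l ^ n) G)"
    using assms(2) by (simp add: smult_power fract_poly_smult tp)
  then have eq: "p ^ n = smult (l ^ n) G" by (simp only: fract_poly_eq_iff)
  have "content (p ^ n) = 1" for n by (induction n) (auto simp: content_mult p(2))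
  then have "l ^ n dvd 1" using eq
    by (metis content_smult dvd_mult_left is_unit_normalize normalize_dvd_iff dvd_refl dvd_triv_left)
  then have "l dvd 1" using assms(3) by (meson dvd_power dvd_trans)
  then obtain u where u: "1 = l * u" by (elim dvdE)
  have "to_fract u = c" using cl u
    by (metis l0 mult.commute mult_cancel_right to_fract_1 to_fract_mult)
  then have "D = map_poly to_fract (smult u p)" by (simp add: p(1))
  moreover have "lead_coeff (smult u p) = 1" unfolding lead_coeff_smult using u by (simp only: l_def mult.commute)
  ultimately show ?thesis by blast
qed

section \<open>Iteration of quadratic polynomials\<close>

definition quad :: "'a :: comm_ring_1 \<Rightarrow> 'a \<Rightarrow> 'a" where
  "quad c z = z ^ 2 + c"

text \<open>
  The derivative of the \<open>n\<close>-th iterate at \<open>z\<close>, written by the chain rule so that it makes sense over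
  every ring.
\<close>

definition multiplier :: "'a :: comm_ring_1 \<Rightarrow> nat \<Rightarrow> 'a \<Rightarrow> 'a" where
  "multiplier c n z = (\<Prod>i<n. 2 * (quad c ^^ i) z)"

lemma quad_iter_0 [simp]: "quad_iter 0 = [:0, 1:]"
  and quad_iter_Suc: "quad_iter (Suc k) = quad_iter k ^ 2 + [:[:0, 1:]:]"
  by (simp_all add: quad_iter_def pcompose_pCons power2_eq_square algebra_simps)

lemma monic_add_lower_degree:
  assumes "lead_coeff p = 1" "degree q < degree p"
  shows "degree (p + q) = degree p" "lead_coeff (p + q) = 1"
  using assms by (simp_all add: degree_add_eq_left coeff_eq_0)

lemma degree_quad_iter: "degree (quad_iter k) = 2 ^ k"
  and lead_coeff_quad_iter: "lead_coeff (quad_iter k) = 1"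
proof -
  have "degree (quad_iter k) = 2 ^ k \<and> lead_coeff (quad_iter k) = 1"
  proof (induction k)
    case (Suc k)
    have sq: "degree (quad_iter k ^ 2) = 2 ^ Suc k" "lead_coeff (quad_iter k ^ 2) = 1"
      using Suc degree_lead_coeff_power_monic[OF conjunct2[OF Suc], of 2] by auto
    then have "degree [:[:0, 1::int:]:] < degree (quad_iter k ^ 2)" by simp
    from monic_add_lower_degree[OF sq(2) this] show ?case unfolding quad_iter_Suc sq(1) by blast
  qed simp
  then show "degree (quad_iter k) = 2 ^ k" "lead_coeff (quad_iter k) = 1" by auto
qed

definition period_poly :: "nat \<Rightarrow> int poly poly" where
  "period_poly n = quad_iter n - [:0, 1:]"

lemma degree_period_poly: "n > 0 \<Longrightarrow> degree (period_poly n) = 2 ^ n"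
  and lead_coeff_period_poly: "n > 0 \<Longrightarrow> lead_coeff (period_poly n) = 1"
proof -
  assume "n > 0"
  then have lt: "degree (- [:0, 1 :: int poly:]) < degree (quad_iter n)"
    unfolding degree_quad_iter degree_minus using power_increasing[of 1 n "2::nat"] by simp
  have eq: "period_poly n = quad_iter n + (- [:0, 1:])" by (simp add: period_poly_def)
  show "degree (period_poly n) = 2 ^ n" "lead_coeff (period_poly n) = 1"
    using monic_add_lower_degree[OF lead_coeff_quad_iter lt] unfolding eq degree_quad_iter by auto
qed

text \<open>
  A specialisation of \<open>\<int>[c]\<close>: the parameter \<open>c\<close> is sent to \<open>param\<close>, and \<open>ev p z\<close> evaluates an element of
  \<open>\<int>[c][z]\<close> there. It is applied to the embedding into the closure of \<open>\<rat>(c)\<close> and to the evaluation at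
  a complex number.
\<close>

locale int_poly_hom = comm_ring_hom h for h :: "int poly \<Rightarrow> 'a :: comm_ring_1"
begin

sublocale p: map_poly_comm_ring_hom h ..

abbreviation param :: 'a where "param \<equiv> h [:0, 1:]"

abbreviation ev :: "int poly poly \<Rightarrow> 'a \<Rightarrow> 'a" where "ev p z \<equiv> poly (map_poly h p) z"

lemma at_quad_iter: "ev (quad_iter k) z = (quad param ^^ k) z"
  by (induction k) (simp_all add: quad_iter_Suc hom_distribs quad_def)

lemma at_period_poly: "ev (period_poly k) z = (quad param ^^ k) z - z"
  by (simp add: period_poly_def hom_distribs at_quad_iter)

lemma at_pderiv_quad_iter: "ev (pderiv (quad_iter k)) z = multiplier param k z"
proof (induction k)
  case (Suc k)
  have "pderiv (quad_iter (Suc k)) = 2 * quad_iter k * pderiv (quad_iter k)"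
    by (simp add: quad_iter_Suc pderiv_add power2_eq_square pderiv_mult pderiv_pCons algebra_simps)
  then show ?case using Suc
    by (simp add: hom_distribs at_quad_iter multiplier_def algebra_simps)
qed (simp add: multiplier_def pderiv_pCons)

end

lemma multiplier_shift:
  assumes "(quad c ^^ n) z = z"
  shows "multiplier c n (quad c z) = multiplier c n z"
proof (cases n)
  case (Suc k)
  have "multiplier c n (quad c z) = (\<Prod>i<k. 2 * (quad c ^^ Suc i) z) * (2 * (quad c ^^ Suc k) z)"
    unfolding multiplier_def Suc prod.lessThan_Suc by (simp add: funpow_Suc_right del: funpow.simps)
  also have "\<dots> = multiplier c n z"
    using assms unfolding multiplier_def Suc prod.lessThan_Suc_shift by simp
  finally show ?thesis .
qed (simp add: multiplier_def)

lemma multiplier_add: "multiplier c (m + n) z = multiplier c m z * multiplier c n ((quad c ^^ m) z)"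
proof (induction n)
  case (Suc n)
  have "(quad c ^^ n) ((quad c ^^ m) z) = (quad c ^^ (m + n)) z"
    by (simp add: funpow_add add.commute[of m n])
  with Suc show ?case by (simp add: multiplier_def mult.assoc)
qed (simp add: multiplier_def)

lemma multiplier_mult:
  assumes "(quad c ^^ d) z = z"
  shows "multiplier c (d * r) z = multiplier c d z ^ r"
proof (induction r)
  case (Suc r)
  have "multiplier c (d + d * r) z = multiplier c d z * multiplier c (d * r) z"
    using assms by (simp add: multiplier_add)
  with Suc show ?case by simp
qed (simp add: multiplier_def)

lemma funpow_period_iff:
  assumes "has_exact_period f k z"
  shows "(f ^^ n) z = z \<longleftrightarrow> k dvd n"
proof -
  from assms have k: "k > 0" "(f ^^ k) z = z" and min: "\<And>i. 0 < i \<Longrightarrow> i < k \<Longrightarrow> (f ^^ i) z \<noteq> z"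
    by (auto simp: has_exact_period_def)
  have "(f ^^ n) z = (f ^^ (n mod k)) z" using funpow_mod_eq[OF k(2)] by simp
  then show ?thesis using min[of "n mod k"] k(1) by (auto simp: dvd_eq_mod_eq_0)
qed

lemma exact_period_exists:
  assumes "(f ^^ n) z = z" "n > 0"
  shows "\<exists>k. k dvd n \<and> has_exact_period f k z"
proof -
  define k where "k = (LEAST k. k > 0 \<and> (f ^^ k) z = z)"
  have k: "k > 0 \<and> (f ^^ k) z = z" unfolding k_def by (rule LeastI[of _ n]) (use assms in auto)
  moreover have "(f ^^ i) z \<noteq> z" if "0 < i" "i < k" for i
    using not_less_Least[of i "\<lambda>k. k > 0 \<and> (f ^^ k) z = z"] that k_def by auto
  ultimately have "has_exact_period f k z" by (auto simp: has_exact_period_def)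
  with funpow_period_iff[OF this, of n] assms show ?thesis by auto
qed

lemma has_exact_period_shift:
  assumes "has_exact_period f k z"
  shows "has_exact_period f k (f z)"
proof -
  from assms have k: "k > 0" "(f ^^ k) z = z" by (auto simp: has_exact_period_def)
  have sh: "(f ^^ i) (f z) = f ((f ^^ i) z)" for i by (simp add: funpow_swap1)
  have "(f ^^ i) z = z" if "(f ^^ i) (f z) = f z" for i
  proof -
    have "(f ^^ (k - 1)) (f ((f ^^ i) z)) = (f ^^ (k - 1)) (f z)" using that sh by simp
    then have "(f ^^ Suc (k - 1)) ((f ^^ i) z) = (f ^^ Suc (k - 1)) z"
      by (simp only: funpow_Suc_right o_apply)
    then have "(f ^^ k) ((f ^^ i) z) = z" using k by simp
    moreover have "(f ^^ k) ((f ^^ i) z) = (f ^^ i) ((f ^^ k) z)"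
      by (metis add.commute funpow_add o_apply)
    ultimately show ?thesis using k by simp
  qed
  then show ?thesis using assms by (auto simp: has_exact_period_def sh)
qed

lemma has_exact_period_funpow:
  "has_exact_period f k z \<Longrightarrow> has_exact_period f k ((f ^^ i) z)"
  by (induction i) (auto intro: has_exact_period_shift)

lemma inj_on_orbit:
  assumes "has_exact_period f k z"
  shows "inj_on (\<lambda>i. (f ^^ i) z) {..<k}"
proof -
  have *: "i = j" if "i \<le> j" "j < k" "(f ^^ i) z = (f ^^ j) z" for i j
  proof -
    have "(f ^^ (j - i)) ((f ^^ i) z) = (f ^^ j) z" using that(1)
      by (metis funpow_add le_add_diff_inverse2 o_apply)
    then have "k dvd j - i" using that(3) funpow_period_iff[OF has_exact_period_funpow[OF assms]] by metis
    then show ?thesis using that by (auto dest: dvd_imp_le)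
  qed
  show ?thesis
  proof (rule inj_onI)
    fix i j assume "i \<in> {..<k}" "j \<in> {..<k}" "(f ^^ i) z = (f ^^ j) z"
    then show "i = j" using *[of i j] *[of j i] by (cases "i \<le> j") auto
  qed
qed

text \<open>
  A finite set of points of exact period \<open>n\<close> splits into cycles of length \<open>n\<close>; \<open>B\<close> picks one point of
  each. A product of a function that is constant on cycles is thus an \<open>n\<close>-th power.
\<close>

lemma cycle_representatives:
  assumes "finite V" "\<And>x. x \<in> V \<Longrightarrow> f x \<in> V" "\<And>x. x \<in> V \<Longrightarrow> has_exact_period f n x"
  shows "\<exists>B\<subseteq>V. card V = n * card B \<and>
    (\<forall>g :: 'a \<Rightarrow> 'b :: comm_monoid_mult. (\<forall>x\<in>V. g (f x) = g x) \<longrightarrow> (\<Prod>x\<in>V. g x) = (\<Prod>x\<in>B. g x) ^ n)"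
  using assms
proof (induction "card V" arbitrary: V rule: less_induct)
  case less
  show ?case
  proof (cases "V = {}")
    case False
    then obtain x where x: "x \<in> V" by blast
    let ?O = "(\<lambda>i. (f ^^ i) x) ` {..<n}"
    have px: "has_exact_period f n x" using less.prems x by blast
    then have n: "n > 0" "(f ^^ n) x = x" by (auto simp: has_exact_period_def)
    have iter: "(f ^^ i) x \<in> V" for i by (induction i) (use less.prems x in auto)
    have cO: "card ?O = n" using card_image[OF inj_on_orbit[OF px]] by simp
    have xO: "x \<in> ?O" using n by (intro image_eqI[of _ _ 0]) auto
    have clos: "f y \<in> V - ?O" if y: "y \<in> V - ?O" for y
    proof
      show "f y \<in> V" using that less.prems by blast
      show "f y \<notin> ?O"
      proof
        assume "f y \<in> ?O"
        then obtain i where i: "f y = (f ^^ i) x" by blast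
        have "y = (f ^^ (n - 1)) (f y)"
          using less.prems(3)[of y] y n(1)
          by (metis DiffD1 Suc_diff_1 funpow_Suc_right has_exact_period_def o_apply)
        also have "\<dots> = (f ^^ ((n - 1 + i) mod n)) x"
          using i funpow_mod_eq[OF n(2), of "n - 1 + i"] by (simp add: funpow_add)
        finally show False using y n(1) by auto
      qed
    qed
    have cX: "card (V - ?O) = card V - n" "card ?O \<le> card V"
      using iter less.prems(1) cO card_mono[of V ?O] by (auto simp: card_Diff_subset image_subset_iff)
    then have "card (V - ?O) < card V" using n(1) cO by linarith
    from less.hyps[OF this] obtain B where B: "B \<subseteq> V - ?O" "card (V - ?O) = n * card B"
      "\<And>g :: 'a \<Rightarrow> 'b. (\<forall>x\<in>V - ?O. g (f x) = g x) \<Longrightarrow> (\<Prod>x\<in>V - ?O. g x) = (\<Prod>x\<in>B. g x) ^ n"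
      using clos less.prems(1,3) by (metis (no_types, lifting) DiffD1 finite_Diff)
    have finB: "finite B" using B(1) less.prems(1) by (meson finite_Diff finite_subset)
    have xB: "x \<notin> B" using B(1) xO by blast
    show ?thesis
    proof (intro exI[of _ "insert x B"] conjI allI impI)
      show "insert x B \<subseteq> V" using B x by blast
      show "card V = n * card (insert x B)" using cX cO B(2) finB xB by simp
      fix g :: "'a \<Rightarrow> 'b" assume g: "\<forall>x\<in>V. g (f x) = g x"
      have gi: "g ((f ^^ i) x) = g x" for i by (induction i) (use g iter in auto)
      have "(\<Prod>y\<in>?O. g y) = (\<Prod>i<n. g ((f ^^ i) x))"
        using prod.reindex[OF inj_on_orbit[OF px], of g] by (simp add: o_def)
      then have "(\<Prod>y\<in>?O. g y) = g x ^ n" by (simp add: gi)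
      moreover have "(\<Prod>y\<in>V. g y) = (\<Prod>y\<in>V - ?O. g y) * (\<Prod>y\<in>?O. g y)"
        by (rule prod.subset_diff) (use iter less.prems in auto)
      ultimately show "(\<Prod>y\<in>V. g y) = (\<Prod>y\<in>insert x B. g y) ^ n"
        using B(3)[of g] g finB xB by (simp add: power_mult_distrib mult.commute)
    qed
  qed (auto intro!: exI[of _ "{}"])
qed

section \<open>Existence of the dynatomic polynomials\<close>

lemma inj_comm_ring_hom_embed_Qc: "inj_comm_ring_hom embed_Qc"
  unfolding embed_Qc_def[abs_def] by (rule inj_comm_ring_hom_to_ac_to_fract)

global_interpretation Qc: inj_idom_hom embed_Qc
proof -
  interpret inj_comm_ring_hom embed_Qc by (rule inj_comm_ring_hom_embed_Qc)
  show "inj_idom_hom embed_Qc" by unfold_locales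
qed

global_interpretation Qc: int_poly_hom embed_Qc ..

global_interpretation Qcp: map_poly_inj_comm_ring_hom embed_Qc ..

definition eval_at :: "complex \<Rightarrow> int poly \<Rightarrow> complex" where
  "eval_at c p = poly (map_poly of_int p) c"

lemma comm_ring_hom_eval_at: "comm_ring_hom (eval_at c)"
  by unfold_locales (simp_all add: eval_at_def hom_distribs)

lemma int_poly_hom_eval_at: "int_poly_hom (eval_at c)"
  using comm_ring_hom_eval_at by (simp add: int_poly_hom_def)

lemma eval_at_param [simp]: "eval_at c [:0, 1:] = c" "eval_at c (pCons 0 1) = c"
proof -
  show "eval_at c [:0, 1:] = c" by (simp add: eval_at_def hom_distribs)
  then show "eval_at c (pCons 0 1) = c" by (simp only: pCons_one)
qed

lemma monic_splits:
  fixes p :: "'a :: alg_closed_field poly"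
  assumes "lead_coeff p = 1"
  shows "p = lin_prod (proots p)"
proof -
  have "p \<noteq> 0" using assms by auto
  then obtain B where "p = smult (lead_coeff p) (\<Prod>x\<in>#B. [:-x, 1:])"
    using alg_closed_imp_factorization[of p] by blast
  then have "p = lin_prod B" by (simp add: assms lin_prod_def)
  then show ?thesis by simp
qed

text \<open>
  A periodic point of \<open>z \<mapsto> z\<^sup>2\<close> is \<open>0\<close> or lies on the unit circle, so its multiplier is \<open>0\<close> or has
  absolute value \<open>2 ^ n\<close>.
\<close>

lemma multiplier_neq_1_at_parameter_0:
  assumes "n > 0" "(quad 0 ^^ n) a = (a :: complex)"
  shows "multiplier 0 n a \<noteq> 1"
proof -
  have pw: "(quad 0 ^^ k) a = a ^ (2 ^ k)" for k
    by (induction k) (simp_all add: quad_def mult.commute flip: power_mult)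
  have "norm a = 1" if "a \<noteq> 0"
  proof -
    have "a * a ^ (2 ^ n - 1) = a * 1" using assms(2) unfolding pw
      by (metis mult.right_neutral power_minus_mult mult.commute zero_less_numeral zero_less_power)
    then have "a ^ (2 ^ n - 1) = 1" using that by simp
    moreover have "2 ^ n - 1 > (0::nat)" using assms(1) one_less_power[of "2::nat" n] by simp
    ultimately show ?thesis by (metis norm_power norm_one norm_ge_zero power_eq_1_iff neq0_conv)
  qed
  then have "norm (multiplier 0 n a) = (if a = 0 then 0 else 2 ^ n)"
    using assms(1) by (auto simp: multiplier_def pw norm_mult norm_power prod_norm[symmetric] prod.distrib
        intro!: exI[of _ 0])
  moreover have "(1::real) < 2 ^ n" by (rule one_less_power) (use assms(1) in auto)
  ultimately show ?thesis by (metis norm_one zero_neq_one less_irrefl)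
qed

text \<open>
  The product of all \<open>multiplier - 1\<close> over the roots of \<open>P\<^sub>n\<close> is a polynomial in \<open>c\<close>. It does not vanish
  at \<open>c = 0\<close>, hence not identically.
\<close>

lemma generic_multiplier_neq_1:
  assumes "n > 0" "(quad Qc.param ^^ n) a = a"
  shows "multiplier Qc.param n a \<noteq> 1"
proof -
  define P where "P = period_poly n"
  define r where "r = root_norm P (pderiv P)"
  have P: "lead_coeff P = 1" using assms(1) by (simp add: P_def lead_coeff_period_poly)
  have dP: "pderiv P = pderiv (quad_iter n) - 1"
    by (simp add: P_def period_poly_def pderiv_diff pderiv_pCons)
  interpret e: int_poly_hom "eval_at 0" by (rule int_poly_hom_eval_at)
  have val: "h r = (\<Prod>x\<in>#proots (map_poly h P). multiplier (h [:0,1:]) n x - 1)"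
    if "int_poly_hom h" for h :: "int poly \<Rightarrow> 'b :: alg_closed_field"
  proof -
    interpret int_poly_hom h by fact
    have "lead_coeff (map_poly h P) = 1"
      by (rule lead_coeff_map_poly_monic[OF comm_ring_hom_axioms P])
    from hom_root_norm[OF comm_ring_hom_axioms P monic_splits[OF this], of "pderiv P"]
    show ?thesis by (simp add: r_def dP hom_distribs at_pderiv_quad_iter)
  qed
  have roots: "x \<in># proots (map_poly h P) \<longleftrightarrow> (quad (h [:0,1:]) ^^ n) x = x"
    if "int_poly_hom h" for h :: "int poly \<Rightarrow> 'b :: alg_closed_field" and x
  proof -
    interpret int_poly_hom h by fact
    have "lead_coeff (map_poly h P) = 1"
      by (rule lead_coeff_map_poly_monic[OF comm_ring_hom_axioms P])
    then have "map_poly h P \<noteq> 0" by (metis leading_coeff_0_iff zero_neq_one)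
    then show ?thesis using at_period_poly[of n x] by (simp add: P_def)
  qed
  \<comment> \<open>Specialise to \<open>c = 0\<close>.\<close>
  have "eval_at 0 r \<noteq> 0"
    unfolding val[OF int_poly_hom_eval_at]
    using multiplier_neq_1_at_parameter_0[OF assms(1)] roots[OF int_poly_hom_eval_at[of 0]]
    by (auto simp: prod_mset_zero_iff)
  then have "r \<noteq> 0" by auto
  then have "embed_Qc r \<noteq> 0" by simp
  then have "0 \<notin># {#multiplier Qc.param n x - 1. x \<in># proots (map_poly embed_Qc P)#}"
    unfolding val[OF Qc.int_poly_hom_axioms] by (simp add: prod_mset_zero_iff)
  then show ?thesis using roots[OF Qc.int_poly_hom_axioms, of a] assms(2) by force
qed

text \<open>
  These turn out to be the roots of \<open>\<Phi>\<^sub>n\<^sup>*\<close> over the algebraic closure of \<open>\<rat>(c)\<close>.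
\<close>

definition Per :: "nat \<Rightarrow> Qc_closure set" where
  "Per n = {a. has_exact_period (quad Qc.param) n a}"

text \<open>
  A double root of \<open>P\<^sub>n\<close> would be a periodic point of multiplier \<open>1\<close>.
\<close>

lemma fixed_points_generic:
  assumes "n > 0"
  shows "finite {a. (quad Qc.param ^^ n) a = a}"
    and "map_poly embed_Qc (period_poly n) = lin_prod (mset_set {a. (quad Qc.param ^^ n) a = a})"
proof -
  let ?P = "map_poly embed_Qc (period_poly n)" let ?F = "{a. (quad Qc.param ^^ n) a = a}"
  have lc: "lead_coeff ?P = 1"
    by (rule lead_coeff_map_poly_monic[OF Qc.comm_ring_hom_axioms lead_coeff_period_poly[OF assms]])
  then have P0: "?P \<noteq> 0" by auto
  have F: "?F = {a. poly ?P a = 0}" by (simp add: Qc.at_period_poly)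
  show fin: "finite ?F" unfolding F using poly_roots_finite[OF P0] .
  have "order a ?P = 1" if "a \<in> ?F" for a
  proof -
    have "poly ?P a = 0" using that F by blast
    then have "order a ?P \<noteq> 0" using P0 order_root by blast
    moreover have "\<not> [:- a, 1:] ^ 2 dvd ?P"
    proof
      assume "[:- a, 1:] ^ 2 dvd ?P"
      then obtain q where "?P = [:- a, 1:] ^ 2 * q" by (elim dvdE)
      moreover have "poly [:- a, 1:] a = 0" by simp
      ultimately have "poly (pderiv ?P) a = 0"
        by (simp only: power2_eq_square pderiv_mult poly_add poly_mult mult_zero_left mult_zero_right add_0)
      moreover have "poly (pderiv ?P) a = multiplier Qc.param n a - 1"
      proof -
        have "pderiv (period_poly n) = pderiv (quad_iter n) - 1"
          by (simp add: period_poly_def pderiv_diff pderiv_pCons)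
        then show ?thesis unfolding Qc.map_poly_pderiv[symmetric]
          by (simp only: Qc.p.hom_minus Qc.p.hom_one poly_diff poly_1 Qc.at_pderiv_quad_iter)
      qed
      ultimately show False using generic_multiplier_neq_1[OF assms, of a] that by simp
    qed
    ultimately show ?thesis using order_divides[of a 2 ?P] P0 by auto
  qed
  note ord1 = this
  have "proots ?P = mset_set ?F"
  proof (rule multiset_eqI)
    fix a
    show "count (proots ?P) a = count (mset_set ?F) a"
    proof (cases "a \<in> ?F")
      case True
      then show ?thesis using ord1[OF True] P0 count_mset_set(1)[OF fin True] by simp
    next
      case False
      then have "order a ?P = 0" unfolding F using order_root[of ?P a] by blast
      then show ?thesis using P0 count_mset_set(3)[OF False] by simp
    qed
  qed
  from trans[OF monic_splits[OF lc] arg_cong[of _ _ lin_prod, OF this]]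
  show "?P = lin_prod (mset_set ?F)" .
qed

lemma PerD:
  assumes "a \<in> Per n"
  shows "n > 0" "(quad Qc.param ^^ n) a = a"
proof -
  have "has_exact_period (quad Qc.param) n a" using assms unfolding Per_def by (rule CollectD)
  then have "n > 0 \<and> (quad Qc.param ^^ n) a = a" unfolding has_exact_period_def by blast
  then show "n > 0" "(quad Qc.param ^^ n) a = a" by (rule conjunct1, rule conjunct2)
qed

lemma finite_Per [simp]: "finite (Per n)"
proof (cases "Per n = {}")
  case True
  show ?thesis unfolding True by (rule finite.emptyI)
next
  case False
  then obtain b where "b \<in> Per n" by blast
  note fin = fixed_points_generic(1)[OF PerD(1)[OF this]]
  have "Per n \<subseteq> {a. (quad Qc.param ^^ n) a = a}"
  proof
    fix a assume "a \<in> Per n"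
    then show "a \<in> {a. (quad Qc.param ^^ n) a = a}" by (intro CollectI) (rule PerD(2))
  qed
  from finite_subset[OF this fin] show ?thesis .
qed

lemma lin_prod_mset_set: "finite A \<Longrightarrow> lin_prod (mset_set A) = (\<Prod>a\<in>A. [:- a, 1:])"
  by (simp add: lin_prod_def prod_unfold_prod_mset)

lemma Per_disjoint: "i \<noteq> j \<Longrightarrow> Per i \<inter> Per j = {}"
proof (rule ccontr)
  assume "i \<noteq> j" "Per i \<inter> Per j \<noteq> {}"
  then obtain a where a: "has_exact_period (quad Qc.param) i a" "has_exact_period (quad Qc.param) j a"
    unfolding Per_def by blast
  then have "(quad Qc.param ^^ i) a = a" "(quad Qc.param ^^ j) a = a"
    unfolding has_exact_period_def by blast+
  then have "i dvd j" "j dvd i" using funpow_period_iff[OF a(1), of j] funpow_period_iff[OF a(2), of i] by blast+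
  with \<open>i \<noteq> j\<close> show False by (simp add: dvd_antisym)
qed

lemma period_poly_generic_factors:
  assumes "n > 0"
  shows "map_poly embed_Qc (period_poly n) = (\<Prod>k | k dvd n. lin_prod (mset_set (Per k)))"
proof -
  have fin: "finite {k. k dvd n}" using assms by simp
  have "{a. (quad Qc.param ^^ n) a = a} = (\<Union>k\<in>{k. k dvd n}. Per k)"
  proof (intro equalityI subsetI)
    fix a assume "a \<in> {a. (quad Qc.param ^^ n) a = a}"
    then show "a \<in> (\<Union>k\<in>{k. k dvd n}. Per k)"
      using exact_period_exists[of n "quad Qc.param" a] assms unfolding Per_def by blast
  next
    fix a assume "a \<in> (\<Union>k\<in>{k. k dvd n}. Per k)"
    then obtain k where "k dvd n" "has_exact_period (quad Qc.param) k a" unfolding Per_def by blast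
    then show "a \<in> {a. (quad Qc.param ^^ n) a = a}" using funpow_period_iff[of "quad Qc.param" k a n] by simp
  qed
  moreover have "(\<Prod>a\<in>(\<Union>k\<in>{k. k dvd n}. Per k). [:- a, 1:]) = (\<Prod>k | k dvd n. \<Prod>a\<in>Per k. [:- a, 1:])"
    by (rule prod.UNION_disjoint[OF fin]) (use Per_disjoint in simp_all)
  ultimately show ?thesis
    using fixed_points_generic[OF assms] by (simp add: lin_prod_mset_set)
qed

lemma lead_coeff_prod_monic:
  fixes f :: "'a \<Rightarrow> 'b :: idom poly"
  shows "(\<And>k. k \<in> A \<Longrightarrow> lead_coeff (f k) = 1) \<Longrightarrow> lead_coeff (prod f A) = 1"
  unfolding lead_coeff_prod by (rule prod.neutral) blast

text \<open>
  The factors of \<open>P\<^sub>n\<close> that belong to proper divisors of \<open>n\<close> have coefficients in \<open>\<int>[c]\<close> by induction, and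
  the remaining factor is the quotient of monic polynomials over \<open>\<int>[c]\<close>.
\<close>

lemma dynatomic_integral:
  assumes "n > 0"
  shows "\<exists>q. lead_coeff q = 1 \<and> map_poly embed_Qc q = lin_prod (mset_set (Per n))"
  using assms
proof (induction n rule: less_induct)
  case (less n)
  define D where "D = {k. k dvd n \<and> k \<noteq> n}"
  have finD: "finite D" using less.prems unfolding D_def by simp
  have "\<exists>q. lead_coeff q = 1 \<and> map_poly embed_Qc q = lin_prod (mset_set (Per k))" if "k \<in> D" for k
  proof (rule less.IH)
    have "k dvd n" "k \<noteq> n" using that unfolding D_def by blast+
    then show "k < n" "k > 0" using less.prems dvd_imp_le[of k n] dvd_pos_nat[of n k] by linarith+
  qed
  then have "\<exists>q. \<forall>k\<in>D. lead_coeff (q k) = 1 \<and> map_poly embed_Qc (q k) = lin_prod (mset_set (Per k))"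
    by (intro bchoice) blast
  then obtain q where q: "\<And>k. k \<in> D \<Longrightarrow> lead_coeff (q k) = 1"
      "\<And>k. k \<in> D \<Longrightarrow> map_poly embed_Qc (q k) = lin_prod (mset_set (Per k))" by blast
  have lq: "lead_coeff (prod q D) = 1" by (rule lead_coeff_prod_monic) (rule q)
  have mq: "map_poly embed_Qc (prod q D) = (\<Prod>k\<in>D. lin_prod (mset_set (Per k)))"
    unfolding Qc.p.hom_prod by (rule prod.cong[OF refl]) (rule q)
  have D: "{k. k dvd n} = insert n D" "n \<notin> D" by (auto simp: D_def)
  have P: "map_poly embed_Qc (period_poly n) = lin_prod (mset_set (Per n)) * map_poly embed_Qc (prod q D)"
    unfolding period_poly_generic_factors[OF less.prems] D(1) prod.insert[OF finD D(2)] mq ..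
  then have "prod q D dvd period_poly n"
    by (intro monic_dvd_descent[OF inj_comm_ring_hom_embed_Qc lq]) simp
  then obtain r where r: "period_poly n = prod q D * r" by (elim dvdE)
  have "lead_coeff r = 1"
    using lead_coeff_period_poly[OF less.prems] lq unfolding r lead_coeff_mult by simp
  moreover have "prod q D \<noteq> 0" using lq by auto
  then have "map_poly embed_Qc (prod q D) \<noteq> 0" by (simp only: Qcp.hom_0_iff not_False_eq_True)
  then have "map_poly embed_Qc r = lin_prod (mset_set (Per n))"
    using P unfolding r Qc.p.hom_mult by (metis mult.commute mult_left_cancel)
  ultimately show ?case by blast
qed

text \<open>
  For a prime divisor \<open>p\<close> of \<open>n\<close>, the squarefree divisors of \<open>n\<close> form pairs \<open>d\<close>, \<open>p * d\<close> with opposite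
  signs.
\<close>

lemma sum_moebius_divisors:
  assumes "n > 0"
  shows "(\<Sum>d | d dvd n. moebius_mu d) = (if n = 1 then 1 else 0)"
proof (cases "n = 1")
  case True
  then show ?thesis by (simp add: moebius_mu_def)
next
  case False
  then obtain p where p: "prime p" "p dvd n" using prime_factor_nat by blast
  let ?S = "{d. d dvd n \<and> squarefree d}"
  let ?A = "{d \<in> ?S. \<not> p dvd d}" let ?B = "{d \<in> ?S. p dvd d}"
  have fin: "finite {d. d dvd n}" using assms by simp
  have pd: "squarefree (p * d) \<longleftrightarrow> squarefree d" "prime_factors (p * d) = insert p (prime_factors d)"
    "p \<notin> prime_factors d" if "\<not> p dvd d" for d
  proof -
    have "d \<noteq> 0" using that by (metis dvd_0_right)
    have cop: "coprime p d" using that p by (simp add: prime_imp_coprime)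
    show "squarefree (p * d) \<longleftrightarrow> squarefree d"
      using squarefree_mult_coprime[OF cop] squarefree_multD(2) squarefree_prime p by blast
    show "prime_factors (p * d) = insert p (prime_factors d)"
      using p \<open>d \<noteq> 0\<close> by (subst prime_factors_product) (auto simp: prime_factorization_prime)
    show "p \<notin> prime_factors d" using that \<open>d \<noteq> 0\<close> by (simp add: in_prime_factors_iff)
  qed
  have "(\<Sum>d | d dvd n. moebius_mu d) = (\<Sum>d\<in>?S. moebius_mu d)"
    by (rule sum.mono_neutral_right) (use fin in \<open>auto simp: moebius_mu_def\<close>)
  also have "\<dots> = (\<Sum>d\<in>?A. moebius_mu d) + (\<Sum>d\<in>?B. moebius_mu d)"
    by (subst sum.union_disjoint[symmetric]) (use fin in \<open>auto intro!: sum.cong\<close>)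
  also have "(\<Sum>d\<in>?B. moebius_mu d) = (\<Sum>d\<in>?A. moebius_mu (p * d))"
  proof (rule sum.reindex_bij_witness[of _ "\<lambda>d. p * d" "\<lambda>d. d div p"])
    fix d assume "d \<in> ?B"
    then obtain e where e: "d = p * e" "squarefree d" "d dvd n" by blast
    have p0: "p > 0" using p prime_gt_0_nat by blast
    have ne: "\<not> p dvd e"
    proof
      assume "p dvd e"
      then have "p ^ 2 dvd d" using e by (simp add: power2_eq_square)
      then show False using e(2) p by (auto simp: squarefree_def)
    qed
    show "p * (d div p) = d" using e by simp
    have "e dvd n" using e by (metis dvd_mult_right)
    then show "d div p \<in> ?A" using e ne pd(1)[OF ne] p0 by simp
    show "moebius_mu (p * (d div p)) = moebius_mu d" using e by simp
  next
    fix d assume d: "d \<in> ?A"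
    show "p * d div p = d" using p by auto
    have "p * d dvd n" using d p by (auto intro!: divides_mult simp: prime_imp_coprime)
    then show "p * d \<in> ?B" using d pd(1)[of d] by simp
  qed
  also have "\<dots> = (\<Sum>d\<in>?A. - moebius_mu d)"
    by (rule sum.cong) (auto simp: moebius_mu_def pd)
  finally show ?thesis using False by (simp add: sum_negf)
qed

lemma power_int_sum:
  "(x :: 'a :: field) \<noteq> 0 \<Longrightarrow> x powi (\<Sum>i\<in>A. f i) = (\<Prod>i\<in>A. x powi f i)"
  by (induction A rule: infinite_finite_induct) (simp_all add: power_int_add)

lemma power_int_prod:
  "(\<Prod>i\<in>A. f i) powi (k :: int) = (\<Prod>i\<in>A. f i powi k :: 'a :: field)"
  by (induction A rule: infinite_finite_induct) (simp_all add: power_int_mult_distrib)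

lemma moebius_inversion_prod:
  fixes F G :: "nat \<Rightarrow> 'a :: field"
  assumes "n > 0" "\<And>k. k > 0 \<Longrightarrow> F k = (\<Prod>j | j dvd k. G j)" "\<And>k. k > 0 \<Longrightarrow> G k \<noteq> 0"
  shows "G n = (\<Prod>k | k dvd n. F k powi moebius_mu (n div k))"
proof -
  let ?D = "{k. k dvd n}"
  have fin: "finite ?D" using assms by simp
  have pos: "k > 0" if "k dvd n" for k using that assms(1) by (rule dvd_pos_nat[rotated])
  have "(\<Prod>k\<in>?D. F k powi moebius_mu (n div k)) =
      (\<Prod>k\<in>?D. \<Prod>j | j \<in> ?D \<and> j dvd k. G j powi moebius_mu (n div k))"
  proof (rule prod.cong[OF refl])
    fix k assume k: "k \<in> ?D"
    then have "{j. j dvd k} = {j. j \<in> ?D \<and> j dvd k}" by (auto dest: dvd_trans)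
    then show "F k powi moebius_mu (n div k) = (\<Prod>j | j \<in> ?D \<and> j dvd k. G j powi moebius_mu (n div k))"
      using assms(2)[of k] pos k by (simp add: power_int_prod)
  qed
  also have "\<dots> = (\<Prod>j\<in>?D. \<Prod>k | k \<in> ?D \<and> j dvd k. G j powi moebius_mu (n div k))"
    by (rule prod.swap_restrict[OF fin fin])
  also have "\<dots> = (\<Prod>j\<in>?D. G j powi (if j = n then 1 else 0))"
  proof (rule prod.cong[OF refl])
    fix j assume j: "j \<in> ?D"
    have "(\<Sum>k | k \<in> ?D \<and> j dvd k. moebius_mu (n div k)) = (\<Sum>d | d dvd n div j. moebius_mu d)"
    proof (rule sum.reindex_bij_witness[of _ "\<lambda>d. n div d" "\<lambda>k. n div k"])
      fix k assume k: "k \<in> {k. k \<in> ?D \<and> j dvd k}"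
      then have kn: "k dvd n" "j dvd k" by blast+
      from kn(1) obtain a where a: "n = k * a" by (rule dvdE)
      from kn(2) obtain b where "k = j * b" by (rule dvdE)
      note ab = a this
      show "n div (n div k) = k" using ab assms(1) by simp
      show "n div k \<in> {d. d dvd n div j}" using ab assms(1) by (simp add: mult.assoc)
    next
      fix d assume d: "d \<in> {d. d dvd n div j}"
      then obtain a where "n div j = d * a" by auto
      then have n: "n = j * (d * a)" using j dvd_mult_div_cancel[of j n] by simp
      then have d0: "d > 0" "a > 0" "j > 0" using assms(1) by auto
      have nd: "n = d * (j * a)" using n by simp
      then have nda: "n div d = j * a" using d0 by simp
      show "n div (n div d) = d" unfolding nda using d0 nd by simp
      show "n div d \<in> {k. k \<in> ?D \<and> j dvd k}" unfolding nda using nd by simp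
    qed simp
    also have "\<dots> = (if j = n then 1 else 0)"
    proof -
      have eq: "j * (n div j) = n" using j by simp
      then have "n div j > 0" using assms(1) by (cases "n div j") simp_all
      moreover have "n div j = 1 \<longleftrightarrow> j = n" 
      proof
        assume "n div j = 1"
        then show "j = n" using eq by simp
      next
        assume "j = n"
        then show "n div j = 1" using assms(1) by simp
      qed
      ultimately show ?thesis using sum_moebius_divisors[of "n div j"] by simp
    qed
    finally show "(\<Prod>k | k \<in> ?D \<and> j dvd k. G j powi moebius_mu (n div k)) = G j powi (if j = n then 1 else 0)"
      using power_int_sum[OF assms(3)[OF pos[of j]], of "\<lambda>k. moebius_mu (n div k)", symmetric] j by simp
  qed
  also have "\<dots> = (\<Prod>j\<in>?D. if j = n then G n else 1)" by (rule prod.cong) auto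
  also have "\<dots> = G n" using fin by (simp add: prod.delta)
  finally show ?thesis by simp
qed

text \<open>
  Moebius inversion of \<open>P\<^sub>n = \<Prod>\<^sub>k\<^sub>|\<^sub>n q\<^sub>k\<close> turns the defining product of fractions into the polynomial with
  the points of exact period \<open>n\<close> as its roots.
\<close>

theorem dynatomic_facts:
  assumes "n > 0"
  shows lead_coeff_dynatomic: "lead_coeff (dynatomic n) = 1"
    and map_dynatomic: "map_poly embed_Qc (dynatomic n) = lin_prod (mset_set (Per n))"
proof -
  have "\<exists>q. \<forall>k. k > 0 \<longrightarrow> lead_coeff (q k) = 1 \<and> map_poly embed_Qc (q k) = lin_prod (mset_set (Per k))"
    by (intro choice) (use dynatomic_integral in blast)
  then obtain q where q: "\<And>k. k > 0 \<Longrightarrow> lead_coeff (q k) = 1"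
      "\<And>k. k > 0 \<Longrightarrow> map_poly embed_Qc (q k) = lin_prod (mset_set (Per k))" by blast
  have pp: "period_poly k = (\<Prod>j | j dvd k. q j)" if "k > 0" for k
  proof -
    have "map_poly embed_Qc (period_poly k) = (\<Prod>j | j dvd k. map_poly embed_Qc (q j))"
      unfolding period_poly_generic_factors[OF that]
    proof (rule prod.cong[OF refl])
      fix j assume "j \<in> {j. j dvd k}"
      then have "j > 0" using dvd_pos_nat[OF that] by blast
      then show "lin_prod (mset_set (Per j)) = map_poly embed_Qc (q j)" by (simp only: q(2))
    qed
    then have "map_poly embed_Qc (period_poly k) = map_poly embed_Qc (\<Prod>j | j dvd k. q j)"
      by (simp add: hom_distribs)
    then show ?thesis by (simp only: Qcp.eq_iff)
  qed
  have tp: "to_fract (\<Prod>j\<in>A. q j) = (\<Prod>j\<in>A. to_fract (q j))" for A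
    by (induction A rule: infinite_finite_induct) auto
  have "to_fract (q n) = (\<Prod>k | k dvd n. to_fract (period_poly k) powi moebius_mu (n div k))"
  proof (rule moebius_inversion_prod[OF assms])
    show "to_fract (period_poly k) = (\<Prod>j | j dvd k. to_fract (q j))" if "k > 0" for k
      using pp[OF that] tp by simp
    show "to_fract (q k) \<noteq> 0" if "k > 0" for k using q(1)[OF that] by auto
  qed
  note qn = this[unfolded period_poly_def]
  have "dynatomic n = q n" unfolding dynatomic_def
  proof (rule the_equality)
    show "to_fract (q n) = (\<Prod>k | k dvd n. to_fract (quad_iter k - [:0, 1:]) powi moebius_mu (n div k))"
      by (rule qn)
    fix p assume "to_fract p = (\<Prod>k | k dvd n. to_fract (quad_iter k - [:0, 1:]) powi moebius_mu (n div k))"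
    from trans[OF this qn[symmetric]] show "p = q n" unfolding to_fract_eq_iff .
  qed
  then show "lead_coeff (dynatomic n) = 1"
    "map_poly embed_Qc (dynatomic n) = lin_prod (mset_set (Per n))" using q[OF assms] by auto
qed

lemma period_poly_eq_prod_dynatomic:
  assumes "n > 0"
  shows "period_poly n = (\<Prod>k | k dvd n. dynatomic k)"
proof -
  have "map_poly embed_Qc (period_poly n) = (\<Prod>k | k dvd n. map_poly embed_Qc (dynatomic k))"
    unfolding period_poly_generic_factors[OF assms]
  proof (rule prod.cong[OF refl])
    fix k assume "k \<in> {k. k dvd n}"
    then have "k > 0" using dvd_pos_nat[OF assms] by blast
    then show "lin_prod (mset_set (Per k)) = map_poly embed_Qc (dynatomic k)" by (simp only: map_dynatomic)
  qed
  then have "map_poly embed_Qc (period_poly n) = map_poly embed_Qc (\<Prod>k | k dvd n. dynatomic k)"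
    by (simp add: hom_distribs)
  then show ?thesis by (simp only: Qcp.eq_iff)
qed

section \<open>Norms and the multiplier polynomials\<close>

text \<open>
  The norm of \<open>q\<close> from \<open>\<int>[c][z]/(\<Phi>\<^sub>n\<^sup>*)\<close> to \<open>\<int>[c]\<close>, that is, the resultant of \<open>\<Phi>\<^sub>n\<^sup>*\<close> and \<open>q\<close>.
\<close>

definition period_norm :: "nat \<Rightarrow> int poly poly \<Rightarrow> int poly" where
  "period_norm n q = root_norm (dynatomic n) q"

lemma embed_period_norm:
  assumes "n > 0"
  shows "embed_Qc (period_norm n q) = (\<Prod>a\<in>Per n. Qc.ev q a)"
  using hom_root_norm[OF Qc.comm_ring_hom_axioms lead_coeff_dynatomic[OF assms] map_dynatomic[OF assms], of q]
  by (simp only: period_norm_def prod_unfold_prod_mset)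

lemma period_norm_mult:
  assumes "n > 0"
  shows "period_norm n (p * q) = period_norm n p * period_norm n q"
proof -
  have "embed_Qc (period_norm n (p * q)) = embed_Qc (period_norm n p * period_norm n q)"
    unfolding Qc.hom_mult embed_period_norm[OF assms] Qc.p.hom_mult poly_mult prod.distrib ..
  then show ?thesis by (simp only: Qc.eq_iff)
qed

lemma period_norm_1: "n > 0 \<Longrightarrow> period_norm n 1 = 1"
proof -
  assume n: "n > 0"
  have "embed_Qc (period_norm n 1) = embed_Qc 1"
    unfolding embed_period_norm[OF n] Qc.p.hom_one Qc.hom_one by simp
  then show ?thesis by (simp only: Qc.eq_iff)
qed

lemma period_norm_prod:
  "n > 0 \<Longrightarrow> period_norm n (\<Prod>k\<in>A. f k) = (\<Prod>k\<in>A. period_norm n (f k))"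
  by (induction A rule: infinite_finite_induct) (simp_all add: period_norm_mult period_norm_1)

lemma period_norm_eq_0_iff:
  assumes "n > 0"
  shows "period_norm n q = 0 \<longleftrightarrow> (\<exists>a\<in>Per n. Qc.ev q a = 0)"
proof -
  have "period_norm n q = 0 \<longleftrightarrow> embed_Qc (period_norm n q) = 0" by (simp only: Qc.hom_0_iff)
  also have "\<dots> \<longleftrightarrow> (\<exists>a\<in>Per n. Qc.ev q a = 0)"
    unfolding embed_period_norm[OF assms] prod_zero_iff[OF finite_Per] by blast
  finally show ?thesis .
qed

lemma comm_ring_hom_const_poly: "comm_ring_hom (\<lambda>a :: 'a :: comm_ring_1. [:a:])"
  by unfold_locales (simp_all add: one_pCons mult.commute)

lemma poly_map_const_poly:
  "poly (map_poly (\<lambda>a. [:a:]) p) [:x:] = [:poly p (x :: 'a :: comm_ring_1):]"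
proof -
  interpret comm_ring_hom "\<lambda>a :: 'a. [:a:]" by (rule comm_ring_hom_const_poly)
  interpret p: map_poly_comm_ring_hom "\<lambda>a :: 'a. [:a:]" ..
  show ?thesis by (induction p) (simp_all add: p.map_poly_pCons_hom)
qed

text \<open>
  The polynomial \<open>\<Prod>(x - (f\<^sup>n)'(\<alpha>))\<close> over the roots \<open>\<alpha>\<close> of \<open>\<Phi>\<^sub>n\<^sup>*\<close>, as the norm of \<open>x - (f\<^sup>n)'(z)\<close> over the
  coefficient ring \<open>\<int>[c][x]\<close>.
\<close>

definition multiplier_poly :: "nat \<Rightarrow> int poly poly" where
  "multiplier_poly n = root_norm (map_poly (\<lambda>a. [:a:]) (dynatomic n))
     ([:[:0, 1:]:] - map_poly (\<lambda>a. [:a:]) (pderiv (quad_iter n)))"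

text \<open>
  For the embedding into the closure of \<open>\<rat>(c)\<close> this gives the product in the definition of \<open>\<delta>\<^sub>n\<close>; for
  other specialisations it describes the multipliers at a given parameter.
\<close>

lemma map_multiplier_poly:
  fixes h :: "int poly \<Rightarrow> 'b :: idom"
  assumes n: "n > 0" and h: "comm_ring_hom h" and sp: "map_poly h (dynatomic n) = lin_prod A"
  shows "map_poly h (multiplier_poly n) = (\<Prod>a\<in>#A. [:- multiplier (h [:0, 1:]) n a, 1:])"
proof -
  interpret int_poly_hom h using h by (simp only: int_poly_hom_def)
  interpret c1: comm_ring_hom "\<lambda>a :: int poly. [:a:]" by (rule comm_ring_hom_const_poly)
  interpret c2: comm_ring_hom "\<lambda>a :: 'b. [:a:]" by (rule comm_ring_hom_const_poly)
  interpret c2p: map_poly_comm_ring_hom "\<lambda>a :: 'b. [:a:]" ..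
  interpret pp: map_poly_comm_ring_hom "map_poly h" ..
  have lift: "map_poly (map_poly h) (map_poly (\<lambda>a. [:a:]) p) = map_poly (\<lambda>a. [:a:]) (map_poly h p)" for p
    by (rule poly_eqI) (simp add: coeff_map_poly map_poly_pCons_hom)
  have l1: "lead_coeff (map_poly (\<lambda>a. [:a:]) (dynatomic n)) = 1"
    by (rule lead_coeff_map_poly_monic[OF comm_ring_hom_const_poly lead_coeff_dynatomic[OF n]])
  have l2: "map_poly (map_poly h) (map_poly (\<lambda>a. [:a:]) (dynatomic n)) = lin_prod (image_mset (\<lambda>a. [:a:]) A)"
    unfolding lift sp by (rule map_poly_lin_prod[OF comm_ring_hom_const_poly])
  have v: "poly (map_poly (map_poly h) ([:[:0, 1:]:] - map_poly (\<lambda>a. [:a:]) (pderiv (quad_iter n)))) [:a:]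
      = [:- multiplier param n a, 1:]" for a
  proof -
    have "poly (map_poly (\<lambda>a. [:a:]) (map_poly h (pderiv (quad_iter n)))) [:a:] = [:multiplier param n a:]"
      using poly_map_const_poly[of "map_poly h (pderiv (quad_iter n))" a] by (simp only: at_pderiv_quad_iter)
    moreover have "poly (map_poly (map_poly h) [:[:0, 1:]:]) [:a:] = [:0, 1:]"
      by (simp add: map_poly_pCons)
    ultimately show ?thesis unfolding pp.hom_minus lift poly_diff by simp
  qed
  have "map_poly h (multiplier_poly n) = (\<Prod>a\<in>#image_mset (\<lambda>a. [:a:]) A.
      poly (map_poly (map_poly h) ([:[:0, 1:]:] - map_poly (\<lambda>a. [:a:]) (pderiv (quad_iter n)))) a)"
    unfolding multiplier_poly_def by (rule hom_root_norm[OF p.comm_ring_hom_axioms l1 l2])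
  also have "\<dots> = (\<Prod>a\<in>#A. [:- multiplier param n a, 1:])"
    unfolding image_mset.compositionality o_def v ..
  finally show ?thesis .
qed

lemma monic_root_descent_Qc:
  assumes "lead_coeff D = 1" "D ^ n = map_poly embed_Qc G" "n > 0"
  shows "\<exists>D0. lead_coeff D0 = 1 \<and> D = map_poly embed_Qc D0"
proof -
  have fh: "field_hom (to_ac :: int poly fract \<Rightarrow> _)" by unfold_locales auto
  then interpret t: field_hom "to_ac :: int poly fract \<Rightarrow> _" .
  interpret tp: map_poly_inj_comm_ring_hom "to_ac :: int poly fract \<Rightarrow> _" ..
  have comp: "map_poly embed_Qc p = map_poly to_ac (map_poly to_fract p)" for p
    by (subst map_poly_map_poly) (simp_all add: o_def embed_Qc_def[abs_def])
  have "of_nat n = embed_Qc (of_nat n)" by (simp only: Qc.hom_of_nat)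
  then have "(of_nat n :: Qc_closure) \<noteq> 0" using assms(3) by simp
  from monic_root_descent_field[OF fh assms(1) assms(2)[unfolded comp] this]
  obtain D1 where D1: "D = map_poly to_ac D1" by blast
  have "degree D = degree D1" unfolding D1 by simp
  then have "to_ac (lead_coeff D1) = to_ac 1" using assms(1) unfolding D1 by (simp add: coeff_map_poly)
  then have "lead_coeff D1 = 1" by (simp only: t.eq_iff)
  moreover have "map_poly to_ac (D1 ^ n) = map_poly to_ac (map_poly to_fract G)"
    using assms(2) unfolding D1 comp by (simp only: tp.hom_power)
  then have "D1 ^ n = map_poly to_fract G" by (simp only: tp.eq_iff)
  ultimately obtain D0 where "lead_coeff D0 = 1" "D1 = map_poly to_fract D0"
    using monic_root_descent_fract[of D1 n G] assms(3) by blast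
  then show ?thesis unfolding D1 comp by blast
qed

lemma Per_shift: "a \<in> Per n \<Longrightarrow> quad Qc.param a \<in> Per n"
  unfolding Per_def by (simp add: has_exact_period_shift)

text \<open>
  The product of \<open>x - multiplier\<close> over cycle representatives is an \<open>n\<close>-th root of \<open>multiplier_poly n\<close>; it
  descends to \<open>\<int>[c]\<close>, and it is the only monic one. The representatives \<open>B\<close> are kept together with the
  splitting of cycle-invariant products, as products over \<open>B\<close> occur as resultants with \<open>\<delta>\<^sub>n\<close>.
\<close>

lemma delta_facts:
  assumes "n > 0"
  shows lead_coeff_delta: "lead_coeff (delta n) = 1"
    and delta_power: "delta n ^ n = multiplier_poly n"
    and delta_generic: "\<exists>B\<subseteq>Per n. map_poly embed_Qc (delta n) = (\<Prod>a\<in>B. [:- multiplier Qc.param n a, 1:]) \<and>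
      (\<forall>g. (\<forall>a\<in>Per n. g (quad Qc.param a) = g a) \<longrightarrow> (\<Prod>a\<in>Per n. g a) = (\<Prod>a\<in>B. g a :: Qc_closure) ^ n)"
proof -
  let ?f = "quad Qc.param" let ?l = "\<lambda>a. [:- multiplier Qc.param n a, 1:]"
  have per: "has_exact_period ?f n a" if "a \<in> Per n" for a using that by (simp add: Per_def)
  have inv: "multiplier Qc.param n (?f a) = multiplier Qc.param n a" if "a \<in> Per n" for a
    by (rule multiplier_shift[OF PerD(2)[OF that]])
  obtain B where B: "B \<subseteq> Per n"
      "\<And>g :: _ \<Rightarrow> Qc_closure poly. (\<forall>x\<in>Per n. g (?f x) = g x) \<Longrightarrow> (\<Prod>x\<in>Per n. g x) = (\<Prod>x\<in>B. g x) ^ n"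
    using cycle_representatives[of "Per n" ?f n, OF finite_Per Per_shift per] by blast
  define D where "D = (\<Prod>a\<in>B. ?l a)"
  have lD: "lead_coeff D = 1" unfolding D_def by (rule lead_coeff_prod_monic) simp
  have G: "map_poly embed_Qc (multiplier_poly n) = (\<Prod>a\<in>Per n. ?l a)"
    unfolding map_multiplier_poly[OF assms Qc.comm_ring_hom_axioms map_dynatomic[OF assms]] prod_unfold_prod_mset ..
  also have "\<dots> = D ^ n" unfolding D_def by (rule B(2)) (intro ballI, simp only: inv)
  finally have DG: "D ^ n = map_poly embed_Qc (multiplier_poly n)" ..
  from monic_root_descent_Qc[OF lD DG assms] obtain d where d: "lead_coeff d = 1" "D = map_poly embed_Qc d" by blast
  have pr: "proots (map_poly embed_Qc (dynatomic n)) = mset_set (Per n)"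
    unfolding map_dynatomic[OF assms] by simp
  have rhs: "(\<Prod>\<alpha>\<in>#proots (map_poly embed_Qc (dynatomic n)).
          [:- poly (pderiv (map_poly embed_Qc (quad_iter n))) \<alpha>, 1:]) = D ^ n"
    unfolding pr Qc.map_poly_pderiv[symmetric] Qc.at_pderiv_quad_iter DG G prod_unfold_prod_mset ..
  have "delta n = d" unfolding delta_def rhs
  proof (rule the_equality)
    show "lead_coeff d = 1 \<and> map_poly embed_Qc d ^ n = D ^ n" using d by simp
    fix e assume e: "lead_coeff e = 1 \<and> map_poly embed_Qc e ^ n = D ^ n"
    then have "map_poly embed_Qc (e ^ n) = map_poly embed_Qc (d ^ n)"
      unfolding d(2) Qc.p.hom_power by blast
    then have "e ^ n = d ^ n" by (simp only: Qcp.eq_iff)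
    then show "e = d" by (rule monic_power_eq_imp_eq[OF conjunct1[OF e] d(1)]) (use assms in simp)
  qed
  note delta_eq = this
  show "lead_coeff (delta n) = 1" unfolding delta_eq by (rule d(1))
  have "map_poly embed_Qc (d ^ n) = map_poly embed_Qc (multiplier_poly n)"
    unfolding Qc.p.hom_power d(2)[symmetric] by (rule DG)
  then show "delta n ^ n = multiplier_poly n" unfolding delta_eq by (simp only: Qcp.eq_iff)
  have "(\<Prod>a\<in>Per n. g a) = (\<Prod>a\<in>B. g a) ^ n" if g: "\<forall>a\<in>Per n. g (?f a) = g a" for g :: "Qc_closure \<Rightarrow> Qc_closure"
  proof -
    have "(\<Prod>a\<in>Per n. [:g a:]) = (\<Prod>a\<in>B. [:g a:]) ^ n" by (rule B(2)) (use g in simp)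
    moreover have "poly (\<Prod>a\<in>C. [:g a:]) 0 = (\<Prod>a\<in>C. g a)" for C by (simp add: poly_prod)
    ultimately show ?thesis by (metis poly_power)
  qed
  then show "\<exists>B\<subseteq>Per n. map_poly embed_Qc (delta n) = (\<Prod>a\<in>B. ?l a) \<and>
      (\<forall>g. (\<forall>a\<in>Per n. g (?f a) = g a) \<longrightarrow> (\<Prod>a\<in>Per n. g a) = (\<Prod>a\<in>B. g a :: Qc_closure) ^ n)"
    unfolding delta_eq d(2)[symmetric] D_def using B(1) by blast
qed

section \<open>Cyclotomic polynomials\<close>

definition unity_root :: "nat \<Rightarrow> nat \<Rightarrow> complex" where
  "unity_root n k = cis (2 * pi * real k / real n)"

lemma unity_root_cancel:
  assumes "g > 0"
  shows "unity_root (d * g) (k * g) = unity_root d k"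
proof -
  have "2 * pi * real (k * g) / real (d * g) = 2 * pi * real k / real d"
    using assms by (cases "d = 0") (simp_all add: field_simps)
  then show ?thesis by (simp only: unity_root_def)
qed

lemma prod_roots_of_unity:
  assumes "n > 0"
  shows "monom 1 n - 1 = (\<Prod>k\<in>{0<..n}. [:- unity_root n k, 1:])"
proof -
  define M where "M = (monom 1 n :: complex poly)"
  have M: "degree M = n" "lead_coeff M = 1" by (simp_all add: M_def degree_monom_eq)
  have d: "degree (- 1 :: complex poly) < degree M" using assms M by simp
  let ?p = "M + (- 1)"
  have lc: "lead_coeff ?p = 1" and dp: "degree ?p = n"
    using monic_add_lower_degree[OF M(2) d] M(1) by blast+
  have r: "poly ?p z = 0 \<longleftrightarrow> z ^ n = 1" for z by (simp add: M_def poly_monom)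
  have p0: "?p \<noteq> 0" using lc by (metis leading_coeff_0_iff zero_neq_one)
  have ss: "set_mset (proots ?p) = {z. z ^ n = 1}" unfolding set_count_proots[OF p0] using r by blast
  have "size (proots ?p) = n" using dp size_proots_complex[of ?p] by simp
  moreover have "card (set_mset (proots ?p)) = n" unfolding ss
    by (rule Complex.card_roots_unity_eq[OF assms])
  ultimately have "size (mset_set (set_mset (proots ?p))) = size (proots ?p)" by simp
  then have "mset_set (set_mset (proots ?p)) = proots ?p"
    by (metis less_irrefl mset_set_set_mset_msubset mset_subset_size subset_mset.le_neq_trans)
  then have eq: "proots ?p = mset_set {z. z ^ n = 1}" unfolding ss by (rule sym)
  have fin: "finite {z :: complex. z ^ n = 1}" unfolding ss[symmetric] by simp
  have "monom 1 n - 1 = ?p" by (simp add: M_def)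
  also have "\<dots> = lin_prod (mset_set {z. z ^ n = 1})"
    by (rule trans[OF monic_splits[OF lc] arg_cong[of _ _ lin_prod, OF eq]])
  also have "\<dots> = (\<Prod>z | z ^ n = 1. [:- z, 1:])" by (rule lin_prod_mset_set[OF fin])
  also have "\<dots> = (\<Prod>k<n. [:- unity_root n k, 1:])"
    unfolding unity_root_def
    by (rule prod.reindex_bij_betw[OF Complex.bij_betw_roots_unity[OF assms], of "\<lambda>z. [:- z, 1:]", symmetric])
  also have "\<dots> = (\<Prod>k\<in>{0<..n}. [:- unity_root n k, 1:])"
  proof (rule prod.reindex_bij_witness[of _ "\<lambda>k. if k = n then 0 else k" "\<lambda>k. if k = 0 then n else k"])
    fix k assume "k \<in> {..<n}"
    then show "[:- unity_root n (if k = 0 then n else k), 1:] = [:- unity_root n k, 1:]"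
      using assms by (simp add: unity_root_def)
  qed auto
  finally show ?thesis .
qed

text \<open>
  Every fraction \<open>k/n\<close> in the interval \<open>(0, 1]\<close> has a unique reduced form, with a divisor of \<open>n\<close> as its
  denominator.
\<close>

lemma prod_cyclotomic_complex:
  assumes "n > 0"
  shows "monom 1 n - 1 = (\<Prod>d | d dvd n. \<Prod>k\<in>totatives d. [:- unity_root d k, 1:])"
proof -
  have fin: "finite {d. d dvd n}" using assms by simp
  have "(\<Prod>k\<in>{0<..n}. [:- unity_root n k, 1:]) = (\<Prod>k\<in>(\<Union>d\<in>{d. d dvd n}. {k\<in>{0<..n}. gcd k n = n div d}). [:- unity_root n k, 1:])"
  proof (rule prod.cong)
    show "{0<..n} = (\<Union>d\<in>{d. d dvd n}. {k\<in>{0<..n}. gcd k n = n div d})"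
    proof (intro equalityI subsetI)
      fix k assume k: "k \<in> {0<..n}"
      have "n div (n div gcd k n) = gcd k n" using assms by (simp add: div_div_eq_right)
      then have "gcd k n = n div (n div gcd k n)" by simp
      moreover have "n div gcd k n dvd n" by (simp add: div_dvd_iff_mult assms)
      ultimately show "k \<in> (\<Union>d\<in>{d. d dvd n}. {k\<in>{0<..n}. gcd k n = n div d})" using k by blast
    qed auto
  qed auto
  also have "\<dots> = (\<Prod>d | d dvd n. \<Prod>k\<in>{k\<in>{0<..n}. gcd k n = n div d}. [:- unity_root n k, 1:])"
  proof (rule prod.UNION_disjoint[OF fin])
    show "\<forall>i\<in>{d. d dvd n}. \<forall>j\<in>{d. d dvd n}. i \<noteq> j \<longrightarrow>
      {k\<in>{0<..n}. gcd k n = n div i} \<inter> {k\<in>{0<..n}. gcd k n = n div j} = {}"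
    proof (intro ballI impI equals0I)
      fix i j k assume ij: "i \<in> {d. d dvd n}" "j \<in> {d. d dvd n}" "i \<noteq> j"
        "k \<in> {k\<in>{0<..n}. gcd k n = n div i} \<inter> {k\<in>{0<..n}. gcd k n = n div j}"
      then have "n div i = n div j" "i * (n div i) = n" "j * (n div j) = n" by auto
      then have "i * (n div i) = j * (n div i)" "n div i \<noteq> 0" using assms by (auto intro: gr0I)
      then show False using ij(3) by simp
    qed
  qed auto
  also have "\<dots> = (\<Prod>d | d dvd n. \<Prod>k\<in>totatives d. [:- unity_root d k, 1:])"
  proof (rule prod.cong[OF refl])
    fix d assume "d \<in> {d. d dvd n}"
    then have d: "d dvd n" by simp
    then have dn: "d * (n div d) = n" by simp
    then have pos: "n div d > 0" "d > 0" using assms by (auto intro: gr0I)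
    have bij: "bij_betw (\<lambda>k. k * (n div d)) (totatives d) {k\<in>{0<..n}. gcd k n = n div d}"
    proof -
      have "n div d dvd n" by (metis dn dvd_triv_right)
      moreover have "n div (n div d) = d" using dn pos(1)
        by (metis nonzero_mult_div_cancel_right less_numeral_extra(3))
      ultimately show ?thesis using bij_betw_totatives_gcd_eq[of "n div d" n] assms by simp
    qed
    have "(\<Prod>k\<in>{k\<in>{0<..n}. gcd k n = n div d}. [:- unity_root n k, 1:]) =
        (\<Prod>k\<in>totatives d. [:- unity_root n (k * (n div d)), 1:])"
      by (rule prod.reindex_bij_betw[OF bij, symmetric])
    also have "\<dots> = (\<Prod>k\<in>totatives d. [:- unity_root d k, 1:])"
      using unity_root_cancel[OF pos(1), of d] by (simp only: dn)
    finally show "(\<Prod>k\<in>{k\<in>{0<..n}. gcd k n = n div d}. [:- unity_root n k, 1:]) =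
        (\<Prod>k\<in>totatives d. [:- unity_root d k, 1:])" .
  qed
  finally show ?thesis unfolding prod_roots_of_unity[OF assms] .
qed

text \<open>
  By induction and division by monic polynomials, as for the dynatomic polynomials.
\<close>

lemma cyclotomic_integral:
  assumes "n > 0"
  shows "\<exists>q. lead_coeff q = 1 \<and> map_poly complex_of_int q = (\<Prod>k\<in>totatives n. [:- unity_root n k, 1:])"
  using assms
proof (induction n rule: less_induct)
  case (less n)
  let ?c = "\<lambda>d. \<Prod>k\<in>totatives d. [:- unity_root d k, 1:]"
  define D where "D = {k. k dvd n \<and> k \<noteq> n}"
  have finD: "finite D" using less.prems unfolding D_def by simp
  have "\<exists>q. lead_coeff q = 1 \<and> map_poly complex_of_int q = ?c k" if "k \<in> D" for k
  proof (rule less.IH)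
    have "k dvd n" "k \<noteq> n" using that unfolding D_def by blast+
    then show "k < n" "k > 0" using less.prems dvd_imp_le[of k n] dvd_pos_nat[of n k] by linarith+
  qed
  then have "\<exists>q. \<forall>k\<in>D. lead_coeff (q k) = 1 \<and> map_poly complex_of_int (q k) = ?c k"
    by (intro bchoice) blast
  then obtain q where q: "\<And>k. k \<in> D \<Longrightarrow> lead_coeff (q k) = 1"
      "\<And>k. k \<in> D \<Longrightarrow> map_poly complex_of_int (q k) = ?c k" by blast
  have lq: "lead_coeff (prod q D) = 1" by (rule lead_coeff_prod_monic) (rule q)
  have mq: "map_poly complex_of_int (prod q D) = (\<Prod>k\<in>D. ?c k)"
    unfolding of_int_poly_hom.hom_prod by (rule prod.cong[OF refl]) (rule q)
  have D: "{k. k dvd n} = insert n D" "n \<notin> D" by (auto simp: D_def)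
  have mon: "map_poly complex_of_int (monom 1 n - 1) = monom 1 n - 1"
    by (simp add: hom_distribs)
  have P: "map_poly complex_of_int (monom 1 n - 1) = ?c n * map_poly complex_of_int (prod q D)"
    unfolding mon prod_cyclotomic_complex[OF less.prems] D(1) prod.insert[OF finD D(2)] mq ..
  have inj: "inj_comm_ring_hom complex_of_int" by unfold_locales
  have "prod q D dvd monom 1 n - 1"
    by (rule monic_dvd_descent[OF inj lq]) (simp only: P dvd_triv_right)
  then obtain r where r: "monom 1 n - 1 = prod q D * r" by (elim dvdE)
  have "degree (- 1 :: int poly) < degree (monom 1 n :: int poly)" "lead_coeff (monom 1 n :: int poly) = 1"
    using less.prems by (simp_all add: degree_monom_eq)
  from monic_add_lower_degree(2)[OF this(2,1)] have "lead_coeff (prod q D * r) = 1"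
    unfolding r[symmetric] by simp
  then have "lead_coeff r = 1" unfolding lead_coeff_mult lq by simp
  moreover have "map_poly complex_of_int (prod q D) \<noteq> 0" using lq by auto
  then have "map_poly complex_of_int r = ?c n"
    using P unfolding r of_int_poly_hom.hom_mult by (metis mult.commute mult_left_cancel)
  ultimately show ?case by blast
qed

lemma cyclotomic_facts:
  assumes "n > 0"
  shows lead_coeff_cyclotomic: "lead_coeff (cyclotomic n) = 1"
    and map_cyclotomic: "map_poly complex_of_int (cyclotomic n) = lin_prod (image_mset (unity_root n) (mset_set (totatives n)))"
proof -
  have inj: "inj (map_poly complex_of_int)" by (rule injI) simp
  obtain q where q: "lead_coeff q = 1" "map_poly complex_of_int q = (\<Prod>k\<in>totatives n. [:- unity_root n k, 1:])"
    using cyclotomic_integral[OF assms] by blast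
  have "cyclotomic n = q"
    unfolding cyclotomic_def
  proof (rule the_equality)
    show "map_poly complex_of_int q = (\<Prod>k\<in>totatives n. [:- cis (2 * pi * real k / real n), 1:])"
      using q(2) by (simp only: unity_root_def)
    fix p assume "map_poly complex_of_int p = (\<Prod>k\<in>totatives n. [:- cis (2 * pi * real k / real n), 1:])"
    then have "map_poly complex_of_int p = map_poly complex_of_int q"
      using q(2) by (simp only: unity_root_def)
    then show "p = q" using inj by (simp only: inj_eq)
  qed
  then show "lead_coeff (cyclotomic n) = 1" using q(1) by simp
  show "map_poly complex_of_int (cyclotomic n) = lin_prod (image_mset (unity_root n) (mset_set (totatives n)))"
    unfolding \<open>cyclotomic n = q\<close> q(2) lin_prod_def image_mset.compositionality o_def prod_unfold_prod_mset ..
qed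

lemma prod_cyclotomic:
  assumes "n > 0"
  shows "monom 1 n - 1 = (\<Prod>d | d dvd n. cyclotomic d)"
proof -
  have inj: "inj (map_poly complex_of_int)" by (rule injI) simp
  have mon: "map_poly complex_of_int (monom 1 n - 1) = monom 1 n - 1"
    by (simp add: hom_distribs)
  have "map_poly complex_of_int (monom 1 n - 1) = map_poly complex_of_int (\<Prod>d | d dvd n. cyclotomic d)"
    unfolding mon prod_cyclotomic_complex[OF assms] of_int_poly_hom.hom_prod
  proof (rule prod.cong[OF refl])
    fix d assume "d \<in> {d. d dvd n}"
    then have "d > 0" using dvd_pos_nat[OF assms] by blast
    show "(\<Prod>k\<in>totatives d. [:- unity_root d k, 1:]) = map_poly complex_of_int (cyclotomic d)"
      unfolding map_cyclotomic[OF \<open>d > 0\<close>] lin_prod_def image_mset.compositionality o_def prod_unfold_prod_mset ..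
  qed
  then show ?thesis using inj by (simp only: inj_eq)
qed

text \<open>
  A number of multiplicative order \<open>n\<close> is a root of \<open>z\<^sup>n - 1\<close>, hence of the cyclotomic factor for some
  divisor \<open>d\<close>; then \<open>z\<^sup>d = 1\<close> and so \<open>d = n\<close>.
\<close>

lemma cyclotomic_root:
  assumes "n > 0" "z ^ n = 1" "\<And>k. 0 < k \<Longrightarrow> k < n \<Longrightarrow> z ^ k \<noteq> (1 :: complex)"
  shows "\<exists>k\<in>totatives n. z = unity_root n k"
proof -
  have "poly (monom 1 n - 1) z = 0" using assms(2) by (simp add: poly_monom)
  then have "\<exists>d. d dvd n \<and> (\<exists>k\<in>totatives d. z = unity_root d k)"
    unfolding prod_cyclotomic_complex[OF assms(1)] using assms(1) by (auto simp: poly_prod)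
  then obtain d k where d: "d dvd n" "k \<in> totatives d" "z = unity_root d k" by blast
  then have d0: "d > 0" using dvd_pos_nat[OF assms(1)] by blast
  have "z ^ d = cis (real d * (2 * pi * real k / real d))" unfolding d(3) unity_root_def by (rule Complex.DeMoivre)
  also have "real d * (2 * pi * real k / real d) = 2 * pi * real k" using d0 by simp
  also have "cis (2 * pi * real k) = 1" by simp
  finally have "d = n" using assms(3)[OF d0] dvd_imp_le[OF d(1) assms(1)] by (metis le_neq_implies_less)
  then show ?thesis using d by blast
qed

section \<open>Resultants of dynatomic polynomials\<close>

lemma ev_Qc_hom: "comm_ring_hom (\<lambda>q. Qc.ev q a)"
  by unfold_locales (simp_all add: hom_distribs)

lemma hom_poly_of_int:
  assumes "comm_ring_hom (h :: 'a :: comm_ring_1 \<Rightarrow> 'b :: comm_ring_1)"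
  shows "h (poly (map_poly of_int p) x) = poly (map_poly of_int p) (h x)"
proof -
  interpret comm_ring_hom h by fact
  show ?thesis by (induction p) (simp_all add: hom_distribs)
qed

lemma hom_poly:
  assumes "comm_ring_hom (h :: 'a :: comm_ring_1 \<Rightarrow> 'b :: comm_ring_1)"
  shows "poly (map_poly h p) (h x) = h (poly p x)"
proof -
  interpret comm_ring_hom h by fact
  interpret p: map_poly_comm_ring_hom h ..
  show ?thesis by (induction p) (simp_all add: hom_distribs)
qed

lemma period_norm_cong:
  assumes "n > 0" "\<And>a. a \<in> Per n \<Longrightarrow> Qc.ev p a = Qc.ev q a"
  shows "period_norm n p = period_norm n q"
proof -
  have "embed_Qc (period_norm n p) = embed_Qc (period_norm n q)"
    unfolding embed_period_norm[OF assms(1)] by (rule prod.cong[OF refl]) (rule assms(2))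
  then show ?thesis by (simp only: Qc.eq_iff)
qed

lemma period_norm_dvd: "n > 0 \<Longrightarrow> p dvd q \<Longrightarrow> period_norm n p dvd period_norm n q"
  by (auto simp: period_norm_mult elim!: dvdE)

lemma ev_dynatomic_eq_0_iff: "n > 0 \<Longrightarrow> Qc.ev (dynatomic n) a = 0 \<longleftrightarrow> a \<in> Per n"
  unfolding map_dynatomic poly_lin_prod by (simp add: image_iff)

lemma period_poly_split:
  assumes "n > 0" "D \<subseteq> {k. k dvd n}" "finite D"
  shows "period_poly n = (\<Prod>k\<in>D. dynatomic k) * (\<Prod>k\<in>{k. k dvd n} - D. dynatomic k)"
  unfolding period_poly_eq_prod_dynatomic[OF assms(1)]
  by (subst prod.subset_diff[OF assms(2)]) (use assms(1) in \<open>simp_all add: mult.commute\<close>)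

lemma period_poly_split_dvd:
  assumes "n > 0" "g dvd n"
  shows "period_poly n = period_poly g * (\<Prod>k | k dvd n \<and> \<not> k dvd g. dynatomic k)"
proof -
  have g: "g > 0" using dvd_pos_nat[OF assms] .
  have sub: "{k. k dvd g} \<subseteq> {k. k dvd n}" using assms(2) by (auto intro: dvd_trans)
  have "{k. k dvd n} - {k. k dvd g} = {k. k dvd n \<and> \<not> k dvd g}" by blast
  then show ?thesis
    using period_poly_split[OF assms(1) sub] g
    by (simp only: period_poly_eq_prod_dynatomic[OF g, symmetric] finite_divisors_nat)
qed

text \<open>
  For \<open>a\<close> of exact period \<open>d\<close>, the value \<open>f\<^sup>n(a) - a\<close> depends only on \<open>n\<close> modulo \<open>d\<close>. Hence \<open>P\<^sub>n\<close> and \<open>P\<^sub>g\<close>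
  with \<open>g = gcd(n, d)\<close> have norms dividing each other, and the cofactor of \<open>P\<^sub>g\<close> in \<open>P\<^sub>n\<close>, of which
  \<open>\<Phi>\<^sub>n\<^sup>*\<close> is a factor, has a unit as its norm.
\<close>

lemma period_norm_dynatomic_unit:
  assumes "d > 0" "n > 0" "\<not> d dvd n" "\<not> n dvd d"
  shows "period_norm d (dynatomic n) dvd 1"
proof -
  define g where "g = gcd n d"
  have g: "g dvd n" "g dvd d" "g > 0" using assms by (simp_all add: g_def)
  \<comment> \<open>A multiple of \<open>n\<close> that acts on points of period \<open>d\<close> like \<open>g\<close>.\<close>
  obtain t where t: "[n * t = g] (mod d)" unfolding g_def using cong_solve_nat by blast
  have ndg: "\<not> d dvd g" using assms(3) g(1) dvd_trans by blast
  have t0: "t > 0"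
  proof (rule gr0I)
    assume "t = 0"
    then have "[0 = g] (mod d)" using t by simp
    then have "d dvd g" using cong_0_iff cong_sym by blast
    with ndg show False by contradiction
  qed
  let ?N = "period_norm d"
  have "?N (period_poly (n * t)) = ?N (period_poly g)"
  proof (rule period_norm_cong[OF assms(1)])
    fix a assume "a \<in> Per d"
    then have per: "(quad Qc.param ^^ d) a = a" by (rule PerD(2))
    have "(quad Qc.param ^^ (n * t)) a = (quad Qc.param ^^ g) a"
      using funpow_mod_eq[OF per, of "n * t"] funpow_mod_eq[OF per, of g] t by (simp only: cong_def)
    then show "Qc.ev (period_poly (n * t)) a = Qc.ev (period_poly g) a"
      unfolding Qc.at_period_poly by (simp only:)
  qed
  moreover have "period_poly (n * t) = period_poly n * (\<Prod>k | k dvd n * t \<and> \<not> k dvd n. dynatomic k)"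
    by (rule period_poly_split_dvd) (use assms(2) t0 in simp_all)
  moreover have pn: "period_poly n = period_poly g * (\<Prod>k | k dvd n \<and> \<not> k dvd g. dynatomic k)"
    by (rule period_poly_split_dvd[OF assms(2) g(1)])
  ultimately have eq: "?N (period_poly g) * (?N (\<Prod>k | k dvd n \<and> \<not> k dvd g. dynatomic k) *
      ?N (\<Prod>k | k dvd n * t \<and> \<not> k dvd n. dynatomic k)) = ?N (period_poly g) * 1"
    by (simp only: period_norm_mult[OF assms(1)] mult.assoc mult_1_right)
  have nz: "?N (period_poly g) \<noteq> 0"
  proof
    assume "?N (period_poly g) = 0"
    then obtain a where a: "a \<in> Per d" "Qc.ev (period_poly g) a = 0"
      unfolding period_norm_eq_0_iff[OF assms(1)] by blast
    then have "(quad Qc.param ^^ g) a = a" unfolding Qc.at_period_poly by simp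
    then show False using ndg funpow_period_iff[of "quad Qc.param" d a g] a(1) unfolding Per_def by blast
  qed
  have "?N (\<Prod>k | k dvd n \<and> \<not> k dvd g. dynatomic k) dvd 1"
    using eq[unfolded mult_left_cancel[OF nz]] by (rule dvdI[OF sym])
  moreover have "\<not> n dvd g" using assms(4) g(2) dvd_trans by blast
  then have "dynatomic n dvd (\<Prod>k | k dvd n \<and> \<not> k dvd g. dynatomic k)"
    using assms(2) by (intro dvd_prodI) simp_all
  then have "?N (dynatomic n) dvd ?N (\<Prod>k | k dvd n \<and> \<not> k dvd g. dynatomic k)"
    by (rule period_norm_dvd[OF assms(1)])
  ultimately show ?thesis by (rule dvd_trans[rotated])
qed

text \<open>
  The \<open>e\<close>-th cyclotomic polynomial evaluated at the multiplier \<open>(f\<^sup>d)'(z)\<close>. Its norm over the points of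
  exact period \<open>d\<close> is, for \<open>e > 1\<close>, the \<open>d\<close>-th power of \<open>\<Delta>\<^sub>d\<^sub>e\<^sub>,\<^sub>d\<close> up to sign.
\<close>

definition cyc_mult :: "nat \<Rightarrow> nat \<Rightarrow> int poly poly" where
  "cyc_mult d e = poly (map_poly of_int (cyclotomic e)) (pderiv (quad_iter d))"

lemma ev_cyc_mult: "Qc.ev (cyc_mult d e) a = poly (map_poly of_int (cyclotomic e)) (multiplier Qc.param d a)"
  using hom_poly_of_int[OF ev_Qc_hom[of a], of "cyclotomic e" "pderiv (quad_iter d)"]
  unfolding cyc_mult_def Qc.at_pderiv_quad_iter .

lemma ev_pderiv_period_poly: "Qc.ev (pderiv (period_poly n)) a = multiplier Qc.param n a - 1"
proof -
  have "pderiv (period_poly n) = pderiv (quad_iter n) - 1"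
    by (simp add: period_poly_def pderiv_diff pderiv_pCons)
  then show ?thesis
    by (simp only: Qc.p.hom_minus Qc.p.hom_one poly_diff poly_1 Qc.at_pderiv_quad_iter)
qed

lemma prod_cyclotomic_value:
  fixes x :: "'a :: comm_ring_1"
  assumes "r > 0"
  shows "(\<Prod>e | e dvd r. poly (map_poly of_int (cyclotomic e)) x) = x ^ r - 1"
proof -
  have "(\<Prod>e | e dvd r. poly (map_poly of_int (cyclotomic e)) x) = poly (map_poly of_int (\<Prod>e | e dvd r. cyclotomic e)) x"
    by (simp only: of_int_poly_hom.hom_prod poly_prod)
  also have "\<dots> = x ^ r - 1"
    unfolding prod_cyclotomic[OF assms, symmetric] by (simp add: hom_distribs poly_monom)
  finally show ?thesis .
qed

lemma cyclotomic_value_nonzero: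
  fixes x :: "'a :: idom"
  assumes "x ^ r \<noteq> 1" "r > 0"
  shows "poly (map_poly of_int (cyclotomic r)) x \<noteq> 0"
proof
  assume "poly (map_poly of_int (cyclotomic r)) x = 0"
  then have "\<exists>e\<in>{e. e dvd r}. poly (map_poly of_int (cyclotomic e)) x = 0"
    by (intro bexI[of _ r] CollectI dvd_refl)
  then have "(\<Prod>e | e dvd r. poly (map_poly of_int (cyclotomic e)) x) = 0"
    by (rule prod_zero[rotated]) (use assms(2) in simp)
  then show False using assms prod_cyclotomic_value[OF assms(2), of x] by simp
qed

lemma of_int_Qc: "(of_int k :: Qc_closure) = embed_Qc [:k:]"
proof -
  have "of_int k = ([:k:] :: int poly)" by (simp add: of_int_poly)
  then show ?thesis by (metis Qc.hom_of_int)
qed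

lemma generic_multiplier_pow_neq_1:
  assumes "a \<in> Per d" "r > 0"
  shows "multiplier Qc.param d a ^ r \<noteq> 1"
proof -
  have fixa: "(quad Qc.param ^^ d) a = a" and d: "d > 0" using PerD[OF assms(1)] by blast+
  have "(quad Qc.param ^^ (d * r)) a = a"
    using funpow_mod_eq[OF fixa, of "d * r"] by simp
  from generic_multiplier_neq_1[OF _ this] show ?thesis
    unfolding multiplier_mult[OF fixa] using d assms(2) by simp
qed


lemma period_norm_cyc_mult_nonzero:
  assumes "d > 0" "r > 0"
  shows "period_norm d (cyc_mult d r) \<noteq> 0"
  unfolding period_norm_eq_0_iff[OF assms(1)] ev_cyc_mult
  using cyclotomic_value_nonzero[OF generic_multiplier_pow_neq_1 assms(2)] assms(2) by blast

lemma normalize_prod: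
  fixes f :: "'b \<Rightarrow> 'a :: normalization_semidom_multiplicative"
  shows "normalize (\<Prod>k\<in>A. f k) = (\<Prod>k\<in>A. normalize (f k))"
  by (induction A rule: infinite_finite_induct) (simp_all add: normalize_mult)

lemma cyclotomic_1: "cyclotomic 1 = [:- 1, 1:]"
proof -
  have "cyclotomic 1 = monom 1 1 - 1" using prod_cyclotomic[of 1] by simp
  also have "\<dots> = [:- 1, 1:]" 
    by (rule poly_eqI) (auto simp: coeff_pCons split: nat.splits)
  finally show ?thesis .
qed

text \<open>
  The resultant of \<open>\<Phi>\<^sub>d\<^sup>*\<close> and \<open>\<Phi>\<^sub>d\<^sub>r\<^sup>*\<close> is, up to units, the norm of the \<open>r\<close>-th cyclotomic polynomial in the
  multiplier \<open>\<lambda>\<close> of a point \<open>a\<close> of period \<open>d\<close>. Write \<open>P\<^sub>d\<^sub>r = P\<^sub>d * W\<close>; differentiating at \<open>a\<close> gives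
  \<open>\<lambda>\<^sup>r - 1 = (\<lambda> - 1) * W(a)\<close>, so \<open>W(a)\<close> is the product of the cyclotomic values for the divisors
  \<open>e \<noteq> 1\<close> of \<open>r\<close>. It is also the product of the \<open>\<Phi>\<^sub>k\<^sup>*(a)\<close>, of which only those with \<open>k = d * e\<close> are not
  units, and induction compares the two products factor by factor. Units are absorbed by
  normalisation.
\<close>

lemma period_norm_dynatomic_multiple:
  assumes d: "d > 0" and "r > 1"
  shows "normalize (period_norm d (dynatomic (d * r))) = normalize (period_norm d (cyc_mult d r))"
  using assms(2)
proof (induction r rule: less_induct)
  case (less r)
  let ?N = "period_norm d" let ?E = "{e. e dvd r \<and> e \<noteq> 1}"
  have r: "r > 0" and dr: "d * r > 0" using less.prems d by auto
  define W where "W = (\<Prod>k | k dvd d * r \<and> \<not> k dvd d. dynatomic k)"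
  have P: "period_poly (d * r) = period_poly d * W"
    unfolding W_def by (rule period_poly_split_dvd[OF dr]) simp
  have finE: "finite ?E" using r by simp
  have val: "Qc.ev W a = Qc.ev (\<Prod>e\<in>?E. cyc_mult d e) a" if a: "a \<in> Per d" for a
  proof -
    let ?m = "multiplier Qc.param d a"
    have fixa: "(quad Qc.param ^^ d) a = a" by (rule PerD(2)[OF a])
    have "Qc.ev (period_poly d) a = 0" using fixa by (simp only: Qc.at_period_poly right_minus_eq)
    then have "Qc.ev (pderiv (period_poly (d * r))) a = Qc.ev (pderiv (period_poly d)) a * Qc.ev W a"
      unfolding P pderiv_mult Qc.p.hom_add Qc.p.hom_mult poly_add poly_mult by simp
    then have 1: "?m ^ r - 1 = (?m - 1) * Qc.ev W a"
      unfolding ev_pderiv_period_poly multiplier_mult[OF fixa] .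
    have "{e. e dvd r} = insert 1 ?E" by auto
    then have "?m ^ r - 1 = poly (map_poly of_int (cyclotomic 1)) ?m * (\<Prod>e\<in>?E. poly (map_poly of_int (cyclotomic e)) ?m)"
      unfolding prod_cyclotomic_value[OF r, symmetric] using finE by simp
    also have "\<dots> = (?m - 1) * (\<Prod>e\<in>?E. Qc.ev (cyc_mult d e) a)"
      unfolding ev_cyc_mult cyclotomic_1 by (simp add: map_poly_pCons)
    finally have "(?m - 1) * Qc.ev W a = (?m - 1) * (\<Prod>e\<in>?E. Qc.ev (cyc_mult d e) a)"
      unfolding 1 .
    moreover have "?m - 1 \<noteq> 0" using generic_multiplier_pow_neq_1[OF a, of 1] by simp
    ultimately have "Qc.ev W a = (\<Prod>e\<in>?E. Qc.ev (cyc_mult d e) a)" using mult_left_cancel by blast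
    then show ?thesis by (simp only: Qc.p.hom_prod poly_prod)
  qed
  have NW: "?N W = (\<Prod>e\<in>?E. ?N (cyc_mult d e))"
    unfolding period_norm_prod[OF d, symmetric] by (rule period_norm_cong[OF d val])
  let ?S = "{k. k dvd d * r \<and> \<not> k dvd d}"
  have finS: "finite ?S" using dr by simp
  \<comment> \<open>Only the multiples of \<open>d\<close> contribute factors that are not units.\<close>
  have img: "{k \<in> ?S. d dvd k} = (\<lambda>e. d * e) ` ?E"
  proof (intro equalityI subsetI)
    fix k assume k: "k \<in> {k \<in> ?S. d dvd k}"
    then obtain e where e: "k = d * e" by (auto elim: dvdE)
    with k d have "e \<in> ?E" by auto
    then show "k \<in> (\<lambda>e. d * e) ` ?E" using e by blast
  qed (use d in auto)
  have "normalize (?N W) = (\<Prod>k\<in>?S. normalize (?N (dynatomic k)))"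
    unfolding W_def period_norm_prod[OF d] normalize_prod ..
  also have "\<dots> = (\<Prod>k\<in>{k \<in> ?S. d dvd k}. normalize (?N (dynatomic k)))"
  proof (rule prod.mono_neutral_right[OF finS])
    show "\<forall>k\<in>?S - {k \<in> ?S. d dvd k}. normalize (?N (dynatomic k)) = 1"
    proof
      fix k assume k: "k \<in> ?S - {k \<in> ?S. d dvd k}"
      then have "k dvd d * r" by blast
      then have "k > 0" by (rule dvd_pos_nat[OF dr])
      moreover have "\<not> d dvd k" "\<not> k dvd d" using k by blast+
      ultimately show "normalize (?N (dynatomic k)) = 1"
        using period_norm_dynatomic_unit[OF d, of k] is_unit_normalize by blast
    qed
  qed blast
  also have "\<dots> = (\<Prod>e\<in>?E. normalize (?N (dynatomic (d * e))))"
    unfolding img using d by (subst prod.reindex) (simp_all add: inj_on_def)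
  finally have eq: "(\<Prod>e\<in>?E. normalize (?N (dynatomic (d * e)))) = (\<Prod>e\<in>?E. normalize (?N (cyc_mult d e)))"
    unfolding NW normalize_prod by (rule sym)
  let ?E' = "?E - {r}"
  have rE: "r \<in> ?E" using less.prems by simp
  have rest: "(\<Prod>e\<in>?E'. normalize (?N (dynatomic (d * e)))) = (\<Prod>e\<in>?E'. normalize (?N (cyc_mult d e)))"
  proof (rule prod.cong[OF refl])
    fix e assume e: "e \<in> ?E'"
    then have "e > 0" using dvd_pos_nat[OF r] by blast
    moreover have "e \<le> r" using e dvd_imp_le[OF _ r] by blast
    ultimately show "normalize (?N (dynatomic (d * e))) = normalize (?N (cyc_mult d e))"
      using e by (intro less.IH) auto
  qed
  have nz: "(\<Prod>e\<in>?E'. normalize (?N (cyc_mult d e))) \<noteq> 0"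
  proof (rule ccontr)
    assume "\<not> ?thesis"
    then obtain e where "e dvd r" "normalize (?N (cyc_mult d e)) = 0"
      using finE by (auto simp: prod_zero_iff)
    then show False using period_norm_cyc_mult_nonzero[OF d dvd_pos_nat[OF r]] by simp
  qed
  from eq have "normalize (?N (dynatomic (d * r))) * (\<Prod>e\<in>?E'. normalize (?N (cyc_mult d e))) =
      normalize (?N (cyc_mult d r)) * (\<Prod>e\<in>?E'. normalize (?N (cyc_mult d e)))"
    unfolding prod.remove[OF finE rE] rest .
  then show ?case unfolding mult_right_cancel[OF nz] .
qed

lemma map_const_poly_of_int:
  "map_poly embed_Qc (map_poly (\<lambda>a. [:a:]) p) = map_poly of_int p"
  by (rule poly_eqI) (simp add: coeff_map_poly of_int_Qc)

lemma Delta_res_power: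
  assumes m: "m > 0" and r: "r > 0"
  shows "\<exists>j. Delta_res (m * r) m ^ m = (-1) ^ j * period_norm m (cyc_mult m r)"
proof -
  let ?q = "map_poly (\<lambda>a. [:a:]) (cyclotomic r)"
  let ?g = "\<lambda>a. poly (map_poly of_int (cyclotomic r)) (multiplier Qc.param m a)"
  obtain B where B: "B \<subseteq> Per m" "map_poly embed_Qc (delta m) = (\<Prod>a\<in>B. [:- multiplier Qc.param m a, 1:])"
    "\<And>g. (\<forall>a\<in>Per m. g (quad Qc.param a) = g a) \<Longrightarrow> (\<Prod>a\<in>Per m. g a) = (\<Prod>a\<in>B. g a :: Qc_closure) ^ m"
    using delta_generic[OF m] by blast
  have lq: "lead_coeff ?q = 1"
    by (rule lead_coeff_map_poly_monic[OF comm_ring_hom_const_poly lead_coeff_cyclotomic[OF r]])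
  have sp: "map_poly embed_Qc (delta m) = lin_prod (image_mset (multiplier Qc.param m) (mset_set B))"
    unfolding B(2) lin_prod_def image_mset.compositionality o_def prod_unfold_prod_mset ..
  have dm: "Delta_res (m * r) m = resultant ?q (delta m)"
    unfolding Delta_res_def using m by simp
  define j where "j = degree ?q * degree (delta m)"
  have "Delta_res (m * r) m = (-1) ^ j * resultant (delta m) ?q"
    unfolding dm j_def by (rule resultant_swap)
  then have "Delta_res (m * r) m ^ m = (-1) ^ (j * m) * resultant (delta m) ?q ^ m"
    by (simp add: power_mult_distrib power_mult)
  moreover have "resultant (delta m) ?q ^ m = period_norm m (cyc_mult m r)"
  proof -
    have "embed_Qc (resultant (delta m) ?q) = (\<Prod>a\<in>B. ?g a)"
      unfolding hom_resultant_monic[OF Qc.comm_ring_hom_axioms lead_coeff_delta[OF m] lq sp]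
        map_const_poly_of_int image_mset.compositionality o_def prod_unfold_prod_mset ..
    moreover have "(\<Prod>a\<in>Per m. ?g a) = (\<Prod>a\<in>B. ?g a) ^ m"
    proof (rule B(3), intro ballI)
      fix a assume "a \<in> Per m"
      from multiplier_shift[OF PerD(2)[OF this]] show "?g (quad Qc.param a) = ?g a" by (simp only:)
    qed
    ultimately have "embed_Qc (resultant (delta m) ?q ^ m) = embed_Qc (period_norm m (cyc_mult m r))"
      unfolding Qc.hom_power embed_period_norm[OF m] ev_cyc_mult by (simp only:)
    then show ?thesis by (simp only: Qc.eq_iff)
  qed
  ultimately show ?thesis by (metis)
qed

lemma dvd_sign_iff: "((-1) ^ j * a) dvd b \<longleftrightarrow> a dvd (b :: 'a :: comm_ring_1)"
  by (cases "even j") simp_all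

lemma Delta_res_power_dvd:
  assumes m: "m > 0" and r: "r > 1"
  shows "Delta_res (m * r) m ^ m dvd period_norm m (dynatomic (m * r))"
proof -
  obtain j where "Delta_res (m * r) m ^ m = (-1) ^ j * period_norm m (cyc_mult m r)"
    using Delta_res_power[OF m, of r] r by auto
  moreover have "period_norm m (cyc_mult m r) dvd period_norm m (dynatomic (m * r))"
    using period_norm_dynatomic_multiple[OF m r] by (metis dvd_normalize_iff dvd_refl)
  ultimately show ?thesis by (simp only: dvd_sign_iff)
qed

lemma Delta_res_nonzero:
  assumes m: "m > 0" and r: "r > 0"
  shows "Delta_res (m * r) m \<noteq> 0"
proof
  assume "Delta_res (m * r) m = 0"
  moreover obtain j where "Delta_res (m * r) m ^ m = (-1) ^ j * period_norm m (cyc_mult m r)"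
    using Delta_res_power[OF m r] by blast
  ultimately have "period_norm m (cyc_mult m r) = 0" using m by (simp add: zero_power)
  then show False using period_norm_cyc_mult_nonzero[OF m r] by contradiction
qed

text \<open>
  Both sides are products of the differences of the roots of two polynomials.
\<close>

lemma period_norm_dynatomic_swap:
  assumes "n > 0" "k > 0"
  shows "\<exists>j. period_norm k (dynatomic n) = (-1) ^ j * period_norm n (dynatomic k)"
proof -
  have "embed_Qc (period_norm k (dynatomic n)) =
      (-1) ^ (card (Per k) * card (Per n)) * embed_Qc (period_norm n (dynatomic k))"
    unfolding embed_period_norm[OF assms(1)] embed_period_norm[OF assms(2)] map_dynatomic[OF assms(1)] map_dynatomic[OF assms(2)]
      prod_unfold_prod_mset
    by (subst prod_poly_lin_prod_swap) simp
  also have "\<dots> = embed_Qc ((-1) ^ (card (Per k) * card (Per n)) * period_norm n (dynatomic k))"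
    by (simp add: hom_distribs)
  finally show ?thesis unfolding Qc.eq_iff by blast
qed

section \<open>Factorisation of the multiplier polynomial at 1\<close>

text \<open>
  All points \<open>f\<^sup>j(\<alpha>)\<close> with \<open>j < n\<close> are distinct roots of \<open>\<Phi>\<^sub>n\<^sup>*\<close>, so \<open>(\<Phi>\<^sub>n\<^sup>*)'(\<alpha>)\<close> is the product of the
  \<open>\<alpha> - f\<^sup>j(\<alpha>)\<close> with \<open>0 < j\<close> and a cofactor. The cofactor is the value at \<open>\<alpha>\<close> of a polynomial \<open>H\<close> that does
  not depend on \<open>\<alpha>\<close>: divide \<open>\<Phi>\<^sub>n\<^sup>*(z)\<close> by \<open>\<Prod>\<^sub>j\<^sub><\<^sub>n (z - f\<^sup>j(w))\<close> over the ring \<open>\<int>[c][w]\<close>; the remainder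
  vanishes at every \<open>w = \<alpha>\<close>, and \<open>H\<close> is the quotient on the diagonal \<open>z = w\<close>.
\<close>

lemma period_norm_pderiv_dynatomic:
  assumes n: "n > 0"
  shows "period_norm n (\<Prod>j\<in>{0<..<n}. period_poly j) dvd period_norm n (pderiv (dynatomic n))"
proof -
  define F where "F = map_poly (\<lambda>a. [:a:]) (dynatomic n)"
  define T where "T = (\<Prod>j<n. [:- quad_iter j, 1:])"
  have lT: "lead_coeff T = 1" unfolding T_def by (rule lead_coeff_prod_monic) simp
  then have T0: "T \<noteq> 0" by auto
  obtain Q S where QS: "pseudo_divmod F T = (Q, S)" by fastforce
  have F: "F = T * Q + S" and S: "S = 0 \<or> degree S < degree T"
    using pseudo_divmod[OF T0 QS] by (simp_all add: lT)
  \<comment> \<open>The quotient on the diagonal; \<open>[:0, 1:]\<close> is the coefficient variable \<open>w\<close>.\<close>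
  define H where "H = poly Q [:0, 1:]"
  have main: "Qc.ev (pderiv (dynatomic n)) a = Qc.ev ((-1) ^ (n - 1) * ((\<Prod>j\<in>{0<..<n}. period_poly j) * H)) a"
    if a: "a \<in> Per n" for a
  proof -
    let ?s = "\<lambda>q. Qc.ev q a" let ?f = "\<lambda>j. (quad Qc.param ^^ j) a"
    have per: "has_exact_period (quad Qc.param) n a" using a by (simp add: Per_def)
    interpret s: comm_ring_hom ?s by (rule ev_Qc_hom)
    interpret sp: map_poly_comm_ring_hom ?s ..
    have sF: "map_poly ?s F = map_poly embed_Qc (dynatomic n)"
    proof -
      have "map_poly embed_Qc [:c:] = [:embed_Qc c:]" for c
        by (rule poly_eqI) (simp add: coeff_map_poly coeff_pCons split: nat.split)
      then have "Qc.ev [:c:] a = embed_Qc c" for c by simp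
      then show ?thesis unfolding F_def by (intro poly_eqI) (simp only: coeff_map_poly s.hom_zero Qc.hom_zero pCons_0_0)
    qed
    have sT: "map_poly ?s T = (\<Prod>j<n. [:- ?f j, 1:])"
      unfolding T_def sp.hom_prod
      by (rule prod.cong[OF refl]) (simp add: map_poly_pCons hom_distribs Qc.at_quad_iter)
    have "(\<Prod>j<n. [:- ?f j, 1:]) = (\<Prod>b\<in>?f ` {..<n}. [:- b, 1:])"
      by (subst prod.reindex[OF inj_on_orbit[OF per]]) (simp add: o_def)
    also have "\<dots> dvd (\<Prod>b\<in>Per n. [:- b, 1:])"
      by (rule prod_dvd_prod_subset[OF finite_Per])
        (use has_exact_period_funpow[OF per] in \<open>auto simp: Per_def\<close>)
    also have "\<dots> = map_poly ?s T * map_poly ?s Q + map_poly ?s S"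
      using sF unfolding F map_dynatomic[OF n] lin_prod_mset_set[OF finite_Per] sp.hom_add sp.hom_mult by (rule sym)
    finally have "map_poly ?s T dvd map_poly ?s S" unfolding sT by (simp add: dvd_add_right_iff)
    moreover have "degree (map_poly ?s T) = degree T"
      by (rule degree_map_poly_monic[OF ev_Qc_hom lT])
    moreover have "degree (map_poly ?s S) \<le> degree S" by (rule degree_map_poly_le)
    \<comment> \<open>The specialised remainder has smaller degree than the divisor.\<close>
    ultimately have S0: "map_poly ?s S = 0" using S
      by (cases "S = 0") (auto dest: dvd_imp_degree_le)
    have eq: "map_poly embed_Qc (dynatomic n) = [:- a, 1:] * ((\<Prod>j\<in>{0<..<n}. [:- ?f j, 1:]) * map_poly ?s Q)"
    proof -
      have "{..<n} = insert 0 {0<..<n}" using n by auto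
      then have "(\<Prod>j<n. [:- ?f j, 1:]) = [:- a, 1:] * (\<Prod>j\<in>{0<..<n}. [:- ?f j, 1:])" by simp
      then show ?thesis unfolding sF[symmetric] F sp.hom_add sp.hom_mult S0 sT by (simp only: mult.assoc add_0_right)
    qed
    have z: "poly [:- a, 1:] a = 0" "pderiv [:- a, 1:] = 1" by (simp_all add: pderiv_pCons)
    have "Qc.ev (pderiv (dynatomic n)) a = (\<Prod>j\<in>{0<..<n}. a - ?f j) * poly (map_poly ?s Q) a"
      unfolding Qc.map_poly_pderiv eq pderiv_mult[of "[:- a, 1:]"] poly_add poly_mult z poly_prod by simp
    also have "(\<Prod>j\<in>{0<..<n}. a - ?f j) = (\<Prod>j\<in>{0<..<n}. - 1 * Qc.ev (period_poly j) a)"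
      by (rule prod.cong[OF refl]) (simp add: Qc.at_period_poly)
    also have "\<dots> = (-1) ^ (n - 1) * (\<Prod>j\<in>{0<..<n}. Qc.ev (period_poly j) a)"
      unfolding prod.distrib by simp
    also have "poly (map_poly ?s Q) a = ?s H"
    proof -
      have "?s [:0, 1:] = a" by (simp add: hom_distribs)
      then show ?thesis unfolding H_def using hom_poly[OF ev_Qc_hom[of a], of Q "[:0, 1:]"] by simp
    qed
    finally show ?thesis by (simp only: s.hom_mult s.hom_power s.hom_prod s.hom_uminus s.hom_one mult.assoc)
  qed
  have "period_norm n (pderiv (dynatomic n)) =
      period_norm n ((-1) ^ (n - 1) * ((\<Prod>j\<in>{0<..<n}. period_poly j) * H))"
    by (rule period_norm_cong[OF n main])
  then show ?thesis by (simp add: period_norm_mult[OF n])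
qed

lemma card_proper_multiples:
  assumes "k dvd n" "n > (0::nat)"
  shows "card {j \<in> {0<..<n}. k dvd j} = n div k - 1"
proof -
  obtain t where t: "n = k * t" using assms(1) by (rule dvdE)
  then have k: "k > 0" using assms(2) by (auto intro: gr0I)
  have "{j \<in> {0<..<n}. k dvd j} = (\<lambda>i. k * i) ` {0<..<t}"
    using k unfolding t by (auto elim!: dvdE)
  then have "card {j \<in> {0<..<n}. k dvd j} = card {0<..<t}"
    using k by (simp add: card_image inj_on_def)
  then show ?thesis using k by (simp add: t)
qed

text \<open>
  A proper divisor \<open>k\<close> of \<open>n\<close> divides \<open>n div k - 1\<close> of the numbers strictly between \<open>0\<close> and \<open>n\<close>.
\<close>

lemma prod_proper_divisors_dvd:
  fixes f :: "nat \<Rightarrow> 'a :: comm_semiring_1"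
  assumes n: "n > 0"
  shows "(\<Prod>k | k dvd n \<and> k \<noteq> n. f k ^ (n div k - 1)) dvd (\<Prod>j\<in>{0<..<n}. \<Prod>k | k dvd j. f k)"
proof -
  let ?D = "{k. k dvd n \<and> k \<noteq> n}"
  have fin: "finite ?D" using n by simp
  have "(\<Prod>k\<in>?D. f k ^ (n div k - 1)) = (\<Prod>k\<in>?D. \<Prod>j | j \<in> {0<..<n} \<and> k dvd j. f k)"
  proof (rule prod.cong[OF refl])
    fix k assume "k \<in> ?D"
    then have "k dvd n" by blast
    from card_proper_multiples[OF this n] show "f k ^ (n div k - 1) = (\<Prod>j | j \<in> {0<..<n} \<and> k dvd j. f k)"
      by simp
  qed
  also have "\<dots> = (\<Prod>j\<in>{0<..<n}. \<Prod>k | k \<in> ?D \<and> k dvd j. f k)"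
    by (rule prod.swap_restrict[OF fin]) simp
  also have "\<dots> dvd (\<Prod>j\<in>{0<..<n}. \<Prod>k | k dvd j. f k)"
    by (intro prod_dvd_prod prod_dvd_prod_subset) auto
  finally show ?thesis .
qed

text \<open>
  Of the exponent \<open>n div k\<close>, one comes from the factor \<open>\<Phi>\<^sub>k\<^sup>*\<close> of \<open>P\<^sub>n\<close>, and the other ones from the
  derivative of \<open>\<Phi>\<^sub>n\<^sup>*\<close>.
\<close>

lemma period_norm_pderiv_period_poly_dvd:
  assumes n: "n > 0"
  shows "(\<Prod>k | k dvd n \<and> k \<noteq> n. period_norm n (dynatomic k) ^ (n div k)) dvd
    period_norm n (pderiv (period_poly n))"
proof -
  let ?D = "{k. k dvd n \<and> k \<noteq> n}" let ?N = "\<lambda>k. period_norm n (dynatomic k)"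
  have fin: "finite ?D" using n by simp
  have pos: "n div k = Suc (n div k - 1)" if "k \<in> ?D" for k
  proof -
    have "k dvd n" using that by blast
    then have "k * (n div k) = n" by simp
    then show ?thesis using n by (cases "n div k") auto
  qed
  have ins: "{k. k dvd n} = insert n ?D" "n \<notin> ?D" by auto
  have P: "period_poly n = dynatomic n * (\<Prod>k\<in>?D. dynatomic k)"
    unfolding period_poly_eq_prod_dynatomic[OF n] ins(1) prod.insert[OF fin ins(2)] ..
  have "period_norm n (pderiv (period_poly n)) = period_norm n (pderiv (dynatomic n) * (\<Prod>k\<in>?D. dynatomic k))"
  proof (rule period_norm_cong[OF n])
    fix a assume "a \<in> Per n"
    then have "Qc.ev (dynatomic n) a = 0" using ev_dynatomic_eq_0_iff[OF n] by blast
    then show "Qc.ev (pderiv (period_poly n)) a = Qc.ev (pderiv (dynatomic n) * (\<Prod>k\<in>?D. dynatomic k)) a"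
      unfolding P pderiv_mult Qc.p.hom_add Qc.p.hom_mult poly_add poly_mult by simp
  qed
  also have "\<dots> = period_norm n (pderiv (dynatomic n)) * (\<Prod>k\<in>?D. ?N k)"
    by (simp only: period_norm_mult[OF n] period_norm_prod[OF n])
  finally have eq: "period_norm n (pderiv (period_poly n)) = period_norm n (pderiv (dynatomic n)) * (\<Prod>k\<in>?D. ?N k)" .
  have "(\<Prod>k\<in>?D. ?N k ^ (n div k - 1)) dvd (\<Prod>j\<in>{0<..<n}. \<Prod>k | k dvd j. ?N k)"
    by (rule prod_proper_divisors_dvd[OF n])
  also have "\<dots> = period_norm n (\<Prod>j\<in>{0<..<n}. period_poly j)"
    unfolding period_norm_prod[OF n]
    by (rule prod.cong[OF refl]) (simp add: period_poly_eq_prod_dynatomic period_norm_prod[OF n])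
  also have "\<dots> dvd period_norm n (pderiv (dynatomic n))"
    by (rule period_norm_pderiv_dynatomic[OF n])
  finally have "(\<Prod>k\<in>?D. ?N k ^ (n div k - 1)) * (\<Prod>k\<in>?D. ?N k) dvd period_norm n (pderiv (period_poly n))"
    unfolding eq by (rule mult_dvd_mono) simp
  moreover have "(\<Prod>k\<in>?D. ?N k ^ (n div k)) = (\<Prod>k\<in>?D. ?N k ^ (n div k - 1)) * (\<Prod>k\<in>?D. ?N k)"
    unfolding prod.distrib[symmetric] by (rule prod.cong[OF refl]) (subst pos, simp_all add: mult.commute)
  ultimately show ?thesis by simp
qed

lemma delta_at_1_power:
  assumes n: "n > 0"
  shows "\<exists>j. poly (delta n) 1 ^ n = (-1) ^ j * period_norm n (pderiv (period_poly n))"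
proof -
  have "poly (map_poly embed_Qc (multiplier_poly n)) 1 = (\<Prod>a\<in>Per n. -1 * (multiplier Qc.param n a - 1))"
    unfolding map_multiplier_poly[OF n Qc.comm_ring_hom_axioms map_dynatomic[OF n]]
    by (simp add: poly_prod_mset image_mset.compositionality o_def prod_unfold_prod_mset)
  also have "\<dots> = (-1) ^ card (Per n) * embed_Qc (period_norm n (pderiv (period_poly n)))"
    unfolding prod.distrib embed_period_norm[OF n] ev_pderiv_period_poly by simp
  also have "\<dots> = embed_Qc ((-1) ^ card (Per n) * period_norm n (pderiv (period_poly n)))"
    by (simp add: hom_distribs)
  also have "poly (map_poly embed_Qc (multiplier_poly n)) 1 = embed_Qc (poly (multiplier_poly n) 1)"
    using Qc.poly_map_poly[of "multiplier_poly n" 1] by simp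
  finally show ?thesis unfolding Qc.eq_iff delta_power[OF n, symmetric] poly_power by blast
qed

text \<open>
  The divisibility is proved for \<open>n\<close>-th powers, where the norms live; since \<open>\<int>[c]\<close> is factorial, it
  descends to the bases.
\<close>

theorem Delta_res_prod_dvd:
  assumes n: "n > 0"
  shows "(\<Prod>k | k dvd n \<and> k \<noteq> n. Delta_res n k) dvd poly (delta n) 1"
proof -
  let ?D = "{k. k dvd n \<and> k \<noteq> n}"
  have "(\<Prod>k\<in>?D. Delta_res n k) ^ n = (\<Prod>k\<in>?D. (Delta_res n k ^ k) ^ (n div k))"
    unfolding prod_power_distrib
  proof (rule prod.cong[OF refl])
    fix k assume "k \<in> ?D"
    then have "k * (n div k) = n" by simp
    then show "Delta_res n k ^ n = (Delta_res n k ^ k) ^ (n div k)" by (simp flip: power_mult)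
  qed
  also have "\<dots> dvd (\<Prod>k\<in>?D. period_norm n (dynatomic k) ^ (n div k))"
  proof (intro prod_dvd_prod dvd_power_same)
    fix k assume k: "k \<in> ?D"
    then have k0: "k > 0" using dvd_pos_nat[OF n] by blast
    define r where "r = n div k"
    have nr: "n = k * r" using k by (simp add: r_def)
    have "r > 1" using k n nr by (cases r; cases "r = 1") auto
    from Delta_res_power_dvd[OF k0 this] have "Delta_res n k ^ k dvd period_norm k (dynatomic n)"
      unfolding nr .
    then show "Delta_res n k ^ k dvd period_norm n (dynatomic k)"
      using period_norm_dynatomic_swap[OF n k0] by (metis dvd_mult_unit_iff' is_unit_power_iff minus_dvd_iff one_dvd dvd_refl)
  qed
  also have "\<dots> dvd period_norm n (pderiv (period_poly n))"
    by (rule period_norm_pderiv_period_poly_dvd[OF n])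
  also have "\<dots> dvd poly (delta n) 1 ^ n"
    using delta_at_1_power[OF n] by auto
  finally show ?thesis using n by (simp add: pow_divides_pow_iff)
qed

lemma Delta_self:
  assumes n: "n > 0"
  shows "poly (delta n) 1 = Delta n n * (\<Prod>k | k dvd n \<and> k \<noteq> n. Delta n k)"
proof -
  let ?D = "{k. k dvd n \<and> k \<noteq> n}"
  have fin: "finite ?D" using n by simp
  have nz: "(\<Prod>k\<in>?D. Delta_res n k) \<noteq> 0"
  proof
    assume "(\<Prod>k\<in>?D. Delta_res n k) = 0"
    then obtain k where k: "k dvd n" "Delta_res n k = 0" using fin by (auto simp: prod_zero_iff)
    then obtain r where r: "n = k * r" by (auto elim: dvdE)
    then have "k > 0" "r > 0" using n by (auto intro: gr0I)
    from Delta_res_nonzero[OF this] show False using k r by simp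
  qed
  obtain e where e: "poly (delta n) 1 = (\<Prod>k\<in>?D. Delta_res n k) * e"
    using Delta_res_prod_dvd[OF n] by (rule dvdE)
  have "Delta n n = e" unfolding Delta_def if_P[OF refl]
  proof (rule the_equality)
    show "poly (delta n) 1 = e * (\<Prod>k\<in>?D. Delta_res n k)" using e by (simp only: mult.commute)
    fix d assume "poly (delta n) 1 = d * (\<Prod>k\<in>?D. Delta_res n k)"
    then have "d * (\<Prod>k\<in>?D. Delta_res n k) = e * (\<Prod>k\<in>?D. Delta_res n k)" using e by (simp only: mult.commute)
    then show "d = e" using nz by simp
  qed
  moreover have "(\<Prod>k\<in>?D. Delta n k) = (\<Prod>k\<in>?D. Delta_res n k)"
    by (rule prod.cong) (auto simp: Delta_def)
  ultimately show ?thesis using e by (simp only: mult.commute)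
qed

section \<open>Specialisation to complex parameters\<close>

text \<open>
  At special parameters, such as parabolic ones, these roots may coincide or have a period smaller
  than \<open>n\<close>; hence a multiset.
\<close>

definition dynatomic_roots :: "complex \<Rightarrow> nat \<Rightarrow> complex multiset" where
  "dynatomic_roots c n = proots (map_poly (eval_at c) (dynatomic n))"

lemma map_dynatomic_eval_at:
  assumes "n > 0"
  shows "map_poly (eval_at c) (dynatomic n) = lin_prod (dynatomic_roots c n)"
  unfolding dynatomic_roots_def
  by (rule monic_splits[OF lead_coeff_map_poly_monic[OF comm_ring_hom_eval_at lead_coeff_dynatomic[OF assms]]])

lemma size_dynatomic_roots:
  assumes "n > 0"
  shows "size (dynatomic_roots c n) = card (Per n)"
proof -
  have "size (dynatomic_roots c n) = degree (map_poly (eval_at c) (dynatomic n))"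
    unfolding map_dynatomic_eval_at[OF assms] by simp
  also have "\<dots> = degree (map_poly embed_Qc (dynatomic n))"
    using degree_map_poly_monic[OF comm_ring_hom_eval_at lead_coeff_dynatomic[OF assms]]
      degree_map_poly_monic[OF Qc.comm_ring_hom_axioms lead_coeff_dynatomic[OF assms]] by simp
  also have "\<dots> = card (Per n)" unfolding map_dynatomic[OF assms] by simp
  finally show ?thesis .
qed

lemma sum_card_Per:
  assumes "n > 0"
  shows "(\<Sum>k | k dvd n. card (Per k)) = 2 ^ n"
proof -
  have "2 ^ n = degree (map_poly embed_Qc (period_poly n))"
    using degree_map_poly_monic[OF Qc.comm_ring_hom_axioms lead_coeff_period_poly[OF assms]]
      degree_period_poly[OF assms] by simp
  also have "\<dots> = (\<Sum>k | k dvd n. degree (lin_prod (mset_set (Per k))))"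
    unfolding period_poly_generic_factors[OF assms] by (rule degree_prod_eq_sum_degree) simp
  finally show ?thesis by simp
qed

lemma dynatomic_roots_periodic:
  assumes "n > 0" "a \<in># dynatomic_roots c n"
  shows "(quad c ^^ n) a = a"
proof -
  interpret int_poly_hom "eval_at c" by (rule int_poly_hom_eval_at)
  have "ev (dynatomic n) a = 0"
    unfolding map_dynatomic_eval_at[OF assms(1)] poly_lin_prod using assms(2) by (auto simp: prod_mset_zero_iff)
  moreover have "dynatomic n dvd period_poly n"
    unfolding period_poly_eq_prod_dynatomic[OF assms(1)] using assms(1) by (intro dvd_prodI) simp_all
  then obtain q where "period_poly n = dynatomic n * q" by (rule dvdE)
  ultimately have "ev (period_poly n) a = 0" by (simp only: p.hom_mult poly_mult mult_zero_left)
  then show ?thesis unfolding at_period_poly by simp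
qed

text \<open>
  A point of exact period \<open>n\<close> is a root of \<open>\<Phi>\<^sub>k\<^sup>*\<close> for some divisor \<open>k\<close> of \<open>n\<close>; then \<open>f\<^sup>k\<close> fixes it, so
  \<open>k\<close> is a multiple of \<open>n\<close>.
\<close>

lemma exact_period_imp_dynatomic_roots:
  assumes "has_exact_period (quad c) n a"
  shows "a \<in># dynatomic_roots c n"
proof -
  interpret int_poly_hom "eval_at c" by (rule int_poly_hom_eval_at)
  have n: "n > 0" and fixa: "(quad c ^^ n) a = a" using assms by (auto simp: has_exact_period_def)
  have "ev (period_poly n) a = 0" unfolding at_period_poly using fixa by simp
  then have "(\<Prod>k | k dvd n. ev (dynatomic k) a) = 0"
    unfolding period_poly_eq_prod_dynatomic[OF n] p.hom_prod poly_prod .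
  then obtain k where k: "k dvd n" "ev (dynatomic k) a = 0" using n by auto
  then have k0: "k > 0" using dvd_pos_nat[OF n] by blast
  have ak: "a \<in># dynatomic_roots c k"
    using k(2) unfolding map_dynatomic_eval_at[OF k0] poly_lin_prod by (auto simp: prod_mset_zero_iff)
  have "n dvd k" using dynatomic_roots_periodic[OF k0 ak] funpow_period_iff[OF assms] by blast
  then show ?thesis using ak k(1) dvd_antisym by blast
qed

lemma delta_at_power:
  assumes "n > 0"
  shows "poly (map_poly (eval_at c) (delta n)) x ^ n = (\<Prod>a\<in>#dynatomic_roots c n. x - multiplier c n a)"
proof -
  interpret int_poly_hom "eval_at c" by (rule int_poly_hom_eval_at)
  have "poly (map_poly (eval_at c) (delta n)) x ^ n = poly (map_poly (eval_at c) (multiplier_poly n)) x"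
    unfolding delta_power[OF assms, symmetric] p.hom_power poly_power ..
  also have "\<dots> = (\<Prod>a\<in>#dynatomic_roots c n. x - multiplier c n a)"
    unfolding map_multiplier_poly[OF assms comm_ring_hom_axioms map_dynatomic_eval_at[OF assms]]
    by (simp add: poly_prod_mset image_mset.compositionality o_def)
  finally show ?thesis .
qed

lemma eval_at_Delta_res:
  assumes m: "m > 0" and r: "r > 0"
  shows "eval_at c (Delta_res (m * r) m) = (\<Prod>k\<in>totatives r. poly (map_poly (eval_at c) (delta m)) (unity_root r k))"
proof -
  let ?q = "map_poly (\<lambda>a. [:a:]) (cyclotomic r)"
  have lq: "lead_coeff ?q = 1"
    by (rule lead_coeff_map_poly_monic[OF comm_ring_hom_const_poly lead_coeff_cyclotomic[OF r]])
  have "map_poly (eval_at c) ?q = map_poly of_int (cyclotomic r)"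
  proof (rule poly_eqI)
    fix i
    interpret int_poly_hom "eval_at c" by (rule int_poly_hom_eval_at)
    have "[:k:] = (of_int k :: int poly)" for k by (simp add: of_int_poly)
    then have "eval_at c [:k:] = of_int k" for k by (simp only: hom_of_int)
    then show "coeff (map_poly (eval_at c) ?q) i = coeff (map_poly of_int (cyclotomic r)) i"
      by (simp add: coeff_map_poly)
  qed
  then have sp: "map_poly (eval_at c) ?q = lin_prod (image_mset (unity_root r) (mset_set (totatives r)))"
    unfolding map_cyclotomic[OF r] .
  have "Delta_res (m * r) m = resultant ?q (delta m)" unfolding Delta_res_def using m by simp
  then show ?thesis
    using hom_resultant_monic[OF comm_ring_hom_eval_at lq lead_coeff_delta[OF m] sp]
    by (simp add: image_mset.compositionality o_def prod_unfold_prod_mset)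
qed

section \<open>Degrees from growth at infinity\<close>

text \<open>
  With \<open>t = s\<^sup>2\<close> as the parameter and \<open>M\<close> the largest absolute value on the cycle,
  \<open>M\<^sup>2 \<le> M + s\<^sup>2\<close> bounds \<open>M\<close> from above; then every \<open>z\<^sup>2 = f(z) - t\<close> on the cycle has absolute value at
  least \<open>s\<^sup>2 - 2 s\<close>. Real parameters of the form \<open>s\<^sup>2\<close> avoid square roots.
\<close>

lemma periodic_orbit_bounds:
  fixes s :: real and a :: complex
  assumes s: "s \<ge> 4" and per: "n > 0" "(quad (of_real (s ^ 2)) ^^ n) a = a"
  shows "s / 2 \<le> norm a" "norm a \<le> 2 * s"
proof -
  let ?f = "quad (complex_of_real (s ^ 2))"
  define z where "z i = (?f ^^ i) a" for i
  have zS: "z (Suc i) = z i ^ 2 + of_real (s ^ 2)" for i by (simp add: z_def quad_def)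
  have zm: "z (i mod n) = z i" for i unfolding z_def by (rule funpow_mod_eq[OF per(2)])
  define M where "M = Max ((\<lambda>i. norm (z i)) ` {..<n})"
  have le: "norm (z i) \<le> M" for i
  proof -
    have "norm (z (i mod n)) \<le> M" unfolding M_def using per(1) by (intro Max_ge) auto
    then show ?thesis unfolding zm .
  qed
  have "M \<in> (\<lambda>i. norm (z i)) ` {..<n}" unfolding M_def using per(1) by (intro Max_in) auto
  then obtain i where i: "M = norm (z i)" by blast
  have n_of: "norm (complex_of_real (s ^ 2)) = s ^ 2" by (simp add: norm_power)
  have "norm (z i) ^ 2 = norm (z (Suc i) - of_real (s ^ 2))" by (simp add: zS norm_power)
  also have "\<dots> \<le> norm (z (Suc i)) + s ^ 2" using norm_triangle_ineq4[of "z (Suc i)" "of_real (s ^ 2)"] n_of by simp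
  finally have M2: "M ^ 2 \<le> M + s ^ 2" using le[of "Suc i"] i by simp
  have Ms: "M \<le> 2 * s"
  proof (rule ccontr)
    assume "\<not> M \<le> 2 * s"
    then have "(2 * s) * (2 * s - 1) \<le> M * (M - 1)" using s by (intro mult_mono) auto
    also have "\<dots> \<le> s ^ 2" using M2 by (simp add: power2_eq_square algebra_simps)
    finally have "s * (3 * s) \<le> s * 2" by (simp add: power2_eq_square algebra_simps)
    then show False using s by simp
  qed
  have "z 0 = a" by (simp add: z_def)
  then show "norm a \<le> 2 * s" using le[of 0] Ms by simp
  have "s ^ 2 = norm (z (Suc 0) - z 0 ^ 2)" using n_of by (simp add: zS)
  also have "\<dots> \<le> norm (z (Suc 0)) + norm (z 0) ^ 2"
    using norm_triangle_ineq4[of "z (Suc 0)" "z 0 ^ 2"] by (simp add: norm_power)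
  finally have "s ^ 2 - 2 * s \<le> norm a ^ 2" using le[of "Suc 0"] Ms \<open>z 0 = a\<close> by simp
  moreover have "(s / 2) ^ 2 \<le> s ^ 2 - 2 * s"
  proof -
    have "s * 4 \<le> s * s" using s by (intro mult_left_mono) auto
    then show ?thesis using s by (simp add: power2_eq_square)
  qed
  ultimately have "(s / 2) ^ 2 \<le> norm a ^ 2" by linarith
  then show "s / 2 \<le> norm a" using power2_le_imp_le norm_ge_zero by blast
qed

lemma multiplier_bounds:
  fixes s :: real and a :: complex
  assumes s: "s \<ge> 4" and per: "n > 0" "(quad (of_real (s ^ 2)) ^^ n) a = a"
  shows "s ^ n \<le> norm (multiplier (of_real (s ^ 2)) n a)"
    "norm (multiplier (of_real (s ^ 2)) n a) \<le> (4 * s) ^ n"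
proof -
  let ?f = "quad (complex_of_real (s ^ 2))"
  have pi: "(?f ^^ n) ((?f ^^ i) a) = (?f ^^ i) a" for i
    using per(2) by (metis add.commute funpow_add o_apply)
  have b: "s \<le> norm (2 * (?f ^^ i) a)" "norm (2 * (?f ^^ i) a) \<le> 4 * s" for i
    using periodic_orbit_bounds[OF s per(1) pi[of i]] by (simp_all add: norm_mult)
  have eq: "norm (multiplier (of_real (s ^ 2)) n a) = (\<Prod>i<n. norm (2 * (?f ^^ i) a))"
    unfolding multiplier_def by (rule prod_norm[symmetric])
  have "(\<Prod>i<n. s) \<le> (\<Prod>i<n. norm (2 * (?f ^^ i) a))"
    by (rule prod_mono) (use b s in auto)
  then show "s ^ n \<le> norm (multiplier (of_real (s ^ 2)) n a)" unfolding eq by simp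
  have "(\<Prod>i<n. norm (2 * (?f ^^ i) a)) \<le> (\<Prod>i<n. 4 * s)"
    by (rule prod_mono) (use b in auto)
  then show "norm (multiplier (of_real (s ^ 2)) n a) \<le> (4 * s) ^ n" unfolding eq by simp
qed

lemma prod_mset_bounds:
  fixes f :: "'a \<Rightarrow> real"
  assumes "\<And>x. x \<in># A \<Longrightarrow> l \<le> f x \<and> f x \<le> u" "0 \<le> l"
  shows "l ^ size A \<le> (\<Prod>x\<in>#A. f x) \<and> (\<Prod>x\<in>#A. f x) \<le> u ^ size A"
  using assms(1)
proof (induction A)
  case (add x A)
  then have IH: "l ^ size A \<le> (\<Prod>x\<in>#A. f x)" "(\<Prod>x\<in>#A. f x) \<le> u ^ size A" and x: "l \<le> f x" "f x \<le> u" by auto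
  have "0 \<le> l ^ size A" using assms(2) by simp
  with IH x assms(2) have "l * l ^ size A \<le> f x * (\<Prod>x\<in>#A. f x)" "f x * (\<Prod>x\<in>#A. f x) \<le> u * u ^ size A"
    by (intro mult_mono; linarith)+
  then show ?case by simp
qed simp

lemma norm_prod_mset: "norm (\<Prod>x\<in>#A. f x :: 'b :: {real_normed_div_algebra, comm_ring_1}) = (\<Prod>x\<in>#A. norm (f x))"
  by (induction A) (simp_all add: norm_mult)

lemma delta_growth:
  fixes s :: real
  assumes n: "n > 0" and s: "s \<ge> 4" and x: "norm x = 1"
  shows "(s ^ n / 2) ^ card (Per n) \<le> norm (poly (map_poly (eval_at (of_real (s ^ 2))) (delta n)) x) ^ n"
    and "norm (poly (map_poly (eval_at (of_real (s ^ 2))) (delta n)) x) ^ n \<le> (2 * (4 * s) ^ n) ^ card (Per n)"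
proof -
  let ?c = "complex_of_real (s ^ 2)"
  have eq: "norm (poly (map_poly (eval_at ?c) (delta n)) x) ^ n =
      (\<Prod>a\<in>#dynatomic_roots ?c n. norm (x - multiplier ?c n a))"
    unfolding norm_power[symmetric] delta_at_power[OF n] norm_prod_mset ..
  have "4 ^ n \<le> s ^ n" using s by (intro power_mono) auto
  moreover have "(4 :: real) ^ 1 \<le> 4 ^ n" using n by (intro power_increasing) auto
  ultimately have sn: "4 \<le> s ^ n" by simp
  have b: "s ^ n / 2 \<le> norm (x - multiplier ?c n a) \<and> norm (x - multiplier ?c n a) \<le> 2 * (4 * s) ^ n"
    if "a \<in># dynatomic_roots ?c n" for a
  proof -
    note m = multiplier_bounds[OF s n dynatomic_roots_periodic[OF n that]]
    have "s ^ n - 1 \<le> norm (x - multiplier ?c n a)"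
      using m norm_triangle_ineq2[of "multiplier ?c n a" x] x by (simp add: norm_minus_commute)
    moreover have "norm (x - multiplier ?c n a) \<le> (4 * s) ^ n + 1"
      using m norm_triangle_ineq4[of x "multiplier ?c n a"] x by simp
    moreover have "1 \<le> (4 * s) ^ n" using m(1,2) sn by linarith
    ultimately show ?thesis using sn by linarith
  qed
  have "0 \<le> s ^ n / 2" using sn by linarith
  note r = prod_mset_bounds[of "dynatomic_roots ?c n", OF b this, unfolded size_dynatomic_roots[OF n]]
  show "(s ^ n / 2) ^ card (Per n) \<le> norm (poly (map_poly (eval_at (of_real (s ^ 2))) (delta n)) x) ^ n"
    unfolding eq using r by (rule conjunct1)
  show "norm (poly (map_poly (eval_at (of_real (s ^ 2))) (delta n)) x) ^ n \<le> (2 * (4 * s) ^ n) ^ card (Per n)"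
    unfolding eq using r by (rule conjunct2)
qed

lemma power_growth_le:
  fixes c C T :: real
  assumes "c > 0" "\<And>t. t \<ge> T \<Longrightarrow> c * t ^ a \<le> C * t ^ b"
  shows "a \<le> b"
proof (rule ccontr)
  assume "\<not> a \<le> b"
  then have ab: "a = b + Suc (a - Suc b)" by simp
  define t where "t = max (max T 1) (C / c + 1)"
  have t: "t \<ge> T" "t \<ge> 1" "C / c + 1 \<le> t" unfolding t_def by auto
  have "C < c * t" using t(3) assms(1) by (simp add: field_simps)
  moreover have "t ^ 1 \<le> t ^ Suc (a - Suc b)" using t(2) by (intro power_increasing) auto
  then have "c * t \<le> c * t ^ Suc (a - Suc b)" using assms(1) by simp
  ultimately have "C * t ^ b < c * t ^ Suc (a - Suc b) * t ^ b" using t(2) by (intro mult_strict_right_mono) auto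
  also have "\<dots> = c * t ^ a" by (subst (2) ab) (simp add: power_add mult_ac)
  also have "\<dots> \<le> C * t ^ b" by (rule assms(2)[OF t(1)])
  finally show False by simp
qed

text \<open>
  Along \<open>c = s\<^sup>2\<close> the polynomial is of the order of its leading term, that is, of \<open>s\<close> to twice its degree.
\<close>

lemma degree_from_growth:
  fixes p :: "int poly" and l u :: real
  assumes lu: "l > 0" "b > 0"
    and bounds: "\<And>s. s \<ge> 4 \<Longrightarrow> l * s ^ a \<le> norm (eval_at (of_real (s ^ 2)) p) ^ b"
      "\<And>s. s \<ge> 4 \<Longrightarrow> norm (eval_at (of_real (s ^ 2)) p) ^ b \<le> u * s ^ a"
  shows "p \<noteq> 0" "2 * b * degree p = a"
proof -
  let ?p = "map_poly real_of_int p" let ?d = "degree p"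
  have ev: "norm (eval_at (of_real x) p) = \<bar>poly ?p x\<bar>" for x
  proof -
    have "map_poly complex_of_int p = map_poly complex_of_real ?p"
      by (subst map_poly_map_poly) (simp_all add: o_def)
    then have "eval_at (of_real x) p = of_real (poly ?p x)"
      unfolding eval_at_def by (simp add: hom_poly[OF of_real_hom.comm_ring_hom_axioms])
    then show ?thesis by simp
  qed
  show p0: "p \<noteq> 0"
  proof
    assume "p = 0"
    then have "l * 4 ^ a \<le> 0" using bounds(1)[of 4] lu(2) by (simp add: eval_at_def zero_power)
    moreover have "l * 4 ^ a > 0" using lu(1) by simp
    ultimately show False by linarith
  qed
  let ?L = "\<bar>real_of_int (lead_coeff p)\<bar>"
  have L: "?L > 0" using p0 by simp
  have "((\<lambda>x. poly ?p x / x ^ degree ?p) \<longlongrightarrow> lead_coeff ?p) at_top"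
    by (rule tendsto_mono[OF at_top_le_at_infinity poly_divide_tendsto_aux])
  then have "((\<lambda>x. \<bar>poly ?p x / x ^ ?d\<bar>) \<longlongrightarrow> ?L) at_top"
    using tendsto_rabs by (fastforce simp: coeff_map_poly)
  then have "eventually (\<lambda>x. dist \<bar>poly ?p x / x ^ ?d\<bar> ?L < ?L / 2) at_top"
    using L by (intro tendstoD) auto
  then obtain T where T: "\<And>x. x \<ge> T \<Longrightarrow> dist \<bar>poly ?p x / x ^ ?d\<bar> ?L < ?L / 2"
    unfolding eventually_at_top_linorder by blast
  have pb: "?L / 2 * x ^ ?d \<le> \<bar>poly ?p x\<bar> \<and> \<bar>poly ?p x\<bar> \<le> 2 * ?L * x ^ ?d" if "x \<ge> T" "x \<ge> 1" for x
  proof -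
    have xp: "x ^ ?d > 0" using that by simp
    have "?L / 2 \<le> \<bar>poly ?p x / x ^ ?d\<bar>" "\<bar>poly ?p x / x ^ ?d\<bar> \<le> 2 * ?L"
      using T[OF that(1)] L unfolding dist_real_def abs_less_iff by linarith+
    then show ?thesis using xp by (simp add: abs_divide field_simps)
  qed
  define T' where "T' = max 4 (max T 1)"
  have sq: "s ^ 2 \<ge> T" "s ^ 2 \<ge> 1" "s \<ge> 4" if "s \<ge> T'" for s
  proof -
    have "s \<ge> 4" "s \<ge> T" using that by (simp_all add: T'_def)
    moreover from this have "s * 1 \<le> s * s" by (intro mult_left_mono) auto
    ultimately show "s ^ 2 \<ge> T" "s ^ 2 \<ge> 1" "s \<ge> 4" unfolding power2_eq_square by linarith+
  qed
  have pw: "(k * (s ^ 2) ^ ?d) ^ b = k ^ b * s ^ (2 * b * ?d)" for k s :: real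
    by (simp add: power_mult_distrib mult.commute mult.left_commute flip: power_mult)
  have "a \<le> 2 * b * ?d"
  proof (rule power_growth_le[OF lu(1)])
    fix s assume s: "s \<ge> T'"
    have "l * s ^ a \<le> \<bar>poly ?p (s ^ 2)\<bar> ^ b" using bounds(1)[OF sq(3)[OF s]] unfolding ev .
    also have "\<dots> \<le> (2 * ?L * (s ^ 2) ^ ?d) ^ b"
      using pb[OF sq(1,2)[OF s]] by (intro power_mono) auto
    finally show "l * s ^ a \<le> (2 * ?L) ^ b * s ^ (2 * b * ?d)" unfolding pw .
  qed
  moreover have "2 * b * ?d \<le> a"
  proof (rule power_growth_le)
    show "(?L / 2) ^ b > 0" using L by simp
    fix s assume s: "s \<ge> T'"
    have "(?L / 2 * (s ^ 2) ^ ?d) ^ b \<le> \<bar>poly ?p (s ^ 2)\<bar> ^ b"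
      using pb[OF sq(1,2)[OF s]] L by (intro power_mono) auto
    also have "\<dots> \<le> u * s ^ a" using bounds(2)[OF sq(3)[OF s]] unfolding ev .
    finally show "(?L / 2) ^ b * s ^ (2 * b * ?d) \<le> u * s ^ a" unfolding pw .
  qed
  ultimately show "2 * b * degree p = a" by simp
qed

text \<open>
  The multipliers tend to infinity like \<open>c\<^sup>n\<^sup>/\<^sup>2\<close>, so every factor \<open>x - (f\<^sup>n)'(\<alpha>)\<close> of \<open>\<delta>\<^sub>n(x)\<^sup>n\<close> does so
  for all \<open>x\<close> on the unit circle alike.
\<close>

lemma degree_delta_values:
  fixes p :: "int poly"
  assumes n: "n > 0" and Z: "finite Z" "\<And>k. k \<in> Z \<Longrightarrow> norm (x k) = 1"
    and p: "\<And>c. eval_at c p = (\<Prod>k\<in>Z. poly (map_poly (eval_at c) (delta n)) (x k))"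
  shows "p \<noteq> 0" "2 * degree p = card (Per n) * card Z"
proof -
  let ?v = "card (Per n)" let ?a = "n * (?v * card Z)"
  let ?l = "((1 / 2) ^ ?v) ^ card Z :: real" let ?u = "((2 * 4 ^ n) ^ ?v) ^ card Z :: real"
  have 1: "?l * s ^ ?a \<le> norm (eval_at (of_real (s ^ 2)) p) ^ n \<and> norm (eval_at (of_real (s ^ 2)) p) ^ n \<le> ?u * s ^ ?a"
    if s: "s \<ge> 4" for s
  proof -
    let ?g = "\<lambda>k. norm (poly (map_poly (eval_at (of_real (s ^ 2))) (delta n)) (x k)) ^ n"
    have s0: "s \<ge> 0" using s by simp
    have eq: "norm (eval_at (of_real (s ^ 2)) p) ^ n = (\<Prod>k\<in>Z. ?g k)"
      unfolding p prod_norm[symmetric] prod_power_distrib ..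
    have "(\<Prod>k\<in>Z. (s ^ n / 2) ^ ?v) \<le> (\<Prod>k\<in>Z. ?g k)"
      by (rule prod_mono) (use delta_growth(1)[OF n s] Z s0 in auto)
    moreover have "(\<Prod>k\<in>Z. ?g k) \<le> (\<Prod>k\<in>Z. (2 * (4 * s) ^ n) ^ ?v)"
      by (rule prod_mono) (use delta_growth(2)[OF n s] Z in auto)
    moreover have "(\<Prod>k\<in>Z. (s ^ n / 2) ^ ?v) = ?l * s ^ ?a"
    proof -
      have "s ^ n / 2 = (1 / 2) * s ^ n" by simp
      then show ?thesis by (simp only: prod_constant power_mult_distrib power_mult)
    qed
    moreover have "(\<Prod>k\<in>Z. (2 * (4 * s) ^ n) ^ ?v) = ?u * s ^ ?a"
      by (simp add: power_mult power_mult_distrib)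
    ultimately show ?thesis unfolding eq by simp
  qed
  have l0: "?l > 0" by simp
  note r = degree_from_growth[of ?l n ?a p ?u, OF l0 n]
  show "p \<noteq> 0" using r(1) 1 by blast
  have "2 * n * degree p = ?a" using r(2) 1 by blast
  then show "2 * degree p = ?v * card Z" using n by (simp add: mult.assoc mult.left_commute)
qed

lemma degree_Delta_proper:
  assumes m: "m > 0" and r: "r > 1"
  shows "2 * degree (Delta (m * r) m) = card (Per m) * totient r"
proof -
  have "Delta (m * r) m = Delta_res (m * r) m" using m r by (simp add: Delta_def)
  moreover have "2 * degree (Delta_res (m * r) m) = card (Per m) * card (totatives r)"
    by (rule degree_delta_values(2)[OF m _ _ eval_at_Delta_res[OF m]]) (use r in \<open>simp_all add: unity_root_def\<close>)
  ultimately show ?thesis by (simp add: totient_def)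
qed

lemma delta_at_1:
  assumes n: "n > 0"
  shows "poly (delta n) 1 \<noteq> 0" "2 * degree (poly (delta n) 1) = card (Per n)"
proof -
  have "eval_at c (poly (delta n) 1) = (\<Prod>k\<in>{()}. poly (map_poly (eval_at c) (delta n)) 1)" for c
  proof -
    interpret int_poly_hom "eval_at c" by (rule int_poly_hom_eval_at)
    show ?thesis using hom_poly[OF comm_ring_hom_axioms, of "delta n" 1] by simp
  qed
  from degree_delta_values[OF n _ _ this] show "poly (delta n) 1 \<noteq> 0" "2 * degree (poly (delta n) 1) = card (Per n)"
    by simp_all
qed

lemma Delta_nonzero:
  assumes n: "n > 0" and k: "k dvd n"
  shows "Delta n k \<noteq> 0"
proof -
  have eq: "poly (delta n) 1 = Delta n n * (\<Prod>k | k dvd n \<and> k \<noteq> n. Delta n k)" by (rule Delta_self[OF n])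
  have fin: "finite {k. k dvd n \<and> k \<noteq> n}" using n by simp
  have "Delta n n \<noteq> 0" "(\<Prod>k | k dvd n \<and> k \<noteq> n. Delta n k) \<noteq> 0"
    using delta_at_1(1)[OF n] unfolding eq by auto
  then show ?thesis using k fin by (cases "k = n") (auto simp: prod_zero_iff)
qed

lemma degree_Delta_self:
  assumes n: "n > 0"
  shows "card (Per n) = 2 * degree (Delta n n) + (\<Sum>k | k dvd n \<and> k \<noteq> n. card (Per k) * totient (n div k))"
proof -
  let ?D = "{k. k dvd n \<and> k \<noteq> n}"
  have nz: "Delta n k \<noteq> 0" if "k dvd n" for k using Delta_nonzero[OF n that] .
  have fin: "finite ?D" using n by simp
  have "degree (\<Prod>k\<in>?D. Delta n k) = (\<Sum>k\<in>?D. degree (Delta n k))"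
    by (rule degree_prod_eq_sum_degree) (use nz in blast)
  moreover have "(\<Prod>k\<in>?D. Delta n k) \<noteq> 0" using fin nz by (auto simp: prod_zero_iff)
  ultimately have "degree (poly (delta n) 1) = degree (Delta n n) + (\<Sum>k\<in>?D. degree (Delta n k))"
    unfolding Delta_self[OF n] using nz[of n] by (simp add: degree_mult_eq)
  then have "card (Per n) = 2 * degree (Delta n n) + (\<Sum>k\<in>?D. 2 * degree (Delta n k))"
    using delta_at_1(2)[OF n] by (simp add: sum_distrib_left)
  also have "(\<Sum>k\<in>?D. 2 * degree (Delta n k)) = (\<Sum>k\<in>?D. card (Per k) * totient (n div k))"
  proof (rule sum.cong[OF refl])
    fix k assume k: "k \<in> ?D"
    then have k0: "k > 0" using dvd_pos_nat[OF n] by blast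
    define r where "r = n div k"
    have nr: "n = k * r" using k by (simp add: r_def)
    have "r > 1" using k n nr by (cases r; cases "r = 1") auto
    from degree_Delta_proper[OF k0 this] show "2 * degree (Delta n k) = card (Per k) * totient (n div k)"
      using nr k0 by simp
  qed
  finally show ?thesis .
qed

section \<open>Which of the polynomials are cubic\<close>

lemma proper_divisors_numeral:
  shows "{k :: nat. k dvd 1 \<and> k \<noteq> 1} = {}" "{k :: nat. k dvd 2 \<and> k \<noteq> 2} = {1}"
    "{k :: nat. k dvd 3 \<and> k \<noteq> 3} = {1}" "{k :: nat. k dvd 4 \<and> k \<noteq> 4} = {1, 2}"
    "{k :: nat. k dvd 5 \<and> k \<noteq> 5} = {1}" "{k :: nat. k dvd 6 \<and> k \<noteq> 6} = {1, 2, 3}"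
    "{k :: nat. k dvd 7 \<and> k \<noteq> 7} = {1}" "{k :: nat. k dvd 8 \<and> k \<noteq> 8} = {1, 2, 4}"
proof -
  have D: "{k :: nat. k dvd n \<and> k \<noteq> n} = set (filter (\<lambda>k. k dvd n) [1..<n])" if "n > 0" for n
    using that by (auto dest: dvd_imp_le intro: gr0I)
  show "{k :: nat. k dvd 1 \<and> k \<noteq> 1} = {}" "{k :: nat. k dvd 2 \<and> k \<noteq> 2} = {1}"
    "{k :: nat. k dvd 3 \<and> k \<noteq> 3} = {1}" "{k :: nat. k dvd 4 \<and> k \<noteq> 4} = {1, 2}"
    "{k :: nat. k dvd 5 \<and> k \<noteq> 5} = {1}" "{k :: nat. k dvd 6 \<and> k \<noteq> 6} = {1, 2, 3}"
    "{k :: nat. k dvd 7 \<and> k \<noteq> 7} = {1}" "{k :: nat. k dvd 8 \<and> k \<noteq> 8} = {1, 2, 4}"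
    by (subst D, simp, simp add: upt_rec del: One_nat_def)+
qed

text \<open>
  The degree of the \<open>n\<close>-th dynatomic polynomial.
\<close>

abbreviation nu :: "nat \<Rightarrow> nat" where "nu n \<equiv> card (Per n)"

lemma nu_rec:
  assumes "n > 0"
  shows "nu n + (\<Sum>k | k dvd n \<and> k \<noteq> n. nu k) = 2 ^ n"
proof -
  have "{k. k dvd n} = insert n {k. k dvd n \<and> k \<noteq> n}" by auto
  moreover have "finite {k. k dvd n \<and> k \<noteq> n}" using assms by simp
  ultimately show ?thesis using sum_card_Per[OF assms] by simp
qed

lemma nu_le: "n > 0 \<Longrightarrow> nu n \<le> 2 ^ n"
  using nu_rec[of n] by simp

lemma nu_small: "nu 1 = 2" "nu 2 = 2" "nu 3 = 6" "nu 4 = 12"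
proof -
  show 1: "nu 1 = 2" using nu_rec[of 1] unfolding proper_divisors_numeral by simp
  show 2: "nu 2 = 2" using nu_rec[of 2] 1 unfolding proper_divisors_numeral by simp
  show 3: "nu 3 = 6" using nu_rec[of 3] 1 unfolding proper_divisors_numeral by simp
  show 4: "nu 4 = 12" using nu_rec[of 4] 1 2 unfolding proper_divisors_numeral by simp
qed

lemma proper_divisor_le_half: "k dvd n \<Longrightarrow> k \<noteq> n \<Longrightarrow> n > 0 \<Longrightarrow> 2 * k \<le> (n :: nat)"
proof (elim dvdE)
  fix t assume "n = k * t" "k \<noteq> n" "n > 0"
  then have "t \<ge> 2" by (cases t; cases "t = 1") auto
  then show "2 * k \<le> n" using \<open>n = k * t\<close> by simp
qed

lemma sum_pow2_proper_divisors:
  assumes "n > 0"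
  shows "(\<Sum>k | k dvd n \<and> k \<noteq> n. 2 ^ k) < (2 :: nat) ^ Suc (n div 2)"
proof -
  have "(\<Sum>k | k dvd n \<and> k \<noteq> n. 2 ^ k) \<le> (\<Sum>k<Suc (n div 2). (2 :: nat) ^ k)"
    by (rule sum_mono2) (use proper_divisor_le_half[OF _ _ assms] in \<open>auto simp: less_Suc_eq_le intro!: div_le_mono[of "2 * _" n 2, simplified]\<close>)
  also have "\<dots> < 2 ^ Suc (n div 2)" using sum_power2[of "Suc (n div 2)"] by (simp add: lessThan_atLeast0)
  finally show ?thesis .
qed

lemma nu_gt_6:
  assumes "n \<ge> 4"
  shows "nu n > 6"
proof (cases "n = 4")
  case False
  then have n: "n \<ge> 5" using assms by simp
  have "(\<Sum>k | k dvd n \<and> k \<noteq> n. nu k) \<le> (\<Sum>k | k dvd n \<and> k \<noteq> n. 2 ^ k)"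
    by (rule sum_mono) (use n nu_le dvd_pos_nat[of n] in auto)
  also have "\<dots> < 2 ^ Suc (n div 2)" by (rule sum_pow2_proper_divisors) (use n in simp)
  also have "\<dots> \<le> 2 ^ (n - 2)" by (rule power_increasing) (use n in auto)
  finally have "2 ^ n < nu n + 2 ^ (n - 2)" using nu_rec[of n] n by simp
  moreover have "(2 :: nat) ^ n = 4 * 2 ^ (n - 2)"
  proof -
    have "n = Suc (Suc (n - 2))" using n by simp
    then have "(2 :: nat) ^ n = 2 ^ Suc (Suc (n - 2))" by (rule arg_cong)
    then show ?thesis by simp
  qed
  moreover have "(2 :: nat) ^ 3 \<le> 2 ^ (n - 2)" by (rule power_increasing) (use n in auto)
  ultimately show ?thesis by simp
qed (simp add: nu_small)

lemma totient_neq_3: "r > 2 \<Longrightarrow> totient r \<noteq> 3"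
  using totient_even[of r] by auto

text \<open>
  The equation \<open>\<nu>(m) \<phi>(r) = 6\<close> leaves only \<open>m \<le> 3\<close>, where \<open>\<nu>(m)\<close> is \<open>2\<close>, \<open>2\<close>, \<open>6\<close>; and \<open>\<phi>(r) = 3\<close> is
  impossible.
\<close>

lemma degree_Delta_proper_eq_3:
  assumes "m > 0" "r > 1" "degree (Delta (m * r) m) = 3"
  shows "m = 3 \<and> r = 2"
proof -
  have eq: "nu m * totient r = 6" using degree_Delta_proper[OF assms(1,2)] assms(3) by simp
  have "totient r > 0" using assms(2) by simp
  then have "nu m \<le> 6" using eq by (metis Suc_leI dvd_imp_le dvd_triv_left zero_less_numeral)
  then have "m < 4" using nu_gt_6[of m] by linarith
  then consider "m = 1" | "m = 2" | "m = 3" using assms(1) by linarith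
  then show ?thesis
  proof cases
    case 3
    then have "totient r = 1" using eq nu_small by simp
    then have "\<not> r > 2" using totient_even[of r] by (metis odd_one)
    then show ?thesis using 3 assms(2) by simp
  next
    case 1
    then have "totient r = 3" using eq nu_small by simp
    then show ?thesis using totient_neq_3[of r] assms(2) by (cases "r = 2") auto
  next
    case 2
    then have "totient r = 3" using eq nu_small by simp
    then show ?thesis using totient_neq_3[of r] assms(2) by (cases "r = 2") auto
  qed
qed

text \<open>
  Twice the degree is \<open>2\<^sup>n - \<Sum>\<^sub>k \<nu>(k) (\<phi>(n/k) + 1)\<close> over the proper divisors \<open>k\<close> of \<open>n\<close>. With
  \<open>\<nu>(k) \<le> 2\<^sup>k\<close> and \<open>\<phi>(n/k) + 1 \<le> n/k\<close> the sum is less than \<open>n 2\<^sup>n\<^sup>/\<^sup>2\<^sup>+\<^sup>1\<close>, which suffices for \<open>n \<ge> 9\<close>;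
  for smaller \<open>n\<close> it is computed.
\<close>

lemma Delta_self_degree_bound:
  assumes "n \<ge> 5"
  shows "degree (Delta n n) > 3"
proof -
  let ?D = "{k. k dvd n \<and> k \<noteq> n}"
  have n: "n > 0" using assms by simp
  have nuD: "nu k \<le> 2 ^ k" if "k \<in> ?D" for k using nu_le dvd_pos_nat[OF n] that by blast
  have "2 ^ n = 2 * degree (Delta n n) + (\<Sum>k\<in>?D. nu k * (totient (n div k) + 1))"
    using nu_rec[OF n] degree_Delta_self[OF n] by (simp add: sum.distrib algebra_simps)
  also have "(\<Sum>k\<in>?D. nu k * (totient (n div k) + 1)) \<le> (\<Sum>k\<in>?D. 2 ^ k * (n div k))"
  proof (rule sum_mono)
    fix k assume k: "k \<in> ?D"
    then have "k * (n div k) = n" by simp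
    then have "n div k > 1" using k n by (cases "n div k"; cases "n div k = 1") auto
    then have "totient (n div k) + 1 \<le> n div k" using totient_less[of "n div k"] by simp
    then show "nu k * (totient (n div k) + 1) \<le> 2 ^ k * (n div k)" using nuD[OF k] by (rule mult_le_mono[rotated])
  qed
  finally have *: "2 ^ n \<le> 2 * degree (Delta n n) + (\<Sum>k\<in>?D. 2 ^ k * (n div k))" by simp
  have "6 + (\<Sum>k\<in>?D. 2 ^ k * (n div k)) < 2 ^ n"
  proof (cases "n \<ge> 9")
    case True
    have "(\<Sum>k\<in>?D. 2 ^ k * (n div k)) \<le> (\<Sum>k\<in>?D. 2 ^ k) * n"
      unfolding sum_distrib_right by (rule sum_mono) simp
    also have "\<dots> \<le> (2 ^ Suc (n div 2) - 1) * n"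
      using sum_pow2_proper_divisors[OF n] by (intro mult_le_mono1) simp
    also have "\<dots> = 2 ^ Suc (n div 2) * n - n" by (simp add: diff_mult_distrib)
    finally have 1: "(\<Sum>k\<in>?D. 2 ^ k * (n div k)) + n \<le> 2 ^ Suc (n div 2) * n"
      by (metis (no_types, lifting) add_le_mono1 le_add_diff_inverse2 mult_le_mono1 nat_mult_1 one_le_numeral one_le_power)
    have "j \<ge> 4 \<Longrightarrow> 2 ^ Suc j * (2 * j + 1) \<le> (2::nat) ^ (2 * j + 1)" for j :: nat
    proof (induction j rule: nat_induct_at_least)
      case (Suc j)
      have "2 ^ Suc (Suc j) * (2 * Suc j + 1) \<le> 4 * (2 ^ Suc j * (2 * j + 1) :: nat)"
        using Suc.hyps by simp
      also have "\<dots> \<le> 4 * 2 ^ (2 * j + 1)" by (rule mult_le_mono2[OF Suc.IH])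
      finally show ?case by simp
    qed simp
    note odd = this
    have even: "j \<ge> 5 \<Longrightarrow> 2 ^ Suc j * (2 * j) \<le> (2::nat) ^ (2 * j)" for j :: nat
    proof (induction j rule: nat_induct_at_least)
      case (Suc j)
      have "2 ^ Suc (Suc j) * (2 * Suc j) \<le> 4 * (2 ^ Suc j * (2 * j) :: nat)"
        using Suc.hyps by simp
      also have "\<dots> \<le> 4 * 2 ^ (2 * j)" by (rule mult_le_mono2[OF Suc.IH])
      finally show ?case by simp
    qed simp
    have "2 ^ Suc (n div 2) * n \<le> 2 ^ n"
    proof (cases "even n")
      case True
      then obtain j where "n = 2 * j" by blast
      with even[of j] \<open>n \<ge> 9\<close> show ?thesis by simp
    next
      case False
      then obtain j where "n = 2 * j + 1" by (elim oddE)
      with odd[of j] \<open>n \<ge> 9\<close> show ?thesis by simp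
    qed
    with 1 \<open>n \<ge> 9\<close> show ?thesis by linarith
  next
    case False
    with assms consider "n = 5" | "n = 6" | "n = 7" | "n = 8" by linarith
    then show ?thesis by cases (simp_all add: proper_divisors_numeral)
  qed
  with * show ?thesis by linarith
qed

lemma degree_Delta_self_eq_3:
  assumes "n > 0" "degree (Delta n n) = 3"
  shows "n = 4"
proof -
  have "n < 5" using Delta_self_degree_bound[of n] assms(2) by linarith
  then consider "n = 1" | "n = 2" | "n = 3" | "n = 4" using assms(1) by linarith
  then show ?thesis
  proof cases
    case 1 then show ?thesis using nu_small degree_Delta_self[of n] assms by simp
  next
    case 2 then show ?thesis using nu_small degree_Delta_self[of n] assms by simp
  next
    case 3
    from degree_Delta_self[of 3] show ?thesis
      using 3 nu_small assms(2) unfolding proper_divisors_numeral by simp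
  qed simp
qed

section \<open>Cubic parabolic parameters\<close>

lemma minimal_poly_dvd:
  fixes p q :: "rat poly" and z :: complex
  assumes "irreducible p" "poly (map_poly of_rat p) z = 0" "poly (map_poly of_rat q) z = 0"
  shows "p dvd q"
proof (rule ccontr)
  assume nd: "\<not> p dvd q"
  let ?e = "\<lambda>f. poly (map_poly of_rat f) z"
  have "gcd p q dvd p" by simp
  then have "p dvd gcd p q \<or> is_unit (gcd p q)" by (rule irreducibleD'[OF assms(1)])
  then have "is_unit (gcd p q)" using nd dvd_trans[OF _ gcd_dvd2[of p q]] by blast
  then have g: "gcd p q = 1" by (simp only: is_unit_gcd coprime_iff_gcd_eq_1)
  obtain u v where "u * p + v * q = 1" using bezout_coefficients_fst_snd[of p q] g by metis
  then have "?e (u * p + v * q) = ?e 1" by (simp only:)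
  moreover have "comm_ring_hom (of_rat :: rat \<Rightarrow> complex)" by unfold_locales (simp_all add: of_rat_add of_rat_mult)
  then interpret map_poly_comm_ring_hom "of_rat :: rat \<Rightarrow> complex" by (simp only: map_poly_comm_ring_hom_def)
  have "?e (u * p + v * q) = 0" "?e 1 = 1"
    by (simp_all only: hom_add hom_mult hom_one poly_add poly_mult poly_1 assms(2,3) mult_zero_right add_0)
  ultimately show False by simp
qed

lemma minimal_degree:
  fixes q :: "rat poly"
  assumes "has_degree_over_rat z d" "q \<noteq> 0" "poly (map_poly of_rat q) z = 0"
  shows "d \<le> degree q"
proof -
  obtain p :: "rat poly" where p: "irreducible p" "degree p = d" "poly (map_poly of_rat p) z = 0"
    using assms(1) unfolding has_degree_over_rat_def by blast
  from minimal_poly_dvd[OF p(1,3) assms(3)] show ?thesis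
    using dvd_imp_degree_le[OF _ assms(2)] p(2) by blast
qed

text \<open>
  An irreducible polynomial with \<open>z\<close> as a root is a constant multiple of the minimal polynomial of \<open>z\<close>.
\<close>

lemma degree_irreducible_root:
  fixes D :: "int poly"
  assumes deg: "has_degree_over_rat z d" and D: "D \<noteq> 0" "eval_at z D = 0"
    and irr: "degree D > 0 \<Longrightarrow> irreducible (map_poly rat_of_int D)"
  shows "degree D = d"
proof -
  obtain p :: "rat poly" where p: "irreducible p" "degree p = d" "poly (map_poly of_rat p) z = 0"
    using deg unfolding has_degree_over_rat_def by blast
  let ?q = "map_poly rat_of_int D"
  have dq: "degree ?q = degree D" by simp
  have D0: "degree D > 0"
  proof (rule gr0I)
    assume "degree D = 0"
    then obtain k where k: "D = [:k:]" by (metis degree_eq_zeroE)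
    interpret int_poly_hom "eval_at z" by (rule int_poly_hom_eval_at)
    have "D = of_int k" using k by (simp add: of_int_poly)
    then have "eval_at z D = of_int k" by (simp only: hom_of_int)
    then show False using D k by simp
  qed
  have "map_poly of_rat ?q = map_poly complex_of_int D"
    by (subst map_poly_map_poly) (simp_all add: o_def)
  then have "poly (map_poly of_rat ?q) z = 0" using D(2) by (simp add: eval_at_def)
  then have "p dvd ?q" by (rule minimal_poly_dvd[OF p(1,3)])
  then obtain u where u: "?q = p * u" by (rule dvdE)
  have "is_unit u" using Factorial_Ring.irreducibleD[OF irr[OF D0] u] irreducible_not_unit[OF p(1)] by blast
  then have "degree u = 0" "u \<noteq> 0" by (auto simp: is_unit_iff_degree)
  moreover have "p \<noteq> 0" using p(1) by auto
  ultimately have "degree ?q = degree p" unfolding u by (simp add: degree_mult_eq)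
  then show ?thesis using dq p(2) by simp
qed

lemma quad_eq: "(\<lambda>z. z ^ 2 + c) = quad c"
  by (simp add: quad_def fun_eq_iff)

lemma deriv_quad_iterate: "deriv (quad c ^^ m) a = multiplier c m (a :: complex)"
proof -
  interpret int_poly_hom "eval_at c" by (rule int_poly_hom_eval_at)
  interpret idom_hom "eval_at c" ..
  let ?p = "map_poly (eval_at c) (quad_iter m)"
  have "(quad c ^^ m) = poly ?p" using at_quad_iter[of m] by (auto simp: fun_eq_iff)
  moreover have "deriv (poly ?p) a = poly (pderiv ?p) a"
    by (rule DERIV_imp_deriv[OF poly_DERIV])
  ultimately show ?thesis using at_pderiv_quad_iter[of m a] by (simp add: map_poly_pderiv)
qed

lemma multiplier_3: "multiplier c 3 x = 8 * (x * quad c x * quad c (quad c x))"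
  and multiplier_4: "multiplier c 4 x = 16 * (x * quad c x * quad c (quad c x) * quad c (quad c (quad c x)))"
  by (simp_all add: multiplier_def numeral_3_eq_3 numeral_nat lessThan_Suc)

text \<open>
  In terms of the elementary symmetric functions \<open>s\<close>, \<open>e\<^sub>2\<close>, \<open>e\<^sub>3\<close> of the cycle, the dynamics imposes
  three relations, which yield \<open>(2 s - 3) (s\<^sup>2 + s + c + 2) = 0\<close>; together with \<open>8 e\<^sub>3 = -1\<close>, the second
  factor leads to the cubic. The first factor leads to the rational value \<open>5/36\<close> of \<open>c\<close>, which is
  harmless for a parameter of degree \<open>3\<close>.
\<close>

lemma three_cycle_algebra:
  fixes x y z c :: complex
  assumes "y = x ^ 2 + c" "z = y ^ 2 + c" "x = z ^ 2 + c" "x \<noteq> y" "8 * (x * y * z) = - 1"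
  shows "64 * c ^ 3 + 128 * c ^ 2 + 72 * c + 81 = 0 \<or> 36 * c = 5"
proof -
  have "(x - y) * (x + y) = y - z" "(y - z) * (y + z) = z - x" "(z - x) * (z + x) = x - y"
    using assms(1-3) by Groebner_Basis.algebra+
  then have "(x - y) * ((x + y) * (y + z) * (z + x) - 1) = 0" by Groebner_Basis.algebra
  then have pr: "(x + y) * (y + z) * (z + x) = 1" using assms(4) by simp
  define s where "s = x + y + z"
  define e2 where "e2 = x * y + y * z + z * x"
  define e3 where "e3 = x * y * z"
  have r1: "s * e2 - e3 = 1" using pr unfolding s_def e2_def e3_def by Groebner_Basis.algebra
  have r2: "s ^ 2 - 2 * e2 = s - 3 * c" using assms(1-3) unfolding s_def e2_def by Groebner_Basis.algebra
  have "x * y = x * (x ^ 2 + c)" "y * z = y * (y ^ 2 + c)" "z * x = z * (z ^ 2 + c)"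
    using assms(1-3) by simp_all
  then have r3: "e2 = s ^ 3 - 3 * s * e2 + 3 * e3 + c * s" unfolding s_def e2_def e3_def by Groebner_Basis.algebra
  have r4: "8 * e3 = - 1" using assms(5) unfolding e3_def .
  have "(2 * s - 3) * (s ^ 2 + s + c + 2) = 0" using r1 r2 r3 by Groebner_Basis.algebra
  then consider "2 * s = 3" | "s ^ 2 + s + c + 2 = 0" by auto
  then show ?thesis
  proof cases
    case 1
    have "12 * e2 = 4 * ((2 * s) * e2)" unfolding 1 by simp
    also have "\<dots> = 8 * (s * e2 - e3) + 8 * e3" by (simp add: algebra_simps)
    also have "\<dots> = 7" unfolding r1 r4 by simp
    finally have e2: "12 * e2 = 7" .
    have "36 * c = 6 * (2 * s) - 3 * (2 * s) ^ 2 + 2 * (12 * e2)" using r2 by Groebner_Basis.algebra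
    also have "\<dots> = 5" unfolding 1 e2 by simp
    finally have "36 * c = 5" .
    then show ?thesis by simp
  next
    case 2
    then have l: "8 * c * s = - 8 * c - 9" using r1 r2 r4 by Groebner_Basis.algebra
    \<comment> \<open>Substitute the value of \<open>s\<close> from \<open>l\<close>, with the denominator cleared.\<close>
    have "64 * c ^ 2 * (s ^ 2 + s + c + 2) = (8 * c * s) ^ 2 + 8 * c * (8 * c * s) + 64 * c ^ 3 + 128 * c ^ 2"
      by Groebner_Basis.algebra
    then have "(- 8 * c - 9) ^ 2 + 8 * c * (- 8 * c - 9) + 64 * c ^ 3 + 128 * c ^ 2 = 0"
      unfolding l 2 by simp
    then have "64 * c ^ 3 + 128 * c ^ 2 + 72 * c + 81 = 0" by Groebner_Basis.algebra
    then show ?thesis by simp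
  qed
qed

text \<open>
  The sums \<open>a\<close> and \<open>b\<close> of opposite points satisfy \<open>a b = -1\<close>, and the products of opposite points are
  polynomials in \<open>a\<close>, \<open>b\<close> and \<open>c\<close>. The sum \<open>s = a + b\<close> of the cycle is a root of
  \<open>s\<^sup>3 + (4 c + 3) s + 4\<close>, while the multiplier is \<open>8 c s\<^sup>2 + 8 c s + 16 (c\<^sup>2 + c + 1)\<close>. Eliminating \<open>s\<close>
  gives \<open>\<delta>\<^sub>4(1)\<close>, whose first two factors belong to bifurcations of cycles of period \<open>2\<close> and \<open>1\<close>.
\<close>

lemma four_cycle_algebra:
  fixes x y z w c :: complex
  assumes "y = x ^ 2 + c" "z = y ^ 2 + c" "w = z ^ 2 + c" "x = w ^ 2 + c" "x \<noteq> z" "16 * (x * y * z * w) = 1"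
  shows "(4 * c + 5) * (16 * c ^ 2 - 8 * c + 5) * (64 * c ^ 3 + 144 * c ^ 2 + 108 * c + 135) = 0"
proof -
  define a where "a = x + z"
  define b where "b = y + w"
  define p where "p = x * z"
  define q where "q = y * w"
  define s where "s = a + b"
  have "(x - z) * (a * b + 1) = 0" using assms(1-4) unfolding a_def b_def by Groebner_Basis.algebra
  then have ab: "a * b = - 1" using assms(5) by (simp add: eq_neg_iff_add_eq_0)
  have p: "2 * p = a ^ 2 - b + 2 * c" using assms(1-4) unfolding a_def b_def p_def by Groebner_Basis.algebra
  have q: "2 * q = b ^ 2 - a + 2 * c" using assms(1-4) unfolding a_def b_def q_def by Groebner_Basis.algebra
  have yw: "b ^ 2 - 4 * q = (a ^ 2 - 4 * p) * a ^ 2"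
    using assms(1-4) unfolding a_def b_def p_def q_def by Groebner_Basis.algebra
  have pq: "16 * (p * q) = 1" using assms(6) unfolding p_def q_def by Groebner_Basis.algebra
  have a0: "a \<noteq> 0" using ab by auto
  have "a ^ 3 * (s ^ 3 + (4 * c + 3) * s + 4) = 0"
    using ab p q yw unfolding s_def by Groebner_Basis.algebra
  then have A: "s ^ 3 + (4 * c + 3) * s + 4 = 0" using a0 by simp
  have "16 * (p * q) = 4 * ((2 * p) * (2 * q))" by simp
  then have B0: "4 * ((a ^ 2 - b + 2 * c) * (b ^ 2 - a + 2 * c)) = 1" using pq unfolding p q by simp
  have B: "8 * c * s ^ 2 + 8 * c * s + (16 * c ^ 2 + 16 * c + 15) = 0"
    using B0 ab A unfolding s_def by Groebner_Basis.algebra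
  \<comment> \<open>Remainder of \<open>8 c\<close> times the cubic \<open>A\<close> on division by the quadratic \<open>B\<close>.\<close>
  have L: "(16 * c ^ 2 + 16 * c - 15) * s + (16 * c ^ 2 + 48 * c + 15) = 0"
    using A B by Groebner_Basis.algebra
  define P where "P = 16 * c ^ 2 + 16 * c - 15"
  define Q where "Q = 16 * c ^ 2 + 48 * c + 15"
  have "P * s + Q = 0" using L unfolding P_def Q_def .
  then have Ps: "P * s = - Q" by (rule eq_neg_iff_add_eq_0[THEN iffD2])
  \<comment> \<open>Substitute \<open>s = - Q / P\<close> into \<open>B\<close>, with the denominator cleared.\<close>
  have "8 * c * (P * s) ^ 2 + 8 * c * P * (P * s) + (16 * c ^ 2 + 16 * c + 15) * P ^ 2 =
      P ^ 2 * (8 * c * s ^ 2 + 8 * c * s + (16 * c ^ 2 + 16 * c + 15))" by Groebner_Basis.algebra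
  then have "8 * c * Q ^ 2 - 8 * c * P * Q + (16 * c ^ 2 + 16 * c + 15) * P ^ 2 = 0"
    unfolding B Ps by simp
  then show ?thesis unfolding P_def Q_def by Groebner_Basis.algebra
qed

theorem proposition6p7:
  fixes \<gamma> :: complex
  assumes "\<And>n m. n > 0 \<Longrightarrow> m > 0 \<Longrightarrow> m dvd n \<Longrightarrow> degree (Delta n m) > 0 \<Longrightarrow>
             irreducible (map_poly rat_of_int (Delta n m))"
    and "parabolic_parameter \<gamma>"
    and "has_degree_over_rat \<gamma> 3"
  shows "64 * \<gamma> ^ 3 + 128 * \<gamma> ^ 2 + 72 * \<gamma> + 81 = 0 \<or>
         64 * \<gamma> ^ 3 + 144 * \<gamma> ^ 2 + 108 * \<gamma> + 135 = 0"
proof -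
  let ?f = "quad \<gamma>"
  interpret g: int_poly_hom "eval_at \<gamma>" by (rule int_poly_hom_eval_at)
  have low: False if "q \<noteq> 0" "degree q < 3" "poly (map_poly of_rat q) \<gamma> = 0" for q :: "rat poly"
    using minimal_degree[OF assms(3) that(1,3)] that(2) by simp
  have deg: "degree (Delta n k) = 3" if "n > 0" "k dvd n" "eval_at \<gamma> (Delta n k) = 0" for n k
    using degree_irreducible_root[OF assms(3) Delta_nonzero[OF that(1,2)] that(3)]
      assms(1)[OF that(1) dvd_pos_nat[OF that(1,2)] that(2)] by blast
  have three: ?thesis if "has_exact_period ?f 3 a" "multiplier \<gamma> 3 a = - 1" for a
  proof -
    have per: "?f (?f (?f a)) = a" "?f a \<noteq> a"
      using that(1) by (auto simp: has_exact_period_def numeral_3_eq_3)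
    have "64 * \<gamma> ^ 3 + 128 * \<gamma> ^ 2 + 72 * \<gamma> + 81 = 0 \<or> 36 * \<gamma> = 5"
      by (rule three_cycle_algebra[of "?f a" a \<gamma> "?f (?f a)"])
        (use per that(2) in \<open>simp_all add: multiplier_3 quad_def\<close>)
    moreover have "36 * \<gamma> \<noteq> 5" using low[of "[:-5, 36:]"] by (auto simp: map_poly_pCons mult.commute)
    ultimately show ?thesis by blast
  qed
  obtain \<alpha> m k where \<alpha>: "has_exact_period ?f m \<alpha>" and k: "k > 0" "multiplier \<gamma> m \<alpha> ^ k = 1"
    using assms(2) unfolding parabolic_parameter_def root_of_unity_def quad_eq deriv_quad_iterate by blast
  have m: "m > 0" using \<alpha> by (simp add: has_exact_period_def)
  define l where "l = multiplier \<gamma> m \<alpha>"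
  \<comment> \<open>The order of the multiplier decides between the two kinds of polynomials.\<close>
  define r where "r = (LEAST k. k > 0 \<and> l ^ k = 1)"
  have r: "r > 0" "l ^ r = 1"
    using LeastI[of "\<lambda>k. k > 0 \<and> l ^ k = 1" k] k unfolding r_def l_def by auto
  have rmin: "l ^ j \<noteq> 1" if "0 < j" "j < r" for j
    using not_less_Least[of j "\<lambda>k. k > 0 \<and> l ^ k = 1"] that unfolding r_def by auto
  have "poly (map_poly (eval_at \<gamma>) (delta m)) l ^ m = 0"
    unfolding delta_at_power[OF m] using exact_period_imp_dynatomic_roots[OF \<alpha>]
    by (auto simp: prod_mset_zero_iff l_def)
  then have dl: "poly (map_poly (eval_at \<gamma>) (delta m)) l = 0" by simp
  show ?thesis
  proof (cases "r = 1")
    case False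
    then have r1: "r > 1" using r(1) by simp
    obtain j where j: "j \<in> totatives r" "l = unity_root r j" using cyclotomic_root[OF r rmin] by blast
    have "eval_at \<gamma> (Delta_res (m * r) m) = 0"
      unfolding eval_at_Delta_res[OF m r(1)] using j dl by (auto simp: prod_zero_iff)
    moreover have "Delta (m * r) m = Delta_res (m * r) m" using m r1 by (simp add: Delta_def)
    ultimately have "degree (Delta (m * r) m) = 3" using m r1 by (intro deg) simp_all
    then have mr: "m = 3" "r = 2" using degree_Delta_proper_eq_3[OF m r1] by blast+
    have "l ^ 2 = 1" "l \<noteq> 1" using r(2) rmin[of 1] unfolding mr by simp_all
    then have "l = - 1" by (simp add: power2_eq_1_iff)
    then show ?thesis using three \<alpha> unfolding mr l_def by blast
  next
    case True
    then have l1: "l = 1" using r(2) by simp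
    have "eval_at \<gamma> (poly (delta m) 1) = 0"
      using dl hom_poly[OF g.comm_ring_hom_axioms, of "delta m" 1] unfolding l1 by simp
    then have "eval_at \<gamma> (Delta m m) = 0 \<or> (\<exists>k. k dvd m \<and> k \<noteq> m \<and> eval_at \<gamma> (Delta m k) = 0)"
      unfolding Delta_self[OF m] g.hom_mult g.hom_prod using m by (auto simp: prod_zero_iff)
    then show ?thesis
    proof
      assume "eval_at \<gamma> (Delta m m) = 0"
      then have "degree (Delta m m) = 3" using m by (intro deg) simp_all
      \<comment> \<open>The point \<open>\<alpha>\<close> itself has exact period \<open>4\<close>; the extra factors of \<open>\<delta>\<^sub>4(1)\<close> have degree at most \<open>2\<close>.\<close>
      then have m4: "m = 4" by (rule degree_Delta_self_eq_3[OF m])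
      have "(?f ^^ 4) \<alpha> = \<alpha>" "(?f ^^ 2) \<alpha> \<noteq> \<alpha>" using \<alpha> unfolding has_exact_period_def m4 by auto
      then have per: "?f (?f (?f (?f \<alpha>))) = \<alpha>" "?f (?f \<alpha>) \<noteq> \<alpha>"
        by (simp_all add: numeral_nat)
      have "(4 * \<gamma> + 5) * (16 * \<gamma> ^ 2 - 8 * \<gamma> + 5) * (64 * \<gamma> ^ 3 + 144 * \<gamma> ^ 2 + 108 * \<gamma> + 135) = 0"
        by (rule four_cycle_algebra[of "?f \<alpha>" \<alpha> \<gamma> "?f (?f \<alpha>)" "?f (?f (?f \<alpha>))"])
          (use per l1 in \<open>simp_all add: l_def m4 multiplier_4 quad_def\<close>)
      moreover have "4 * \<gamma> + 5 \<noteq> 0"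
        using low[of "[:5, 4:]"] by (auto simp: map_poly_pCons algebra_simps)
      moreover have "16 * \<gamma> ^ 2 - 8 * \<gamma> + 5 \<noteq> 0"
        using low[of "[:5, - 8, 16:]"] by (auto simp: map_poly_pCons power2_eq_square algebra_simps)
      ultimately show ?thesis by simp
    next
      assume "\<exists>k. k dvd m \<and> k \<noteq> m \<and> eval_at \<gamma> (Delta m k) = 0"
      then obtain k where k: "k dvd m" "k \<noteq> m" "eval_at \<gamma> (Delta m k) = 0" by blast
      then have k0: "k > 0" using dvd_pos_nat[OF m] by blast
      obtain t where t: "m = k * t" using k(1) by (rule dvdE)
      then have t1: "t > 1" using k(2) m by (cases t; cases "t = 1") auto
      have "degree (Delta (k * t) k) = 3" using deg[OF m k(1,3)] unfolding t .
      then have kt: "k = 3" "t = 2" using degree_Delta_proper_eq_3[OF k0 t1] by blast+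
      have "Delta m k = Delta_res (3 * 2) 3" unfolding t kt by (simp add: Delta_def)
      then have "(\<Prod>j\<in>totatives 2. poly (map_poly (eval_at \<gamma>) (delta 3)) (unity_root 2 j)) = 0"
        using k(3) eval_at_Delta_res[of 3 2 \<gamma>] by simp
      moreover have "totatives 2 = {1 :: nat}" by (auto simp: totatives_def intro: antisym) presburger
      moreover have "unity_root 2 1 = - 1" by (simp add: unity_root_def)
      ultimately have "poly (map_poly (eval_at \<gamma>) (delta 3)) (- 1) ^ 3 = 0" by simp
      then obtain a where a: "a \<in># dynatomic_roots \<gamma> 3" "multiplier \<gamma> 3 a = - 1"
        unfolding delta_at_power[OF zero_less_numeral] by (auto simp: prod_mset_zero_iff)
      \<comment> \<open>Being a root of the third dynatomic polynomial does not guarantee exact period \<open>3\<close>.\<close>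
      have fa: "(?f ^^ 3) a = a" by (rule dynatomic_roots_periodic[OF zero_less_numeral a(1)])
      obtain d where d: "d dvd 3" "has_exact_period ?f d a" using exact_period_exists[OF fa] by auto
      have "prime (3 :: nat)" by simp
      then have "d = 1 \<or> d = 3" using d(1) by (metis prime_nat_iff)
      then show ?thesis
      proof
        assume "d = 3"
        then show ?thesis using three d(2) a(2) by blast
      next
        assume "d = 1"
        then have fix1: "?f a = a" using d(2) by (simp add: has_exact_period_def)
        \<comment> \<open>A fixed point \<open>a\<close> with \<open>(2 a)\<^sup>3 = -1\<close> is at most quadratic, and then so is \<open>\<gamma>\<close>.\<close>
        have c: "\<gamma> = a - a ^ 2" using fix1 by (simp add: quad_def algebra_simps)
        have "8 * (a * a * a) = - 1" using a(2) unfolding multiplier_3 fix1 .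
        then have "(4 * \<gamma> + 3) * (16 * \<gamma> ^ 2 - 12 * \<gamma> + 3) = 0" unfolding c by Groebner_Basis.algebra
        moreover have "4 * \<gamma> + 3 \<noteq> 0"
          using low[of "[:3, 4:]"] by (auto simp: map_poly_pCons algebra_simps)
        moreover have "16 * \<gamma> ^ 2 - 12 * \<gamma> + 3 \<noteq> 0"
          using low[of "[:3, - 12, 16:]"] by (auto simp: map_poly_pCons power2_eq_square algebra_simps)
        ultimately show ?thesis by simp
      qed
    qed
  qed
qed

end
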